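(* Let $Q$ be a finite connected acyclic quiver with vertices $1,\dots,n$ such that $i<j$ whenever there is an arrow $i\to j$ in $Q$, and assume $Q$ is not a linearly oriented quiver of type $\mathbb A_n$. Let $\mathcal A_Q$ be the coefficient-free cluster algebra with initial seed $((y_1,\dots,y_n),B_Q)$. Perform the sequence of mutations $\mu_n\cdots\mu_2\mu_1$ (first in direction $1$, then $2$, …, then $n$) starting with this seed, and let $y_k^\dagger$ be the new cluster variable obtained in the $k$-th step. Then the monomials $$\{\,y_1^{p_1}(y_1^\dagger)^{q_1}\cdots y_n^{p_n}(y_n^\dagger)^{q_n}\mid p_i,q_i\ge0,\ p_iq_i=0\,\}$$ form a $\mathbb C$-basis of the acyclic cluster algebra $\mathcal A_Q$.
   Context: $B_Q=(b_{ij})_{1\le i,j\le n}$ with $b_{ij}=\#\{\text{arrows }j\to i\text{ in }Q\}-\#\{\text{arrows }i\to j\text{ in }Q\}$. $\mathcal A_Q$ is the Fomin–Zelevinsky cluster algebra over $\mathbb C$ without coefficients: the subalgebra of $\mathbb C(y_1,\dots,y_n)$ generated by all cluster variables of all seeds obtained from $((y_1,\dots,y_n),B_Q)$ by iterated mutation. Mutation in direction $k$ of a seed $((u_1,\dots,u_n),(b_{ij}))$ replaces $u_k$ by $u_k^*=\bigl(\prod_{b_{ik}>0}u_i^{b_{ik}}+\prod_{b_{ik}<0}u_i^{-b_{ik}}\bigr)/u_k$ and $(b_{ij})$ by $(b'_{ij})$, where $b'_{ij}=-b_{ij}$ if $i=k$ or $j=k$ and $b'_{ij}=b_{ij}+\frac{|b_{ik}|b_{kj}+b_{ik}|b_{kj}|}{2}$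 otherwise. *)

theory Defs
  imports
    Complex_Main
    "HOL-Library.FuncSet"
    "HOL-Library.Poly_Mapping"
    "HOL-Computational_Algebra.Polynomial_Factorial"
    "Graph_Theory.Digraph_Component"
begin

text \<open>
  A quiver is a \<^typ>\<open>('v, 'e) pre_digraph\<close> (parallel arrows allowed), an arrow
  \<^term>\<open>e\<close> going from \<^term>\<open>tail Q e\<close> to \<^term>\<open>head Q e\<close>.
\<close>

definition num_arrows :: "('v, 'e) pre_digraph \<Rightarrow> 'v \<Rightarrow> 'v \<Rightarrow> nat" where
  "num_arrows Q i j = card {e \<in> arcs Q. tail Q e = i \<and> head Q e = j}"

text \<open>
  The quiver is \<open>v\<^sub>1 \<rightarrow> v\<^sub>2 \<rightarrow> \<dots> \<rightarrow> v\<^sub>n\<close>, with exactly one arrow from \<open>v\<^sub>i\<close> to \<open>v\<^sub>i\<^sub>+\<^sub>1\<close>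
  and no other arrows.
\<close>

definition linearly_oriented_A :: "('v, 'e) pre_digraph \<Rightarrow> bool" where
  "linearly_oriented_A Q \<longleftrightarrow>
     (\<exists>v. bij_betw v {1..card (verts Q)} (verts Q) \<and>
          bij_betw (arc_to_ends Q) (arcs Q)
            {(v i, v (i + 1)) | i :: nat. 1 \<le> i \<and> i < card (verts Q)})"

definition B_matrix :: "('v, 'e) pre_digraph \<Rightarrow> 'v \<Rightarrow> 'v \<Rightarrow> int" where
  "B_matrix Q i j = int (num_arrows Q j i) - int (num_arrows Q i j)"

text \<open>
  The field \<open>\<complex>(y\<^sub>0, y\<^sub>1, y\<^sub>2, \<dots>)\<close> of rational functions: fractions of polynomials, a polynomial
  being a finitely supported family of coefficients indexed by finitely supported exponent
  vectors.  It contains \<open>\<complex>(y\<^sub>1, \<dots>, y\<^sub>n)\<close> for every \<open>n\<close>, and a subalgebra generated by elements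
  of the latter does not depend on which of the two fields is taken as ambient field.
\<close>

type_synonym ratfun = "((nat \<Rightarrow>\<^sub>0 nat) \<Rightarrow>\<^sub>0 complex) fract"

definition yvar :: "nat \<Rightarrow> ratfun" where
  "yvar i = to_fract (Poly_Mapping.single (Poly_Mapping.single i 1) 1)"

definition const :: "complex \<Rightarrow> ratfun" where
  "const c = to_fract (Poly_Mapping.single 0 c)"

global_interpretation ratfun: vector_space "\<lambda>c (f :: ratfun). const c * f"
  defines ratfun_span = ratfun.span
    and ratfun_dependent = ratfun.dependent
    and ratfun_subspace = ratfun.subspace
proof unfold_locales
  fix a b :: complex and x y :: ratfun
  show "const a * (x + y) = const a * x + const a * y"
    by (rule distrib_left)
  show "const (a + b) * x = const a * x + const b * x"
    by (simp add: const_def single_add distrib_right)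
  have "const a * const b = const (a * b)"
    by (simp add: const_def mult_single flip: to_fract_mult)
  then show "const a * (const b * x) = const (a * b) * x"
    by (simp flip: mult.assoc)
  show "const 1 * x = x"
    by (simp add: const_def)
qed

definition is_subalgebra :: "ratfun set \<Rightarrow> bool" where
  "is_subalgebra S \<longleftrightarrow> ratfun_subspace S \<and> 1 \<in> S \<and> (\<forall>x\<in>S. \<forall>y\<in>S. x * y \<in> S)"

text \<open>
  A seed with finite index set \<open>I\<close> is a pair of a cluster and an exchange matrix, of which only
  the entries with indices in \<open>I\<close> matter.
\<close>

type_synonym ('i, 'a) seed = "('i \<Rightarrow> 'a) \<times> ('i \<Rightarrow> 'i \<Rightarrow> int)"

text \<open>The division by 2 is exact, the numerator being always even.\<close>

definition mutate_matrix :: "'i \<Rightarrow> ('i \<Rightarrow> 'i \<Rightarrow> int) \<Rightarrow> 'i \<Rightarrow> 'i \<Rightarrow> int" where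
  "mutate_matrix k b i j =
     (if i = k \<or> j = k then - b i j
      else b i j + (\<bar>b i k\<bar> * b k j + b i k * \<bar>b k j\<bar>) div 2)"

definition mutate :: "'i set \<Rightarrow> 'i \<Rightarrow> ('i, 'a::field) seed \<Rightarrow> ('i, 'a) seed" where
  "mutate I k = (\<lambda>(u, b).
     (u(k := ((\<Prod>i\<in>{i\<in>I. b i k > 0}. u i ^ nat (b i k)) +
              (\<Prod>i\<in>{i\<in>I. b i k < 0}. u i ^ nat (- b i k))) / u k),
      mutate_matrix k b))"

inductive_set mutation_class :: "'i set \<Rightarrow> ('i, 'a::field) seed \<Rightarrow> ('i, 'a) seed set"
  for I s0 where
    initial: "s0 \<in> mutation_class I s0"
  | step: "s \<in> mutation_class I s0 \<Longrightarrow> k \<in> I \<Longrightarrow> mutate I k s \<in> mutation_class I s0"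

definition initial_seed :: "(nat, 'e) pre_digraph \<Rightarrow> (nat, ratfun) seed" where
  "initial_seed Q = (yvar, B_matrix Q)"

definition cluster_variables :: "(nat, 'e) pre_digraph \<Rightarrow> ratfun set" where
  "cluster_variables Q =
     {fst s i | s i. s \<in> mutation_class (verts Q) (initial_seed Q) \<and> i \<in> verts Q}"

definition cluster_algebra :: "(nat, 'e) pre_digraph \<Rightarrow> ratfun set" where
  "cluster_algebra Q = is_subalgebra hull cluster_variables Q"

text \<open>\<^term>\<open>fold\<close> applies the mutation in direction 1 first and the one in direction \<^term>\<open>k\<close> last.\<close>

definition y_dagger :: "(nat, 'e) pre_digraph \<Rightarrow> nat \<Rightarrow> ratfun" where
  "y_dagger Q k = fst (fold (mutate (verts Q)) [1..<k + 1] (initial_seed Q)) k"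

text \<open>
  Exponents \<open>(p, q)\<close> with \<open>p\<^sub>i q\<^sub>i = 0\<close>; the functions are made extensional so that each pair of
  exponent vectors occurs exactly once.
\<close>

definition dagger_exponents :: "nat \<Rightarrow> ((nat \<Rightarrow> nat) \<times> (nat \<Rightarrow> nat)) set" where
  "dagger_exponents n =
     {(p, q). p \<in> {1..n} \<rightarrow>\<^sub>E UNIV \<and> q \<in> {1..n} \<rightarrow>\<^sub>E UNIV \<and> (\<forall>i\<in>{1..n}. p i * q i = 0)}"

definition dagger_monomial ::
  "(nat, 'e) pre_digraph \<Rightarrow> nat \<Rightarrow> (nat \<Rightarrow> nat) \<times> (nat \<Rightarrow> nat) \<Rightarrow> ratfun" where
  "dagger_monomial Q n = (\<lambda>(p, q). \<Prod>i\<in>{1..n}. yvar i ^ p i * y_dagger Q i ^ q i)"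

end

theory Submission
  imports Defs
begin

text \<open>
  Coefficient-free exchange polynomials may have common factors, and then a Laurent polynomial that
  stays Laurent after each single mutation need not stay Laurent after two.  The remedy is to work
  in a generic deformation: every vertex \<open>k\<close> gets its own frozen variable \<open>x\<^sub>n\<^sub>+\<^sub>k\<close>, which enlarges
  the exchange matrix by an identity block.  The columns of the enlarged matrix are linearly
  independent, mutation preserves this, and independent columns have coprime exchange polynomials.
  Setting the frozen variables to 1 leads back to the given seed.

  In a seed of the deformation, the upper bound consists of the Laurent polynomials in the cluster
  that remain Laurent polynomials after a mutation in any single direction.  By coprimality the
  substitution \<open>x\<^sub>k \<mapsto> P\<^sub>k / x\<^sub>k\<close> carries the upper bound of a mutated seed into that of the seed
  itself (\<open>upper_bound_mutate\<close>).  Following a path of mutations back to the initial seed, every cluster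
  variable of \<open>Q\<close> becomes a specialised element of the initial upper bound
  (\<open>cluster_variable_upper_bound\<close>).

  For an acyclic seed the upper bound is generated, over the frozen Laurent monomials, by the \<open>x\<^sub>k\<close>
  and the \<open>z\<^sub>k = P\<^sub>k / x\<^sub>k\<close> (\<open>upper_bound_subset_lower_bound\<close>).  This is proved by unfreezing the
  vertices one at a time.  The least vertex \<open>t\<close> of the mutable part is a source of it, so the trailing
  exponents of the standard monomials in the remaining generators do not involve \<open>x\<^sub>t\<close>.  These
  exponents are triangular, hence the standard monomials stay linearly independent at \<open>x\<^sub>t = 0\<close>, which
  makes division by \<open>x\<^sub>t\<close> possible (\<open>lower_bound_divide\<close>).  Coprimality enters once more, to divide
  values at \<open>x\<^sub>t = 0\<close> by \<open>P\<^sub>t\<close> (\<open>lower_bound_quotient\<close>).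

  Each step of \<open>\<mu>\<^sub>n \<dots> \<mu>\<^sub>1\<close> mutates at a source, whence
  \<open>y\<^sub>k y\<^sub>k\<^sup>\<dagger> = 1 + \<Prod>\<^bsub>i<k\<^esub> (y\<^sub>i\<^sup>\<dagger>)\<^bsup>a(i,k)\<^esup> \<Prod>\<^bsub>i>k\<^esub> y\<^sub>i\<^bsup>a(k,i)\<^esup>\<close> with \<open>a(i,j)\<close> the number of arrows
  (\<open>dagger_exchange\<close>).  Read as a rewriting rule, this relation expresses all products of the \<open>y\<^sub>k\<close> and
  \<open>y\<^sub>k\<^sup>\<dagger>\<close> by dagger monomials; it terminates because suitable positive weights decrease.  Each
  specialised \<open>z\<^sub>k\<close> is a polynomial in the \<open>y\<^sub>i\<close> and \<open>y\<^sub>i\<^sup>\<dagger>\<close> (\<open>ev_z_in_dagger_span\<close>), so the dagger monomials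
  span the cluster algebra.  They are linearly independent since the lexicographically
  largest monomial of \<open>y\<^sub>k\<^sup>\<dagger>\<close> is \<open>y\<^sub>k\<^sup>-\<^sup>1\<close> times a monomial in later variables (\<open>dagger_trailing\<close>), so
  that distinct dagger monomials have distinct leading exponents.
\<close>

section \<open>Laurent polynomials and their gradings\<close>

type_synonym laurent = "(nat \<Rightarrow>\<^sub>0 int) \<Rightarrow>\<^sub>0 complex"

abbreviation "keys \<equiv> Poly_Mapping.keys"
abbreviation "lookup \<equiv> Poly_Mapping.lookup"
abbreviation "single \<equiv> Poly_Mapping.single"

abbreviation X :: "(nat \<Rightarrow>\<^sub>0 int) \<Rightarrow> laurent" where
  "X e \<equiv> single e 1"

text \<open>
  The rings below are all given as sets of finite sums of explicit generators.  Scalars are part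
  of the generators, so closure under addition suffices, and a ring is obtained as soon as the
  generators are closed under products.
\<close>

inductive_set add_closure :: "'a::comm_monoid_add set \<Rightarrow> 'a set" for S where
  zero: "0 \<in> add_closure S"
| add: "s \<in> S \<Longrightarrow> f \<in> add_closure S \<Longrightarrow> s + f \<in> add_closure S"

lemma add_closure_base: "s \<in> S \<Longrightarrow> s \<in> add_closure S"
  using add_closure.add[OF _ add_closure.zero] by fastforce

lemma add_closure_add:
  assumes "f \<in> add_closure S" "g \<in> add_closure S"
  shows "f + g \<in> add_closure S"
  using assms by induction (auto simp: add.assoc intro: add_closure.add)

lemma add_closure_sum:
  assumes "\<And>i. i \<in> A \<Longrightarrow> f i \<in> add_closure S"
  shows "sum f A \<in> add_closure S"
  using assms
  by (induction A rule: infinite_finite_induct) (auto intro: add_closure_add add_closure.zero)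

lemma add_closure_mult:
  fixes f g :: "'a::comm_semiring_1"
  assumes "f \<in> add_closure S" "g \<in> add_closure T" "\<And>s t. s \<in> S \<Longrightarrow> t \<in> T \<Longrightarrow> s * t \<in> add_closure U"
  shows "f * g \<in> add_closure U"
  using assms(1)
proof induction
  case zero
  then show ?case by (simp add: add_closure.zero)
next
  case (add s f)
  note s = add(1)
  have "s * g \<in> add_closure U"
    using assms(2)
    by induction (auto simp: distrib_left intro: add_closure_add add_closure.zero assms(3)[OF s])
  then show ?case using add by (simp add: distrib_right add_closure_add)
qed

lemma power_closed:
  fixes f :: "'a::comm_semiring_1"
  assumes "\<And>f g. f \<in> S \<Longrightarrow> g \<in> S \<Longrightarrow> f * g \<in> S" "1 \<in> S" "f \<in> S"
  shows "f ^ n \<in> S"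
  by (induction n) (use assms in auto)

lemma poly_mapping_sum_single: "(\<Sum>e\<in>keys f. single e (lookup f e)) = f"
proof (rule poly_mapping_eqI)
  fix e
  show "lookup (\<Sum>e\<in>keys f. single e (lookup f e)) e = lookup f e"
    by (simp add: lookup_sum lookup_single when_def in_keys_iff)
qed

lemma poly_mapping_single_induct [case_names zero add]:
  fixes f :: "'a \<Rightarrow>\<^sub>0 'b::comm_monoid_add"
  assumes "P 0" "\<And>e c f. P f \<Longrightarrow> P (single e c + f)"
  shows "P f"
proof -
  have "P (\<Sum>e\<in>A. single e (lookup f e))" if "finite A" for A
    using that by induction (auto intro: assms)
  from this[of "keys f"] show ?thesis by (simp add: poly_mapping_sum_single)
qed

lemma X_add: "X (a + b) = X a * X b"
  by (simp add: mult_single)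

lemma X_uminus: "X a * X (- a) = 1"
  by (simp flip: X_add)

lemma X_of_nat_mult: "X (frag_cmul (int n) a) = X a ^ n"
proof (induction n)
  case (Suc n)
  have "frag_cmul (int (Suc n)) a = a + frag_cmul (int n) a"
    by (simp add: frag_cmul_distrib)
  then show ?case by (simp add: X_add Suc)
qed auto

text \<open>
  Divisibility by an element that is homogeneous for a grading is tested on graded parts.  The
  gradings used are the degree in one variable and, for coprimality, a degree adapted to a pair
  of exchange polynomials.
\<close>

definition graded_part :: "('a \<Rightarrow> int) \<Rightarrow> int \<Rightarrow> ('a \<Rightarrow>\<^sub>0 'b) \<Rightarrow> ('a \<Rightarrow>\<^sub>0 'b::comm_monoid_add)" where
  "graded_part \<phi> a f = (\<Sum>e\<in>{e\<in>keys f. \<phi> e = a}. single e (lookup f e))"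

lemma lookup_graded_part: "lookup (graded_part \<phi> a f) e = (if \<phi> e = a then lookup f e else 0)"
  by (auto simp: graded_part_def lookup_sum lookup_single when_def in_keys_iff)

lemma graded_part_add: "graded_part \<phi> a (f + g) = graded_part \<phi> a f + graded_part \<phi> a g"
  by (rule poly_mapping_eqI) (simp add: lookup_graded_part lookup_add)

lemma graded_part_zero [simp]: "graded_part \<phi> a 0 = 0"
  by (rule poly_mapping_eqI) (simp add: lookup_graded_part)

lemma graded_part_diff: "graded_part \<phi> a (f - g) = graded_part \<phi> a f - graded_part \<phi> a (g :: _ \<Rightarrow>\<^sub>0 _::ab_group_add)"
  by (rule poly_mapping_eqI) (simp add: lookup_graded_part lookup_minus)

lemma graded_part_single: "graded_part \<phi> a (single e c) = (if \<phi> e = a then single e c else 0)"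
  by (rule poly_mapping_eqI) (simp add: lookup_graded_part lookup_single when_def)

lemma graded_part_graded_part: "graded_part \<phi> a (graded_part \<psi> b f) = graded_part \<psi> b (graded_part \<phi> a f)"
  by (rule poly_mapping_eqI) (simp add: lookup_graded_part)

lemma graded_part_idem: "graded_part \<phi> a (graded_part \<phi> b f) = (if a = b then graded_part \<phi> b f else 0)"
  by (rule poly_mapping_eqI) (simp add: lookup_graded_part)

lemma keys_graded_part: "keys (graded_part \<phi> a f) = {e\<in>keys f. \<phi> e = a}"
  by (auto simp: in_keys_iff lookup_graded_part split: if_splits)

lemma sum_graded_part:
  assumes "finite A" "\<phi> ` keys f \<subseteq> A"
  shows "(\<Sum>a\<in>A. graded_part \<phi> a f) = f"
proof (rule poly_mapping_eqI)
  fix e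
  have "(\<Sum>a\<in>A. if \<phi> e = a then lookup f e else 0) = (if \<phi> e \<in> A then lookup f e else 0)"
    using assms(1) by simp
  also have "\<dots> = lookup f e"
    using assms(2) by (auto simp: in_keys_iff image_subset_iff)
  finally show "lookup (\<Sum>a\<in>A. graded_part \<phi> a f) e = lookup f e"
    by (simp add: lookup_sum lookup_graded_part)
qed

definition homogeneous :: "('a \<Rightarrow> int) \<Rightarrow> int \<Rightarrow> ('a \<Rightarrow>\<^sub>0 'b::zero) \<Rightarrow> bool" where
  "homogeneous \<phi> d f \<longleftrightarrow> (\<forall>e\<in>keys f. \<phi> e = d)"

lemma homogeneous_single: "\<phi> e = d \<Longrightarrow> homogeneous \<phi> d (single e c)"
  by (auto simp: homogeneous_def)

lemma homogeneous_add:
  "homogeneous \<phi> d f \<Longrightarrow> homogeneous \<phi> d g \<Longrightarrow> homogeneous \<phi> d (f + g)"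
  unfolding homogeneous_def using keys_add[of f g] by auto

lemma graded_part_homogeneous: "homogeneous \<phi> d f \<Longrightarrow> graded_part \<phi> a f = (if a = d then f else 0)"
  by (rule poly_mapping_eqI) (auto simp: homogeneous_def lookup_graded_part in_keys_iff)

locale grading =
  fixes \<phi> :: "(nat \<Rightarrow>\<^sub>0 int) \<Rightarrow> int"
  assumes grading_add: "\<phi> (e + e') = \<phi> e + \<phi> e'"
begin

lemma grading_zero [simp]: "\<phi> 0 = 0"
  using grading_add[of 0 0] by simp

lemma grading_uminus: "\<phi> (- e) = - \<phi> e"
  using grading_add[of e "- e"] by simp

lemma homogeneous_mult:
  assumes "homogeneous \<phi> d f" "homogeneous \<phi> d' (g :: laurent)"
  shows "homogeneous \<phi> (d + d') (f * g)"
  unfolding homogeneous_def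
proof
  fix e assume "e \<in> keys (f * g)"
  then obtain a b where "e = a + b" "a \<in> keys f" "b \<in> keys g"
    using keys_mult[of f g] by blast
  then show "\<phi> e = d + d'" using assms by (simp add: homogeneous_def grading_add)
qed

lemma homogeneous_power:
  assumes "homogeneous \<phi> 0 (f :: laurent)"
  shows "homogeneous \<phi> 0 (f ^ n)"
  using homogeneous_mult[OF assms, of 0]
  by (induction n) (auto simp: homogeneous_def)

lemma graded_part_single_mult:
  "graded_part \<phi> a (single e c * f) = single e c * graded_part \<phi> (a - \<phi> e) (f :: laurent)"
proof (induction f rule: poly_mapping_single_induct)
  case (add e' c' f)
  then show ?case
    by (auto simp: distrib_left graded_part_add mult_single graded_part_single grading_add)
qed auto

lemma graded_part_homogeneous_mult:
  assumes "homogeneous \<phi> d h"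
  shows "graded_part \<phi> a (h * f) = h * graded_part \<phi> (a - d) (f :: laurent)"
proof -
  have "graded_part \<phi> a ((\<Sum>e\<in>A. single e (lookup h e)) * f) =
        (\<Sum>e\<in>A. single e (lookup h e)) * graded_part \<phi> (a - d) f" if "finite A" "A \<subseteq> keys h" for A
    using that
  proof induction
    case (insert e A)
    then show ?case using assms
      by (simp add: distrib_right graded_part_add graded_part_single_mult homogeneous_def)
  qed auto
  from this[of "keys h"] show ?thesis by (simp add: poly_mapping_sum_single)
qed

lemma dvd_graded_part:
  assumes "homogeneous \<phi> d h" "h dvd (f :: laurent)"
  shows "h dvd graded_part \<phi> a f"
  using assms by (auto simp: graded_part_homogeneous_mult elim!: dvdE)

text \<open>
  No factorisation theory is needed for coprimality: if \<open>Q\<close> is homogeneous and the two terms of the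
  binomial have different degrees, the graded part of \<open>h\<close> in each degree is, up to a unit and a multiple of
  the part in a lower degree, a graded part of the product.  As \<open>h\<close> has no parts of very
  low degree, induction on the degree applies.
\<close>

lemma binomial_coprime:
  assumes hom: "homogeneous \<phi> d Q"
    and ne: "\<phi> v \<noteq> \<phi> w"
    and dvd: "Q dvd (X v + X w) * (h :: laurent)"
  shows "Q dvd h"
proof -
  have *: "Q dvd h" if lt: "\<phi> v < \<phi> w" and dvd: "Q dvd (X v + X w) * (h :: laurent)" for v w
  proof -
    define m where "m = Min (insert 0 (\<phi> ` keys h))"
    have m: "\<phi> e \<ge> m" if "e \<in> keys h" for e
      using that by (auto simp: m_def)
    have "Q dvd graded_part \<phi> a h" for a
    proof (induction "nat (a - m + 1)" arbitrary: a rule: less_induct)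
      case less
      show ?case
      proof (cases "a < m")
        case True
        then have "graded_part \<phi> a h = 0"
          by (intro poly_mapping_eqI) (use m in \<open>force simp: lookup_graded_part in_keys_iff\<close>)
        then show ?thesis by simp
      next
        case False
        have "Q dvd graded_part \<phi> (a + \<phi> v) ((X v + X w) * h)"
          using dvd_graded_part[OF hom dvd] .
        also have "graded_part \<phi> (a + \<phi> v) ((X v + X w) * h) = X v * graded_part \<phi> a h + X w * graded_part \<phi> (a + \<phi> v - \<phi> w) h"
          by (simp add: distrib_right graded_part_add graded_part_single_mult)
        finally have "Q dvd X v * graded_part \<phi> a h + X w * graded_part \<phi> (a + \<phi> v - \<phi> w) h" .
        moreover have "Q dvd graded_part \<phi> (a + \<phi> v - \<phi> w) h"
          by (rule less) (use False lt in auto)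
        ultimately have "Q dvd X v * graded_part \<phi> a h"
          by (meson dvd_add_left_iff dvd_mult)
        then have "Q dvd X (- v) * (X v * graded_part \<phi> a h)" by simp
        then show ?thesis using X_uminus[of "- v"] by (simp flip: mult.assoc)
      qed
    qed
    then have "Q dvd (\<Sum>a\<in>\<phi> ` keys h. graded_part \<phi> a h)" by (simp add: dvd_sum)
    then show ?thesis by (simp add: sum_graded_part)
  qed
  show ?thesis
    using *[of v w] *[of w v] ne dvd by (auto simp: add.commute neq_iff)
qed

lemma binomial_coprime_power:
  assumes hom: "homogeneous \<phi> d Q"
    and ne: "\<phi> v \<noteq> \<phi> w"
    and dvd: "Q ^ a dvd (X v + X w) * (h :: laurent)"
  shows "Q ^ a dvd h"
  using dvd
proof (induction a arbitrary: h)
  case (Suc a)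
  show ?case
  proof (cases "Q = 0")
    case True
    then show ?thesis using Suc.prems binomial_coprime[OF hom ne, of h] by auto
  next
    case False
    have "Q dvd h"
      by (rule binomial_coprime[OF hom ne]) (use Suc.prems in \<open>auto intro: dvd_mult_left\<close>)
    then obtain h' where h: "h = Q * h'" by auto
    have "Q * Q ^ a dvd Q * ((X v + X w) * h')"
      using Suc.prems by (simp add: h mult_ac)
    then have "Q ^ a dvd (X v + X w) * h'" using False by (simp add: dvd_times_left_cancel_iff)
    then show ?thesis using Suc.IH[of h'] by (simp add: h mult_dvd_mono)
  qed
qed auto

end

interpretation deg: grading "\<lambda>e. lookup e k" for k
  by standard (simp add: lookup_add)

section \<open>Evaluation in the field of rational functions, and Laurent polynomials in two charts\<close>

lemma const_add: "const (a + b) = const a + const b"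
  by (simp add: const_def single_add)

lemma const_mult: "const (a * b) = const a * const b"
  by (simp add: const_def mult_single flip: to_fract_mult)

lemma const_0 [simp]: "const 0 = 0"
  by (simp add: const_def)

lemma const_1 [simp]: "const 1 = 1"
  by (simp add: const_def)

definition ev_monomial :: "(nat \<Rightarrow> 'a::field) \<Rightarrow> (nat \<Rightarrow>\<^sub>0 int) \<Rightarrow> 'a" where
  "ev_monomial u e = (\<Prod>i\<in>keys e. u i powi lookup e i)"

lemma ev_monomial_superset: "finite A \<Longrightarrow> keys e \<subseteq> A \<Longrightarrow> ev_monomial u e = (\<Prod>i\<in>A. u i powi lookup e i)"
  unfolding ev_monomial_def by (rule prod.mono_neutral_left) (auto simp: in_keys_iff)

lemma ev_monomial_0 [simp]: "ev_monomial u 0 = 1"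
  by (simp add: ev_monomial_def)

lemma ev_monomial_single: "ev_monomial u (single k m) = u k powi m"
  by (simp add: ev_monomial_def)

lemma ev_monomial_add:
  assumes "\<And>i. u i \<noteq> 0"
  shows "ev_monomial u (a + b) = ev_monomial u a * ev_monomial u b"
proof -
  let ?A = "keys a \<union> keys b"
  have "ev_monomial u (a + b) = (\<Prod>i\<in>?A. u i powi lookup (a + b) i)"
    by (rule ev_monomial_superset) (use keys_add[of a b] in auto)
  also have "\<dots> = (\<Prod>i\<in>?A. u i powi lookup a i) * (\<Prod>i\<in>?A. u i powi lookup b i)"
    by (simp add: lookup_add power_int_add assms prod.distrib)
  also have "\<dots> = ev_monomial u a * ev_monomial u b"
    by (simp add: ev_monomial_superset[of ?A])
  finally show ?thesis .
qed

lemma ev_monomial_upd: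
  assumes "u k \<noteq> 0"
  shows "ev_monomial (u(k := v)) e = ev_monomial u e * (v / u k) powi lookup e k"
proof -
  have "ev_monomial (u(k := v)) e = (\<Prod>i\<in>insert k (keys e). (u(k := v)) i powi lookup e i)"
    by (rule ev_monomial_superset) auto
  also have "\<dots> = v powi lookup e k * (\<Prod>i\<in>keys e - {k}. (u(k := v)) i powi lookup e i)"
    by (subst prod.insert_remove) auto
  also have "(\<Prod>i\<in>keys e - {k}. (u(k := v)) i powi lookup e i) = (\<Prod>i\<in>keys e - {k}. u i powi lookup e i)"
    by (rule prod.cong) auto
  also have "v powi lookup e k = (v / u k) powi lookup e k * u k powi lookup e k"
    using assms by (simp flip: power_int_mult_distrib)
  also have "(v / u k) powi lookup e k * u k powi lookup e k * (\<Prod>i\<in>keys e - {k}. u i powi lookup e i) =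
     (v / u k) powi lookup e k * (\<Prod>i\<in>insert k (keys e). u i powi lookup e i)"
    by (subst prod.insert_remove) (auto simp: mult_ac)
  also have "(\<Prod>i\<in>insert k (keys e). u i powi lookup e i) = ev_monomial u e"
    by (rule ev_monomial_superset[symmetric]) auto
  finally show ?thesis by (simp only: mult_ac)
qed

text \<open>
  Evaluation at an arbitrary family \<open>u\<close> of nonzero rational functions, algebraically independent or not.
  This freedom is what allows frozen variables to be evaluated at 1.
\<close>

definition ev :: "(nat \<Rightarrow> ratfun) \<Rightarrow> laurent \<Rightarrow> ratfun" where
  "ev u f = (\<Sum>e\<in>keys f. const (lookup f e) * ev_monomial u e)"

lemma ev_superset: "finite A \<Longrightarrow> keys f \<subseteq> A \<Longrightarrow> ev u f = (\<Sum>e\<in>A. const (lookup f e) * ev_monomial u e)"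
  unfolding ev_def by (rule sum.mono_neutral_left) (auto simp: in_keys_iff)

lemma ev_0 [simp]: "ev u 0 = 0"
  by (simp add: ev_def)

lemma ev_single: "ev u (single e c) = const c * ev_monomial u e"
  by (simp add: ev_def)

lemma ev_1 [simp]: "ev u 1 = 1"
  using ev_single[of u 0 1] by simp

lemma ev_add: "ev u (f + g) = ev u f + ev u g"
proof -
  let ?A = "keys f \<union> keys g"
  have "ev u (f + g) = (\<Sum>e\<in>?A. const (lookup (f + g) e) * ev_monomial u e)"
    by (rule ev_superset) (use keys_add[of f g] in auto)
  also have "\<dots> = ev u f + ev u g"
    by (simp add: lookup_add const_add distrib_right sum.distrib ev_superset[of ?A])
  finally show ?thesis .
qed

lemma ev_sum: "ev u (sum f A) = (\<Sum>i\<in>A. ev u (f i))"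
  by (induction A rule: infinite_finite_induct) (auto simp: ev_add)

lemma ev_mult:
  assumes "\<And>i. u i \<noteq> 0"
  shows "ev u (f * g) = ev u f * ev u g"
proof (induction f rule: poly_mapping_single_induct)
  case (add e c f)
  have "ev u (single e c * g) = ev u (single e c) * ev u g"
  proof (induction g rule: poly_mapping_single_induct)
    case (add e' c' g)
    have "ev u (single e c * single e' c') =
        ev u (single e c) * ev u (single e' c')"
      by (simp only: mult_single ev_single const_mult ev_monomial_add[OF assms] mult_ac)
    then show ?case using add by (simp only: distrib_left ev_add)
  qed auto
  then show ?case using add by (simp only: distrib_right ev_add)
qed auto

lemma ev_power:
  assumes "\<And>i. u i \<noteq> 0"
  shows "ev u (f ^ n) = ev u f ^ n"
  by (induction n) (auto simp: ev_mult assms)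

lemma ev_prod:
  assumes "\<And>i. u i \<noteq> 0"
  shows "ev u (prod f A) = (\<Prod>i\<in>A. ev u (f i))"
  by (induction A rule: infinite_finite_induct) (auto simp: ev_mult assms)

lemma ev_cong_homogeneous:
  assumes "homogeneous (\<lambda>e. lookup e k) 0 f"
  shows "ev (u(k := v)) f = ev u f"
proof -
  have "ev_monomial (u(k := v)) e = ev_monomial u e" if "e \<in> keys f" for e
    unfolding ev_monomial_def
  proof (rule prod.cong[OF refl])
    fix i assume "i \<in> keys e"
    then have "i \<noteq> k" using assms that by (auto simp: homogeneous_def in_keys_iff)
    then show "(u(k := v)) i powi lookup e i = u i powi lookup e i" by simp
  qed
  then show ?thesis by (simp add: ev_def)
qed

lemma single_nonzero: "c \<noteq> 0 \<Longrightarrow> single e c \<noteq> 0"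
  by (metis keys_eq_empty keys_single insert_not_empty)

lemma yvar_nonzero [simp]: "yvar i \<noteq> 0"
  unfolding yvar_def to_fract_eq_0_iff by (rule single_nonzero) simp

lemma to_fract_prod: "to_fract (prod f A) = (\<Prod>i\<in>A. to_fract (f i))"
  by (induction A rule: infinite_finite_induct) auto

lemma to_fract_power: "to_fract (x ^ n) = to_fract x ^ n"
  by (induction n) auto

lemma lookup_map: "f 0 = 0 \<Longrightarrow> lookup (Poly_Mapping.map f p) i = f (lookup p i)"
  by (auto simp: map.rep_eq when_def)

lemma ev_monomial_yvar_nonneg:
  assumes "\<And>i. lookup e i \<ge> 0"
  shows "ev_monomial yvar e = to_fract (single (Poly_Mapping.map nat e) 1)"
proof -
  have 1: "single (single i m) (1::complex) = single (single i 1) 1 ^ m"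
    for i :: nat and m :: nat
  proof (induction m)
    case (Suc m)
    have "single i (Suc m) = single i 1 + single i m"
      by (simp flip: single_add)
    then have "single (single i (Suc m)) (1::complex) =
      single (single i 1) 1 * single (single i m) 1"
      by (simp add: mult_single)
    then show ?case using Suc by simp
  qed auto
  have 2: "single (\<Sum>i\<in>A. single i (m i)) (1::complex) =
        (\<Prod>i\<in>A. single (single i 1) 1 ^ m i)"
    if "finite A" for A :: "nat set" and m :: "nat \<Rightarrow> nat"
    using that
  proof induction
    case (insert i A)
    have "single (\<Sum>i\<in>insert i A. single i (m i)) (1::complex) =
      single (single i (m i)) 1 * single (\<Sum>i\<in>A. single i (m i)) 1"
      using insert(1,2) by (simp add: mult_single)
    then show ?case using insert by (simp only: 1[of i "m i"] prod.insert[OF insert(1,2)])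
  qed auto
  have "ev_monomial yvar e = (\<Prod>i\<in>keys e. yvar i ^ nat (lookup e i))"
    unfolding ev_monomial_def
    by (rule prod.cong[OF refl]) (use assms in \<open>auto simp: power_int_def\<close>)
  also have "\<dots> = to_fract (\<Prod>i\<in>keys e. single (single i 1) 1 ^ nat (lookup e i))"
    by (simp add: yvar_def to_fract_prod to_fract_power)
  also have "\<dots> = to_fract (single (\<Sum>i\<in>keys e. single i (nat (lookup e i))) 1)"
    by (simp add: 2)
  also have "(\<Sum>i\<in>keys e. single i (nat (lookup e i))) = Poly_Mapping.map nat e"
    by (rule poly_mapping_eqI) (auto simp: lookup_sum lookup_single when_def lookup_map in_keys_iff)
  finally show ?thesis .
qed

text \<open>
  After multiplication by a large monomial the exponents are nonnegative, and evaluation at the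
  \<open>y\<^sub>i\<close> is then the embedding of the polynomial ring into its field of fractions.
\<close>

lemma ev_yvar_eq_0:
  assumes "ev yvar f = 0"
  shows "f = 0"
proof -
  define s where "s = (\<Sum>e\<in>keys f. Poly_Mapping.map abs e)"
  define h where "h = X s * f"
  have nonneg: "lookup e i \<ge> 0" if e: "e \<in> keys h" for e i
  proof -
    obtain e' where e': "e' \<in> keys f" "e = s + e'"
      using e keys_mult[of "X s" f] unfolding h_def keys_single by auto
    have "lookup s i = (\<Sum>e\<in>keys f. \<bar>lookup e i\<bar>)"
      by (simp add: s_def lookup_sum lookup_map)
    also have "\<dots> \<ge> \<bar>lookup e' i\<bar>"
      using e'(1) by (intro member_le_sum) auto
    finally show ?thesis using e' by (simp add: lookup_add)
  qed
  have inj: "inj_on (Poly_Mapping.map nat) (keys h)"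
  proof (rule inj_onI)
    fix a b assume ab: "a \<in> keys h" "b \<in> keys h" "Poly_Mapping.map nat a = Poly_Mapping.map nat b"
    show "a = b"
    proof (rule poly_mapping_eqI)
      fix i
      have "nat (lookup a i) = nat (lookup b i)"
        using ab(3) by (metis lookup_map nat_0)
      then show "lookup a i = lookup b i"
        using nonneg ab(1,2) by (simp add: eq_nat_nat_iff)
    qed
  qed
  have "ev yvar h = 0"
    using assms by (simp add: h_def ev_mult)
  also have "ev yvar h = (\<Sum>e\<in>keys h. const (lookup h e) * to_fract (single (Poly_Mapping.map nat e) 1))"
    unfolding ev_def by (rule sum.cong) (auto simp: ev_monomial_yvar_nonneg nonneg)
  also have "\<dots> = to_fract (\<Sum>e\<in>keys h. single (Poly_Mapping.map nat e) (lookup h e))"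
    by (simp add: const_def mult_single flip: to_fract_mult) 
  finally have *: "(\<Sum>e\<in>keys h. single (Poly_Mapping.map nat e) (lookup h e)) = 0"
    unfolding to_fract_eq_0_iff .
  have "keys h = {}"
  proof (rule ccontr)
    assume "keys h \<noteq> {}"
    then obtain a where a: "a \<in> keys h" by blast
    have "0 = lookup (\<Sum>e\<in>keys h. single (Poly_Mapping.map nat e) (lookup h e)) (Poly_Mapping.map nat a)"
      by (simp add: *)
    also have "\<dots> = (\<Sum>e\<in>keys h. if e = a then lookup h e else 0)"
      unfolding lookup_sum by (rule sum.cong) (use inj a in \<open>auto simp: lookup_single when_def inj_on_def\<close>)
    also have "\<dots> = lookup h a" using a by simp
    finally show False using a by (simp add: in_keys_iff)
  qed
  then have "h = 0" by simp
  moreover have "X (- s) * h = f"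
    using X_uminus[of "- s"] by (simp add: h_def flip: mult.assoc)
  ultimately show "f = 0" by simp
qed

lemma ev_yvar_inj: "ev yvar f = ev yvar g \<Longrightarrow> f = g"
proof -
  assume "ev yvar f = ev yvar g"
  moreover have "ev yvar (f - g) + ev yvar g = ev yvar f"
    by (simp flip: ev_add)
  ultimately have "ev yvar (f - g) = 0" by simp
  then show ?thesis using ev_yvar_eq_0[of "f - g"] by simp
qed

abbreviation deg_free :: "nat \<Rightarrow> laurent \<Rightarrow> bool" where
  "deg_free k f \<equiv> homogeneous (\<lambda>e. lookup e k) 0 f"

text \<open>
  For \<open>P\<close> not involving \<open>x\<^sub>k\<close>, these are the Laurent polynomials that remain Laurent
  polynomials when \<open>x\<^sub>k\<close> is replaced by \<open>P / x\<^sub>k\<close>, that is, those Laurent in both clusters joined by a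
  mutation in direction \<open>k\<close>.  The description by generators makes the ring structure evident; the
  criterion by divisibility is \<open>two_chart_iff\<close>.
\<close>

definition two_chart :: "nat \<Rightarrow> laurent \<Rightarrow> laurent set" where
  "two_chart k P = add_closure {single e c * P ^ a | e c a. lookup e k + int a \<ge> 0}"

lemma two_chart_gen: "lookup e k + int a \<ge> 0 \<Longrightarrow> single e c * P ^ a \<in> two_chart k P"
  unfolding two_chart_def by (rule add_closure_base) blast

lemma two_chart_single: "lookup e k \<ge> 0 \<Longrightarrow> single e c \<in> two_chart k P"
  using two_chart_gen[of e k 0] by simp

lemma two_chart_add: "f \<in> two_chart k P \<Longrightarrow> g \<in> two_chart k P \<Longrightarrow> f + g \<in> two_chart k P"
  unfolding two_chart_def by (rule add_closure_add)

lemma two_chart_0: "0 \<in> two_chart k P"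
  unfolding two_chart_def by (rule add_closure.zero)

lemma two_chart_1: "1 \<in> two_chart k P"
  using two_chart_single[of 0 k 1] by simp

lemma two_chart_mult:
  assumes "f \<in> two_chart k P" "g \<in> two_chart k P"
  shows "f * g \<in> two_chart k P"
  using assms unfolding two_chart_def
proof (rule add_closure_mult, safe)
  fix e e' a a' and c c' :: complex
  assume *: "0 \<le> lookup e k + int a" "0 \<le> lookup e' k + int a'"
  have "single e c * P ^ a * (single e' c' * P ^ a') =
      (single e c * single e' c') * P ^ (a + a')"
    by (simp only: power_add mult_ac)
  also have "\<dots> = single (e + e') (c * c') * P ^ (a + a')"
    by (simp only: mult_single)
  also have "\<dots> \<in> two_chart k P"
    by (rule two_chart_gen) (use * in \<open>simp add: lookup_add\<close>)
  finally show "single e c * P ^ a * (single e' c' * P ^ a') \<in> add_closure {single e c * P ^ a |e c a. 0 \<le> lookup e k + int a}"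
    by (simp add: two_chart_def)
qed

lemma two_chart_uminus: "f \<in> two_chart k P \<Longrightarrow> - f \<in> two_chart k P"
  using two_chart_mult[of "single 0 (-1)" k P f] two_chart_single[of 0 k "-1"]
  by (simp add: single_uminus)

lemma two_chart_diff: "f \<in> two_chart k P \<Longrightarrow> g \<in> two_chart k P \<Longrightarrow> f - g \<in> two_chart k P"
  using two_chart_add[OF _ two_chart_uminus, of f k P g] by simp

lemma two_chart_power: "f \<in> two_chart k P \<Longrightarrow> f ^ n \<in> two_chart k P"
  by (rule power_closed) (auto intro: two_chart_mult two_chart_1)

lemma two_chart_prod: "(\<And>i. i \<in> A \<Longrightarrow> f i \<in> two_chart k P) \<Longrightarrow> prod f A \<in> two_chart k P"
  by (induction A rule: infinite_finite_induct) (auto intro: two_chart_mult two_chart_1)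

lemma two_chart_nonneg:
  assumes "\<And>e. e \<in> keys f \<Longrightarrow> lookup e k \<ge> 0"
  shows "f \<in> two_chart k P"
proof -
  have "(\<Sum>e\<in>keys f. single e (lookup f e)) \<in> two_chart k P"
    using assms unfolding two_chart_def
    by (intro add_closure_sum) (auto intro: two_chart_single[unfolded two_chart_def])
  then show ?thesis by (simp add: poly_mapping_sum_single)
qed

lemma two_chart_iff:
  assumes P: "deg_free k P"
  shows "f \<in> two_chart k P \<longleftrightarrow> (\<forall>a::nat. P ^ a dvd graded_part (\<lambda>e. lookup e k) (- int a) f)"
proof
  assume "f \<in> two_chart k P"
  then show "\<forall>a::nat. P ^ a dvd graded_part (\<lambda>e. lookup e k) (- int a) f"
    unfolding two_chart_def
  proof induction
    case (add s f)
    then obtain e c b where s: "s = single e c * P ^ b" "0 \<le> lookup e k + int b" by blast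
    have "P ^ a dvd graded_part (\<lambda>e. lookup e k) (- int a) s" for a
    proof -
      have "graded_part (\<lambda>e. lookup e k) (- int a) s = single e c * graded_part (\<lambda>e. lookup e k) (- int a - lookup e k) (P ^ b)"
        by (simp add: s deg.graded_part_single_mult)
      also have "\<dots> = (if lookup e k = - int a then single e c * P ^ b else 0)"
        using graded_part_homogeneous[OF deg.homogeneous_power[OF P]] by auto
      finally show ?thesis
        using s(2) by (auto intro!: dvd_mult le_imp_power_dvd)
    qed
    then show ?case using add by (simp add: graded_part_add)
  qed auto
next
  assume *: "\<forall>a::nat. P ^ a dvd graded_part (\<lambda>e. lookup e k) (- int a) f"
  have "graded_part (\<lambda>e. lookup e k) a f \<in> two_chart k P" for a
  proof (cases "a \<ge> 0")
    case True
    then show ?thesis by (intro two_chart_nonneg) (auto simp: keys_graded_part)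
  next
    case False
    define n where "n = nat (- a)"
    have n: "a = - int n" using False by (simp add: n_def)
    obtain q where q: "graded_part (\<lambda>e. lookup e k) a f = P ^ n * q"
      using * n by (auto elim!: dvdE)
    define q' where "q' = graded_part (\<lambda>e. lookup e k) a q"
    have "graded_part (\<lambda>e. lookup e k) a f = graded_part (\<lambda>e. lookup e k) a (graded_part (\<lambda>e. lookup e k) a f)"
      by (simp add: graded_part_idem)
    also have "\<dots> = P ^ n * q'"
      unfolding q q'_def by (simp add: deg.graded_part_homogeneous_mult[OF deg.homogeneous_power[OF P]])
    also have "\<dots> = (\<Sum>e\<in>keys q'. single e (lookup q' e) * P ^ n)"
      by (subst poly_mapping_sum_single[of q', symmetric]) (simp add: sum_distrib_left mult_ac)
    also have "\<dots> \<in> two_chart k P"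
      unfolding two_chart_def
      by (rule add_closure_sum, rule two_chart_gen[unfolded two_chart_def]) (auto simp: q'_def keys_graded_part n)
    finally show ?thesis .
  qed
  then have "(\<Sum>a\<in>(\<lambda>e. lookup e k) ` keys f. graded_part (\<lambda>e. lookup e k) a f) \<in> two_chart k P"
    unfolding two_chart_def by (intro add_closure_sum)
  then show "f \<in> two_chart k P" by (simp add: sum_graded_part)
qed

lemma two_chart_cancel_coprime:
  assumes P: "deg_free j P" and v: "lookup v j = 0" and w: "lookup w j = 0"
    and "grading \<phi>" "homogeneous \<phi> d P" "\<phi> v \<noteq> \<phi> w"
    and "(X v + X w) * g \<in> two_chart j P"
  shows "g \<in> two_chart j P"
proof -
  interpret grading \<phi> by fact
  have "homogeneous (\<lambda>e. lookup e j) 0 (X v + X w)"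
    using v w by (intro homogeneous_add homogeneous_single)
  then have eq: "graded_part (\<lambda>e. lookup e j) (- int a) ((X v + X w) * g) =
      (X v + X w) * graded_part (\<lambda>e. lookup e j) (- int a) g" for a
    using deg.graded_part_homogeneous_mult[of j 0 "X v + X w" "- int a" g] by simp
  have "\<forall>a::nat. P ^ a dvd graded_part (\<lambda>e. lookup e j) (- int a) ((X v + X w) * g)"
    using assms(7) unfolding two_chart_iff[OF P] .
  then have "P ^ a dvd (X v + X w) * graded_part (\<lambda>e. lookup e j) (- int a) g" for a
    unfolding eq by blast
  then have "P ^ a dvd graded_part (\<lambda>e. lookup e j) (- int a) g" for a
    by (rule binomial_coprime_power[OF assms(5,6)])
  then show ?thesis unfolding two_chart_iff[OF P] by blast
qed

text \<open>
  Here \<open>x\<^sub>j\<close> divides exactly one term of the binomial, which is therefore a unit modulo \<open>x\<^sub>j\<close>: solving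
  for the other term shows that if \<open>x\<^sub>j\<^sup>s\<^sup>+\<^sup>1 g\<close> lies in the ring then so does \<open>x\<^sub>j\<^sup>s g\<close>.
\<close>

lemma two_chart_cancel_adjacent:
  assumes v: "lookup v j = 0" and w: "lookup w j > 0"
    and g: "(X v + X w) * g \<in> two_chart j P"
  shows "g \<in> two_chart j P"
proof -
  define x where "x = (single j 1 :: nat \<Rightarrow>\<^sub>0 int)"
  define s where "s = nat (Max (insert 0 ((\<lambda>e. - lookup e j) ` keys g)))"
  have s: "- lookup e j \<le> int s" if "e \<in> keys g" for e
  proof -
    have "- lookup e j \<le> Max (insert 0 ((\<lambda>e. - lookup e j) ` keys g))"
      using that by (intro Max_ge) auto
    then show ?thesis unfolding s_def by linarith
  qed
  have Xpow: "X x ^ n \<in> two_chart j P" for n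
    by (intro two_chart_power two_chart_single) (simp add: x_def)
  have "X x ^ s * g \<in> two_chart j P"
  proof (rule two_chart_nonneg)
    fix e assume "e \<in> keys (X x ^ s * g)"
    then have "e \<in> keys (X (frag_cmul (int s) x) * g)" by (simp add: X_of_nat_mult)
    then obtain e' where "e = frag_cmul (int s) x + e'" "e' \<in> keys g"
      using keys_mult[of "X (frag_cmul (int s) x)" g] by auto
    then show "lookup e j \<ge> 0" using s[of e'] by (simp add: lookup_add x_def)
  qed
  moreover have "X x ^ n * g \<in> two_chart j P" if "X x ^ (Suc n) * g \<in> two_chart j P" for n
  proof -
    have *: "X w = X (w - x) * X x" by (simp flip: X_add)
    have "X v * (X x ^ n * g) = X x ^ n * ((X v + X w) * g) - X (w - x) * (X x ^ (Suc n) * g)"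
      by (simp add: * algebra_simps)
    also have "\<dots> \<in> two_chart j P"
      by (intro two_chart_diff two_chart_mult Xpow g that two_chart_single)
         (use w in \<open>simp add: lookup_minus x_def\<close>)
    finally have "X (- v) * (X v * (X x ^ n * g)) \<in> two_chart j P"
      by (rule two_chart_mult[rotated]) (use v in \<open>auto intro: two_chart_single\<close>)
    then show ?thesis using X_uminus[of "- v"] by (simp flip: mult.assoc)
  qed
  ultimately have "X x ^ 0 * g \<in> two_chart j P"
    by (induction s) blast+
  then show ?thesis by simp
qed

text \<open>
  The image \<open>g\<close> of \<open>f\<close> under \<open>x\<^sub>k \<mapsto> P / x\<^sub>k\<close> is characterised by its values at all points rather than
  by a formula: this makes multiplicativity automatic, and the same \<open>g\<close> serves for the
  generic point and for points with frozen variables equal to 1.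
\<close>

lemma two_chart_substitute:
  assumes P: "deg_free k P" and f: "f \<in> two_chart k P"
  shows "\<exists>g\<in>two_chart k P. \<forall>u. (\<forall>i. u i \<noteq> 0) \<longrightarrow> ev u P \<noteq> 0 \<longrightarrow> ev (u(k := ev u P / u k)) f = ev u g"
  using f unfolding two_chart_def
proof induction
  case zero
  show ?case by (rule bexI[of _ 0]) (auto intro: add_closure.zero)
next
  case (add s f)
  then obtain e c a where s: "s = single e c * P ^ a" "0 \<le> lookup e k + int a" by blast
  obtain g where g: "g \<in> two_chart k P"
    "\<forall>u. (\<forall>i. u i \<noteq> 0) \<longrightarrow> ev u P \<noteq> 0 \<longrightarrow> ev (u(k := ev u P / u k)) f = ev u g"
    using add.IH unfolding two_chart_def by blast
  define m where "m = lookup e k"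
  define h where "h = single (e + single k (- 2 * m)) c * P ^ nat (m + int a)"
  have "h \<in> two_chart k P"
    unfolding h_def by (rule two_chart_gen) (use s in \<open>auto simp: lookup_add m_def\<close>)
  moreover have "ev (u(k := ev u P / u k)) s = ev u h" if u: "\<forall>i. u i \<noteq> 0" "ev u P \<noteq> 0" for u
  proof -
    let ?u = "u(k := ev u P / u k)"
    have u': "?u i \<noteq> 0" for i using u by auto
    have upd: "ev_monomial ?u e = ev_monomial u e * (ev u P / u k / u k) powi m"
      unfolding m_def by (rule ev_monomial_upd) (use u in simp)
    have "ev ?u s = const c * ev_monomial ?u e * ev ?u P ^ a"
      unfolding s by (simp only: ev_mult[OF u'] ev_power[OF u'] ev_single)
    also have "\<dots> = const c * (ev_monomial u e * (ev u P / u k / u k) powi m) * ev u P ^ a"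
      by (simp only: ev_cong_homogeneous[OF P] upd)
    also have "(ev u P / u k / u k) powi m = ev u P powi m * u k powi (- 2 * m)"
    proof -
      have "ev u P / u k / u k = ev u P * u k powi (- 2)"
        by (simp add: power_int_minus field_simps power2_eq_square)
      then show ?thesis by (simp only: power_int_mult_distrib power_int_mult)
    qed
    also have "const c * (ev_monomial u e * (ev u P powi m * u k powi (- 2 * m))) * ev u P ^ a =
       const c * (ev_monomial u e * u k powi (- 2 * m)) * (ev u P powi m * ev u P powi int a)"
      by (simp add: mult_ac)
    also have "ev u P powi m * ev u P powi int a = ev u P ^ nat (m + int a)"
      using u s(2) unfolding m_def[symmetric]
      by (subst power_int_add[symmetric]) (auto simp: power_int_def)
    also have "ev_monomial u e * u k powi (- 2 * m) = ev_monomial u (e + single k (- 2 * m))"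
      using u by (simp add: ev_monomial_add ev_monomial_single)
    also have "const c * ev_monomial u (e + single k (- 2 * m)) * ev u P ^ nat (m + int a) = ev u h"
    proof -
      have "u i \<noteq> 0" for i using u by simp
      from ev_mult[OF this] ev_power[OF this] show ?thesis
        unfolding h_def by (simp only: ev_single)
    qed
    finally show ?thesis .
  qed
  ultimately show ?case
    using g by (intro bexI[of _ "h + g"]) (auto simp: ev_add two_chart_def simp del: fun_upd_apply intro: add_closure_add)
qed

section \<open>Exchange polynomials and mutation of the upper bound\<close>

definition pos_part :: "(nat \<Rightarrow> nat \<Rightarrow> int) \<Rightarrow> nat \<Rightarrow> nat \<Rightarrow>\<^sub>0 int" where
  "pos_part b k = Abs_poly_mapping (\<lambda>i. max 0 (b i k))"

abbreviation neg_part :: "(nat \<Rightarrow> nat \<Rightarrow> int) \<Rightarrow> nat \<Rightarrow> nat \<Rightarrow>\<^sub>0 int" where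
  "neg_part b k \<equiv> pos_part (\<lambda>i j. - b i j) k"

definition exchange_poly :: "(nat \<Rightarrow> nat \<Rightarrow> int) \<Rightarrow> nat \<Rightarrow> laurent" where
  "exchange_poly b k = X (pos_part b k) + X (neg_part b k)"

lemma exchange_poly_uminus: "exchange_poly (\<lambda>i j. - b i j) k = exchange_poly b k"
  by (simp add: exchange_poly_def add.commute)

lemma lookup_pos_part:
  assumes "finite {i. b i k \<noteq> 0}"
  shows "lookup (pos_part b k) i = max 0 (b i k)"
proof -
  have "{i. max 0 (b i k) \<noteq> 0} \<subseteq> {i. b i k \<noteq> 0}" by auto
  then have "finite {i. max 0 (b i k) \<noteq> 0}" using assms by (rule finite_subset)
  then show ?thesis unfolding pos_part_def by simp
qed

lemma lookup_neg_part:
  assumes "finite {i. b i k \<noteq> 0}"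
  shows "lookup (neg_part b k) i = max 0 (- b i k)"
  using lookup_pos_part[of "\<lambda>i j. - b i j" k i] assms by simp

lemma exchange_poly_two_chart:
  assumes "finite {i. b i k \<noteq> 0}"
  shows "exchange_poly b k \<in> two_chart j P"
  unfolding exchange_poly_def using lookup_pos_part[of b k j] lookup_neg_part[of b k j] assms
  by (intro two_chart_add two_chart_single) auto

lemma exchange_poly_deg_free:
  assumes "finite {i. b i k \<noteq> 0}" "b j k = 0"
  shows "deg_free j (exchange_poly b k)"
  unfolding exchange_poly_def using lookup_pos_part[of b k j] lookup_neg_part[of b k j] assms
  by (intro homogeneous_add homogeneous_single) auto

lemma two_chart_quotient:
  "P * X (- single j 1) \<in> two_chart j P"
  using two_chart_gen[of "- single j 1" j 1 1 P] by (simp add: mult.commute)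

lemma binomial_power_expand:
  assumes "p \<in> two_chart j P" "m \<in> two_chart j P"
  shows "\<exists>Q\<in>two_chart j P. (p + m) ^ n = p ^ n + m * Q"
proof (induction n)
  case 0
  show ?case by (rule bexI[of _ 0]) (auto simp: two_chart_0)
next
  case (Suc n)
  then obtain Q where "Q \<in> two_chart j P" "(p + m) ^ n = p ^ n + m * Q" by blast
  then show ?case
    by (intro bexI[of _ "p ^ n + (p + m) * Q"])
       (auto simp: algebra_simps intro!: two_chart_add two_chart_mult two_chart_power assms)
qed

text \<open>
  If \<open>j\<close> and \<open>k\<close> are joined, only one term of \<open>P\<^sub>k\<close> survives modulo \<open>x\<^sub>j\<close>, and the matrix mutation rule is made so that
  substituting that term for \<open>x\<^sub>k x\<^sub>k'\<close> turns the mutated exchange polynomial \<open>P'\<^sub>j\<close> into a monomial multiple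
  of \<open>P\<^sub>j\<close>.  The correction terms are divisible by \<open>x\<^sub>j\<close>, so they stay in the ring after division by \<open>x\<^sub>j\<close>.
\<close>

lemma exchange_compatible_nonneg:
  fixes b b' :: "nat \<Rightarrow> nat \<Rightarrow> int" and j k :: nat
  defines "y' \<equiv> yvar(k := ev yvar (exchange_poly b k) / yvar k)"
  assumes fin: "finite {i. b i k \<noteq> 0}" "finite {i. b i j \<noteq> 0}" "finite {i. b' i j \<noteq> 0}"
    and ne: "ev yvar (exchange_poly b k) \<noteq> 0"
    and jk: "j \<noteq> k" and diag: "b k k = 0" "b j j = 0"
    and c: "b k j = int c" "b j k = - int c"
    and b': "b' k j = - int c" "\<And>i. i \<noteq> k \<Longrightarrow> b' i j = b i j + max 0 (b i k) * int c"
  shows "\<exists>w\<in>two_chart j (exchange_poly b j).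
           ev y' (exchange_poly b' j * X (- single j 1)) = ev yvar w"
proof -
  let ?G = "two_chart j (exchange_poly b j)"
  let ?P = "exchange_poly b k"
  let ?\<epsilon> = "single j 1 :: nat \<Rightarrow>\<^sub>0 int"
  define A B p m where "A = pos_part b' j" and "B = neg_part b' j" and "p = pos_part b k" and "m = neg_part b k"
  define B' where "B' = B + single k (- 2 * int c)"
  define E where "E = A - pos_part b j"
  note lookups = lookup_pos_part[of b k, OF fin(1)] lookup_neg_part[of b k, OF fin(1)]
    lookup_pos_part[of b j, OF fin(2)] lookup_neg_part[of b j, OF fin(2)]
    lookup_pos_part[of b' j, OF fin(3)] lookup_neg_part[of b' j, OF fin(3)]
  have y': "y' i \<noteq> 0" for i using ne by (simp add: y'_def)
  have ev_monomial_y': "ev_monomial y' e = ev_monomial yvar (e + single k (- 2 * lookup e k)) * ev yvar ?P powi lookup e k" for e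
  proof -
    have "ev_monomial y' e = ev_monomial yvar e * (ev yvar ?P / yvar k / yvar k) powi lookup e k"
      unfolding y'_def by (rule ev_monomial_upd) simp
    also have "ev yvar ?P / yvar k / yvar k = ev yvar ?P * yvar k powi (- 2)"
      by (simp add: power_int_minus field_simps power2_eq_square)
    also have "(ev yvar ?P * yvar k powi (- 2)) powi lookup e k = ev yvar ?P powi lookup e k * yvar k powi (- 2 * lookup e k)"
      by (simp only: power_int_mult_distrib power_int_mult)
    also have "ev_monomial yvar e * (ev yvar ?P powi lookup e k * yvar k powi (- 2 * lookup e k)) =
        ev_monomial yvar e * yvar k powi (- 2 * lookup e k) * ev yvar ?P powi lookup e k"
      by (simp only: mult_ac)
    finally show ?thesis
      by (simp only: ev_monomial_add[OF yvar_nonzero] ev_monomial_single)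
  qed
  have A: "lookup A k = 0" "lookup A j = 0" and B: "lookup B k = int c" "lookup B j = 0"
    using b'(1) b'(2)[of j] jk c diag by (auto simp: A_def B_def lookups)
  have 1: "ev y' (X A) = ev yvar (X A)"
    by (simp add: ev_single ev_monomial_y' A)
  have 2: "ev y' (X B) = ev yvar (X B' * ?P ^ c)"
    by (simp add: ev_single ev_monomial_y' B B'_def ev_mult ev_power)
  have "X p \<in> ?G" "X m \<in> ?G"
    by (rule two_chart_single; simp add: p_def m_def lookups)+
  from binomial_power_expand[OF this] obtain Q where Q: "Q \<in> ?G" "(X p + X m) ^ c = X p ^ c + X m * Q"
    by blast
  have key: "B' + frag_cmul (int c) p = E + neg_part b j"
  proof (rule poly_mapping_eqI)
    fix i
    have linear: "max 0 (- (x + q)) + q = max 0 (x + q) - max 0 x + max 0 (- x)" for x q :: int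
      by (simp add: max_def)
    show "lookup (B' + frag_cmul (int c) p) i = lookup (E + neg_part b j) i"
    proof (cases "i = k")
      case True
      then show ?thesis
        using b'(1) c(1) diag(1)
        by (simp add: lookup_add lookup_minus B'_def E_def A_def B_def p_def lookups)
    next
      case False
      then show ?thesis
        using linear[of "b i j" "max 0 (b i k) * int c"]
        by (simp add: lookup_add lookup_minus B'_def E_def A_def B_def p_def lookups lookup_single b'(2) mult.commute)
    qed
  qed
  have key2: "A = E + pos_part b j" by (simp add: E_def)
  have X_B'p: "X B' * X p ^ c = X E * X (neg_part b j)"
    by (metis X_add X_of_nat_mult key)
  have "exchange_poly b' j = X A + X B"
    by (simp add: exchange_poly_def A_def B_def)
  then have "ev y' (exchange_poly b' j * X (- ?\<epsilon>)) = (ev y' (X A) + ev y' (X B)) * ev y' (X (- ?\<epsilon>))"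
    by (simp add: ev_mult[OF y'] ev_add)
  also have "ev y' (X (- ?\<epsilon>)) = ev yvar (X (- ?\<epsilon>))"
    using jk by (simp add: ev_single ev_monomial_y' lookup_single)
  also have "(ev y' (X A) + ev y' (X B)) * ev yvar (X (- ?\<epsilon>)) = ev yvar ((X A + X B' * ?P ^ c) * X (- ?\<epsilon>))"
    by (simp only: 1 2 ev_mult[OF yvar_nonzero] ev_add)
  also have "X A + X B' * ?P ^ c = X E * X (pos_part b j) + X E * X (neg_part b j) + X B' * (X m * Q)"
  proof -
    have "?P ^ c = X p ^ c + X m * Q"
      using Q(2) by (simp add: exchange_poly_def p_def m_def)
    then have "X B' * ?P ^ c = X E * X (neg_part b j) + X B' * (X m * Q)"
      by (simp only: distrib_left X_B'p)
    moreover have "X A = X E * X (pos_part b j)"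
      using key2 by (metis X_add)
    ultimately show ?thesis by (simp only: add.assoc)
  qed
  finally have eq: "ev y' (exchange_poly b' j * X (- ?\<epsilon>)) =
     ev yvar ((X E * X (pos_part b j) + X E * X (neg_part b j) + X B' * (X m * Q)) * X (- ?\<epsilon>))" .
  have "(X E * X (pos_part b j) + X E * X (neg_part b j) + X B' * (X m * Q)) * X (- ?\<epsilon>) =
     X E * (exchange_poly b j * X (- ?\<epsilon>)) + X B' * ((X m * X (- ?\<epsilon>)) * Q)"
    unfolding exchange_poly_def by (simp only: distrib_left distrib_right mult_ac)
  also have "\<dots> \<in> ?G"
  proof (intro two_chart_add two_chart_mult[of "X E"] two_chart_mult[of "X B'"] two_chart_quotient)
    show "X E \<in> ?G"
      using A diag(2) by (intro two_chart_single) (simp add: E_def lookup_minus lookups)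
    show "X B' \<in> ?G"
      using B jk by (intro two_chart_single) (simp add: B'_def lookup_add lookup_single)
    show "X m * X (- ?\<epsilon>) * Q \<in> ?G"
    proof (cases "c = 0")
      case True
      then have "X m * Q = 0" using Q(2) by simp
      moreover have "X m * X (- ?\<epsilon>) * Q = X (- ?\<epsilon>) * (X m * Q)"
        by (simp only: mult_ac)
      ultimately have "X m * X (- ?\<epsilon>) * Q = 0"
        by (simp only: mult_zero_right)
      then show ?thesis by (simp only: two_chart_0)
    next
      case False
      then have "X (m - ?\<epsilon>) \<in> ?G"
        using c(2) by (intro two_chart_single) (simp add: lookup_minus m_def lookups)
      moreover have "X m * X (- ?\<epsilon>) = X (m - ?\<epsilon>)"
        by (simp flip: X_add)
      ultimately show ?thesis using Q(1) by (simp only: two_chart_mult)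
    qed
  qed
  finally show ?thesis using eq by blast
qed

definition column_independent :: "nat set \<Rightarrow> (nat \<Rightarrow> nat \<Rightarrow> int) \<Rightarrow> bool" where
  "column_independent I b \<longleftrightarrow> (\<forall>c. (\<forall>i. (\<Sum>l\<in>I. c l * b i l) = 0) \<longrightarrow> (\<forall>l\<in>I. c l = 0))"

locale exchange_matrix =
  fixes I :: "nat set" and b :: "nat \<Rightarrow> nat \<Rightarrow> int"
  assumes finite_I: "finite I"
    and finite_rows: "finite {i. \<exists>k. b i k \<noteq> 0}"
    and skew: "i \<in> I \<Longrightarrow> j \<in> I \<Longrightarrow> b i j = - b j i"
    and independent: "column_independent I b"
begin

lemma finite_col [simp, intro]: "finite {i. b i k \<noteq> 0}"
  by (rule finite_subset[OF _ finite_rows]) blast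

lemma diag: "k \<in> I \<Longrightarrow> b k k = 0"
  using skew[of k k] by simp

lemma poly_deg_free: "k \<in> I \<Longrightarrow> deg_free k (exchange_poly b k)"
  by (rule exchange_poly_deg_free) (auto simp: diag)

text \<open>
  If all \<open>2 \<times> 2\<close> minors vanished, one column would be a multiple of the other.
\<close>

lemma nonzero_minor:
  assumes "j \<in> I" "k \<in> I" "j \<noteq> k"
  obtains p q where "b p j * b q k \<noteq> b q j * b p k"
proof (rule ccontr)
  assume "\<not> thesis"
  then have minors: "b p j * b q k = b q j * b p k" for p q using that by blast
  have *: "\<forall>l\<in>I. c l = 0" if "\<And>i. (\<Sum>l\<in>I. c l * b i l) = 0" for c
    using independent that unfolding column_independent_def by blast
  have "\<exists>p. b p j \<noteq> 0"
  proof (rule ccontr)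
    assume "\<nexists>p. b p j \<noteq> 0"
    then have "(\<Sum>l\<in>I. (if l = j then 1 else 0) * b i l) = 0" for i
      by (intro sum.neutral) auto
    from *[OF this] assms(1) show False by auto
  qed
  then obtain p where p: "b p j \<noteq> 0" by blast
  have "(\<Sum>l\<in>I. (if l = j then b p k else if l = k then - b p j else 0) * b i l) = 0" for i
  proof -
    have "(\<Sum>l\<in>I. (if l = j then b p k else if l = k then - b p j else 0) * b i l) =
      (\<Sum>l\<in>{j, k}. (if l = j then b p k else if l = k then - b p j else 0) * b i l)"
      by (rule sum.mono_neutral_right) (use assms finite_I in auto)
    then show ?thesis using assms(3) minors[of p i] by simp
  qed
  from *[OF this] assms p show False by auto
qed

text \<open>
  Coprimality of distinct exchange polynomials in the form in which it is used.  If \<open>j\<close> and \<open>k\<close> are not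
  joined, a nonzero minor of the two columns yields a grading for which \<open>P\<^sub>j\<close> is homogeneous and
  \<open>P\<^sub>k\<close> is not.
\<close>

lemma two_chart_cancel:
  assumes j: "j \<in> I" and k: "k \<in> I" and jk: "j \<noteq> k"
    and g: "exchange_poly b k * g \<in> two_chart j (exchange_poly b j)"
  shows "g \<in> two_chart j (exchange_poly b j)"
proof -
  note lookups = lookup_pos_part[OF finite_col] lookup_neg_part[OF finite_col]
  consider "b j k > 0" | "b j k < 0" | "b j k = 0" by linarith
  then show ?thesis
  proof cases
    case 1
    show ?thesis
      by (rule two_chart_cancel_adjacent[of "neg_part b k" j "pos_part b k"])
         (use 1 g in \<open>auto simp: lookups exchange_poly_def add.commute\<close>)
  next
    case 2
    show ?thesis
      by (rule two_chart_cancel_adjacent[of "pos_part b k" j "neg_part b k"])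
         (use 2 g in \<open>auto simp: lookups exchange_poly_def\<close>)
  next
    case 3
    obtain p q where pq: "b p j * b q k \<noteq> b q j * b p k"
      using nonzero_minor[OF j k jk] .
    \<comment> \<open>The minor with the column \<open>j\<close> fixed: it vanishes on column \<open>j\<close> but not on column \<open>k\<close>.\<close>
    define \<phi> where "\<phi> = (\<lambda>e. b p j * lookup e q - b q j * lookup e p)"
    have gr: "grading \<phi>"
      by standard (simp add: \<phi>_def lookup_add algebra_simps)
    have parts: "\<phi> (pos_part b l) - \<phi> (neg_part b l) = b p j * b q l - b q j * b p l" for l
      by (simp add: \<phi>_def lookups max_def algebra_simps)
    have hom: "homogeneous \<phi> (\<phi> (neg_part b j)) (exchange_poly b j)"
      unfolding exchange_poly_def using parts[of j]
      by (intro homogeneous_add homogeneous_single) auto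
    show ?thesis
      by (rule two_chart_cancel_coprime[OF poly_deg_free[OF j] _ _ gr hom, of "pos_part b k" "neg_part b k"])
         (use 3 parts[of k] pq g in \<open>auto simp: lookups exchange_poly_def\<close>)
  qed
qed

end

text \<open>
  In this form mutation is a column operation followed by a row operation, which is why it preserves the
  independence of the columns.
\<close>

lemma mutate_matrix_pos:
  assumes "i \<noteq> k" "j \<noteq> k"
  shows "mutate_matrix k b i j = b i j + max 0 (b i k) * b k j + b i k * max 0 (- b k j)"
proof -
  have "\<bar>b i k\<bar> * b k j + b i k * \<bar>b k j\<bar> = 2 * (max 0 (b i k) * b k j + b i k * max 0 (- b k j))"
    by (auto simp: max_def abs_if algebra_simps)
  then show ?thesis using assms by (simp add: mutate_matrix_def)
qed

context exchange_matrix
begin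

lemma mutate_exchange_matrix:
  assumes k: "k \<in> I"
  shows "exchange_matrix I (mutate_matrix k b)"
proof
  show "finite I" by (rule finite_I)
  show "finite {i. \<exists>j. mutate_matrix k b i j \<noteq> 0}"
  proof (rule finite_subset[OF _ finite_rows], safe)
    fix i j assume "mutate_matrix k b i j \<noteq> 0"
    then have "b i j \<noteq> 0 \<or> b i k \<noteq> 0" by (auto simp: mutate_matrix_def split: if_splits)
    then show "\<exists>j. b i j \<noteq> 0" by blast
  qed
  fix i j assume ij: "i \<in> I" "j \<in> I"
  show "mutate_matrix k b i j = - mutate_matrix k b j i"
  proof (cases "i = k \<or> j = k")
    case True
    then show ?thesis using skew[OF ij] by (auto simp: mutate_matrix_def)
  next
    case False
    then show ?thesis
      using skew[OF ij] skew[OF ij(1) k] skew[OF ij(2) k]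
      by (auto simp: mutate_matrix_pos max_def algebra_simps)
  qed
next
  show "column_independent I (mutate_matrix k b)"
    unfolding column_independent_def
  proof (intro allI impI)
    fix c :: "nat \<Rightarrow> int"
    assume c: "\<forall>i. (\<Sum>l\<in>I. c l * mutate_matrix k b i l) = 0"
    \<comment> \<open>The column operation of the mutation, applied to the coefficients of the relation.\<close>
    define c' where "c' = c(k := (\<Sum>l\<in>I - {k}. c l * max 0 (- b k l)) - c k)"
    have split: "(\<Sum>l\<in>I. h l) = h k + (\<Sum>l\<in>I - {k}. h l)" for h :: "nat \<Rightarrow> int"
      using finite_I k by (rule sum.remove)
    have row_k: "(\<Sum>l\<in>I - {k}. c l * b k l) = 0"
      using c[rule_format, of k] unfolding split by (simp add: mutate_matrix_def diag[OF k] sum_negf)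
    have "(\<Sum>l\<in>I. c' l * b i l) = 0" for i
    proof (cases "i = k")
      case True
      then show ?thesis using row_k unfolding split by (simp add: diag[OF k] c'_def)
    next
      case False
      have "(\<Sum>l\<in>I - {k}. c l * mutate_matrix k b i l) =
        (\<Sum>l\<in>I - {k}. c l * b i l + max 0 (b i k) * (c l * b k l) + b i k * (c l * max 0 (- b k l)))"
        by (rule sum.cong) (use False in \<open>auto simp: mutate_matrix_pos algebra_simps\<close>)
      also have "\<dots> = (\<Sum>l\<in>I - {k}. c l * b i l) + max 0 (b i k) * (\<Sum>l\<in>I - {k}. c l * b k l)
        + b i k * (\<Sum>l\<in>I - {k}. c l * max 0 (- b k l))"
        by (simp only: sum.distrib sum_distrib_left)
      finally have "c k * (- b i k) + ((\<Sum>l\<in>I - {k}. c l * b i l) + b i k * (\<Sum>l\<in>I - {k}. c l * max 0 (- b k l))) = 0"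
        using c[rule_format, of i] unfolding split row_k by (simp add: mutate_matrix_def)
      moreover have "(\<Sum>l\<in>I - {k}. c' l * b i l) = (\<Sum>l\<in>I - {k}. c l * b i l)"
        by (rule sum.cong) (auto simp: c'_def)
      ultimately show ?thesis unfolding split by (simp add: c'_def algebra_simps)
    qed
    then have "\<forall>l\<in>I. c' l = 0"
      using independent unfolding column_independent_def by blast
    then have *: "c l = 0" if "l \<in> I" "l \<noteq> k" for l using that by (auto simp: c'_def split: if_splits)
    moreover have "c' k = 0" using \<open>\<forall>l\<in>I. c' l = 0\<close> k by blast
    ultimately show "\<forall>l\<in>I. c l = 0" by (auto simp: c'_def)
  qed
qed

lemma exchange_poly_mutate_same: "exchange_poly (mutate_matrix k b) k = exchange_poly b k"
proof -
  have "pos_part (mutate_matrix k b) k = neg_part b k" "neg_part (mutate_matrix k b) k = pos_part b k"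
    by (simp_all add: pos_part_def mutate_matrix_def)
  then show ?thesis by (simp add: exchange_poly_def add.commute)
qed

lemma exchange_poly_nonzero: "ev yvar (exchange_poly b k) \<noteq> 0"
proof
  assume "ev yvar (exchange_poly b k) = 0"
  then have "exchange_poly b k = 0" by (rule ev_yvar_eq_0)
  then have "lookup (exchange_poly b k) (pos_part b k) = 0" by simp
  then show False
    by (auto simp: exchange_poly_def lookup_add lookup_single when_def split: if_splits)
qed

lemma exchange_compatible:
  assumes "j \<in> I" "k \<in> I" "j \<noteq> k"
  shows "\<exists>w\<in>two_chart j (exchange_poly b j).
     ev (yvar(k := ev yvar (exchange_poly b k) / yvar k))
       (exchange_poly (mutate_matrix k b) j * X (- single j 1)) = ev yvar w"
proof -
  interpret b': exchange_matrix I "mutate_matrix k b"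
    by (rule mutate_exchange_matrix) fact
  show ?thesis
  proof (cases "b k j \<ge> 0")
    case True
    show ?thesis
      by (rule exchange_compatible_nonneg[where c = "nat (b k j)"])
         (use assms True skew[OF assms(1,2)] in \<open>auto simp: diag exchange_poly_nonzero mutate_matrix_pos mutate_matrix_def[of k b k]\<close>)
  next
    case False
    have "\<exists>w\<in>two_chart j (exchange_poly (\<lambda>i j. - b i j) j).
      ev (yvar(k := ev yvar (exchange_poly (\<lambda>i j. - b i j) k) / yvar k))
       (exchange_poly (\<lambda>i j. - mutate_matrix k b i j) j * X (- single j 1)) = ev yvar w"
      by (rule exchange_compatible_nonneg[where c = "nat (- b k j)"])
         (use assms False skew[OF assms(1,2)] in \<open>auto simp: diag exchange_poly_nonzero exchange_poly_uminus
            mutate_matrix_pos mutate_matrix_def[of k b k] max_def algebra_simps\<close>)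
    then show ?thesis by (simp only: exchange_poly_uminus)
  qed
qed

text \<open>
  This is the rank two core of the Laurent phenomenon.  Inverting the value \<open>p\<close> of \<open>P\<^sub>k\<close> makes the
  substitution \<open>x\<^sub>k \<mapsto> P\<^sub>k / x\<^sub>k\<close> harmless on every generator, so \<open>p\<^sup>N g\<close> lies in the target ring for some
  \<open>N\<close>; the factors \<open>p\<close> are then cancelled one by one.
\<close>

lemma two_chart_mutate:
  assumes j: "j \<in> I" and k: "k \<in> I" and jk: "j \<noteq> k"
    and f: "f \<in> two_chart j (exchange_poly (mutate_matrix k b) j)"
    and fg: "ev (yvar(k := ev yvar (exchange_poly b k) / yvar k)) f = ev yvar g"
  shows "g \<in> two_chart j (exchange_poly b j)"
proof -
  let ?G = "two_chart j (exchange_poly b j)"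
  let ?P = "exchange_poly b k"
  let ?P' = "exchange_poly (mutate_matrix k b) j"
  define p where "p = ev yvar ?P"
  define y' where "y' = yvar(k := p / yvar k)"
  \<comment> \<open>The elements of the target ring with the value of \<open>P\<^sub>k\<close> inverted.\<close>
  define S where "S = {h. \<exists>N. \<exists>w\<in>?G. p ^ N * h = ev yvar w}"
  have p0: "p \<noteq> 0" unfolding p_def by (rule exchange_poly_nonzero)
  then have y'0: "y' i \<noteq> 0" for i by (simp add: y'_def)
  have PG: "?P \<in> ?G" by (rule exchange_poly_two_chart) simp
  have p_pow: "p ^ N = ev yvar (?P ^ N)" for N
    by (simp add: p_def ev_power)
  have S_mult: "h * h' \<in> S" if hh': "h \<in> S" "h' \<in> S" for h h'
  proof -
    obtain N w N' w' where "w \<in> ?G" "p ^ N * h = ev yvar w" "w' \<in> ?G" "p ^ N' * h' = ev yvar w'"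
      using hh' unfolding S_def by blast
    then have "w * w' \<in> ?G" "p ^ (N + N') * (h * h') = ev yvar (w * w')"
      by (auto simp: ev_mult power_add two_chart_mult simp flip: \<open>p ^ N * h = ev yvar w\<close>)
    then show ?thesis unfolding S_def by blast
  qed
  have S_add: "h + h' \<in> S" if hh': "h \<in> S" "h' \<in> S" for h h'
  proof -
    obtain N w N' w' where *: "w \<in> ?G" "p ^ N * h = ev yvar w" "w' \<in> ?G" "p ^ N' * h' = ev yvar w'"
      using hh' unfolding S_def by blast
    have "p ^ (N + N') * (h + h') = p ^ N' * (p ^ N * h) + p ^ N * (p ^ N' * h')"
      by (simp add: power_add algebra_simps)
    also have "\<dots> = ev yvar (?P ^ N' * w + ?P ^ N * w')"
      by (simp only: *(2,4)) (simp only: p_pow ev_mult[OF yvar_nonzero] ev_add)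
    finally show ?thesis
      unfolding S_def using * PG by (blast intro: two_chart_add two_chart_mult two_chart_power)
  qed
  have S_power: "h ^ n \<in> S" if "h \<in> S" for h n
  proof (induction n)
    case 0
    have "p ^ 0 * h ^ 0 = ev yvar 1" by simp
    then show ?case unfolding S_def using two_chart_1 by blast
  qed (use that in \<open>simp add: S_mult\<close>)
  have S_single: "ev y' (single e c) \<in> S" if e: "lookup e j \<ge> 0" for e c
  proof -
    define a where "a = lookup e k"
    define w where "w = single (e + single k (- 2 * a)) c * ?P ^ nat (\<bar>a\<bar> + a)"
    have "w \<in> ?G"
      unfolding w_def using e jk
      by (intro two_chart_mult two_chart_single two_chart_power PG) (simp add: lookup_add lookup_single)
    moreover have "p ^ nat \<bar>a\<bar> * ev y' (single e c) = ev yvar w"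
    proof -
      have "ev y' (single e c) = const c * (ev_monomial yvar e * (p / yvar k / yvar k) powi a)"
        unfolding ev_single y'_def a_def by (subst ev_monomial_upd) simp_all
      also have "p / yvar k / yvar k = p * yvar k powi (- 2)"
        by (simp add: power_int_minus field_simps power2_eq_square)
      also have "(p * yvar k powi (- 2)) powi a = p powi a * yvar k powi (- 2 * a)"
        by (simp only: power_int_mult_distrib power_int_mult)
      finally have "p ^ nat \<bar>a\<bar> * ev y' (single e c) =
        const c * (ev_monomial yvar e * yvar k powi (- 2 * a)) * (p ^ nat \<bar>a\<bar> * p powi a)"
        by (simp only: mult_ac)
      also have "p ^ nat \<bar>a\<bar> * p powi a = p powi (\<bar>a\<bar> + a)"
        using p0 power_int_add[of p "\<bar>a\<bar>" a] by (simp add: power_int_def[of p "\<bar>a\<bar>"])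
      also have "\<dots> = p ^ nat (\<bar>a\<bar> + a)"
        by (simp add: power_int_def)
      also have "ev_monomial yvar e * yvar k powi (- 2 * a) = ev_monomial yvar (e + single k (- 2 * a))"
        by (simp add: ev_monomial_add ev_monomial_single)
      finally show ?thesis
        unfolding w_def p_pow by (simp only: ev_mult[OF yvar_nonzero] ev_single)
    qed
    ultimately show ?thesis unfolding S_def by blast
  qed
  have S_quot: "ev y' (?P' * X (- single j 1)) \<in> S"
  proof -
    obtain w where "w \<in> ?G" "ev y' (?P' * X (- single j 1)) = ev yvar w"
      using exchange_compatible[OF j k jk] unfolding y'_def p_def by blast
    then have "p ^ 0 * ev y' (?P' * X (- single j 1)) = ev yvar w" by simp
    then show ?thesis unfolding S_def using \<open>w \<in> ?G\<close> by blast
  qed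
  have "ev y' f \<in> S"
    using f unfolding two_chart_def
  proof induction
    case zero
    have "p ^ 0 * ev y' 0 = ev yvar 0" by simp
    then show ?case unfolding S_def using two_chart_0 by blast
  next
    case (add s f)
    then obtain e c a where s: "s = single e c * ?P' ^ a" "0 \<le> lookup e j + int a" by blast
    define e' where "e' = e + frag_cmul (int a) (single j 1)"
    have "e = e' + frag_cmul (int a) (- single j 1)"
      by (rule poly_mapping_eqI) (simp add: e'_def lookup_add)
    then have "single e c = single e' c * X (frag_cmul (int a) (- single j 1))"
      by (simp only: mult_single mult_1_right)
    then have "s = single e' c * X (- single j 1) ^ a * ?P' ^ a"
      unfolding s X_of_nat_mult by (rule arg_cong)
    also have "\<dots> = single e' c * (?P' * X (- single j 1)) ^ a"
      by (simp only: power_mult_distrib mult_ac)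
    finally have "s = single e' c * (?P' * X (- single j 1)) ^ a" .
    then have "ev y' s = ev y' (single e' c) *
        ev y' (?P' * X (- single j 1)) ^ a"
      by (simp only: ev_mult[OF y'0] ev_power[OF y'0])
    also have "\<dots> \<in> S"
      using s(2) by (intro S_mult S_power S_quot S_single) (simp add: e'_def lookup_add)
    finally show ?case using add by (simp add: ev_add S_add)
  qed
  then obtain N w where w: "w \<in> ?G" "p ^ N * ev yvar g = ev yvar w"
    using fg unfolding S_def y'_def p_def by auto
  then have "ev yvar (?P ^ N * g) = ev yvar w"
    by (simp add: p_pow ev_mult)
  then have "?P ^ N * g \<in> ?G" using ev_yvar_inj w(1) by metis
  then show "g \<in> ?G"
  proof (induction N)
    case (Suc N)
    then show ?case using two_chart_cancel[OF j k jk, of "?P ^ N * g"] by (simp add: mult.assoc)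
  qed simp
qed

text \<open>
  The upper bound is expressed in the coordinates of its own cluster, so that it depends on the
  exchange matrix only.
\<close>

definition upper_bound :: "laurent set" where
  "upper_bound = {f. \<forall>k\<in>I. f \<in> two_chart k (exchange_poly b k)}"

end

lemma (in exchange_matrix) upper_bound_mutate:
  assumes k: "k \<in> I" and f: "f \<in> exchange_matrix.upper_bound I (mutate_matrix k b)"
  shows "\<exists>g\<in>upper_bound. \<forall>u. (\<forall>i. u i \<noteq> 0) \<longrightarrow> ev u (exchange_poly b k) \<noteq> 0 \<longrightarrow>
           ev (u(k := ev u (exchange_poly b k) / u k)) f = ev u g"
proof -
  interpret b': exchange_matrix I "mutate_matrix k b"
    by (rule mutate_exchange_matrix) fact
  have "f \<in> two_chart k (exchange_poly b k)"
    using f k exchange_poly_mutate_same[of k] by (auto simp: b'.upper_bound_def)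
  then obtain g where g: "g \<in> two_chart k (exchange_poly b k)"
    "\<forall>u. (\<forall>i. u i \<noteq> 0) \<longrightarrow> ev u (exchange_poly b k) \<noteq> 0 \<longrightarrow>
           ev (u(k := ev u (exchange_poly b k) / u k)) f = ev u g"
    using two_chart_substitute[OF poly_deg_free[OF k]] by blast
  have "g \<in> two_chart j (exchange_poly b j)" if "j \<in> I" for j
  proof (cases "j = k")
    case False
    show ?thesis
      by (rule two_chart_mutate[OF that k False, of f])
         (use f that g(2) in \<open>auto simp: b'.upper_bound_def exchange_poly_nonzero\<close>)
  qed (use g in auto)
  then show ?thesis using g(2) unfolding upper_bound_def by blast
qed

section \<open>Leading monomials and the lower bound of an acyclic seed\<close>

text \<open>
  The lexicographic order on exponents, with the lowest index most significant, is used in both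
  directions, through \<open>\<psi>\<close> the identity or the negation.
\<close>

locale monomial_order =
  fixes \<psi> :: "(nat \<Rightarrow>\<^sub>0 int) \<Rightarrow> (nat \<Rightarrow>\<^sub>0 int)"
  assumes order_add: "\<psi> (a + b) = \<psi> a + \<psi> b" and order_inj: "\<psi> a = \<psi> b \<Longrightarrow> a = b"
begin

definition trailing :: "laurent \<Rightarrow> (nat \<Rightarrow>\<^sub>0 int) \<Rightarrow> bool" where
  "trailing f a \<longleftrightarrow> a \<in> keys f \<and> (\<forall>e\<in>keys f. \<psi> a \<le> \<psi> e)"

lemma trailing_single: "c \<noteq> 0 \<Longrightarrow> trailing (single a c) a"
  by (simp add: trailing_def)

lemma trailing_sum:
  assumes "trailing f a" "\<And>e. e \<in> keys g \<Longrightarrow> \<psi> a < \<psi> e"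
  shows "trailing (f + g) a"
proof -
  have "a \<notin> keys g" using assms(2) by blast
  then have "a \<in> keys (f + g)"
    using assms(1) by (simp add: trailing_def in_keys_iff lookup_add)
  moreover have "\<psi> a \<le> \<psi> e" if "e \<in> keys (f + g)" for e
    using that keys_add[of f g] assms by (fastforce simp: trailing_def)
  ultimately show ?thesis by (simp add: trailing_def)
qed

lemma trailing_split:
  assumes "trailing f a"
  obtains c g where "f = single a c + g" "c \<noteq> 0" "\<And>e. e \<in> keys g \<Longrightarrow> \<psi> a < \<psi> e"
proof
  let ?g = "f - single a (lookup f a)"
  show "f = single a (lookup f a) + ?g" by simp
  show "lookup f a \<noteq> 0" using assms by (simp add: trailing_def in_keys_iff)
  fix e assume "e \<in> keys ?g"
  then have "e \<in> keys f" "e \<noteq> a"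
    by (auto simp: in_keys_iff lookup_minus lookup_single when_def split: if_splits)
  then show "\<psi> a < \<psi> e"
    using assms order_inj[of a e] by (auto simp: trailing_def order_less_le)
qed

lemma trailing_mult:
  assumes "trailing f a" "trailing g b"
  shows "trailing (f * g) (a + b)"
proof -
  obtain c f' where f: "f = single a c + f'" "c \<noteq> 0" "\<And>e. e \<in> keys f' \<Longrightarrow> \<psi> a < \<psi> e"
    using trailing_split[OF assms(1)] by blast
  obtain d g' where g: "g = single b d + g'" "d \<noteq> 0" "\<And>e. e \<in> keys g' \<Longrightarrow> \<psi> b < \<psi> e"
    using trailing_split[OF assms(2)] by blast
  have "f * g = single (a + b) (c * d) + (single a c * g' + f' * g)"
    by (simp add: f(1) g(1) distrib_left distrib_right mult_single)
  moreover have "trailing (single (a + b) (c * d) + (single a c * g' + f' * g)) (a + b)"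
  proof (rule trailing_sum)
    show "trailing (single (a + b) (c * d)) (a + b)"
      using f(2) g(2) by (intro trailing_single) simp
    fix e assume "e \<in> keys (single a c * g' + f' * g)"
    then have "e \<in> keys (single a c * g') \<or> e \<in> keys (f' * g)"
      using keys_add[of "single a c * g'" "f' * g"] by blast
    then show "\<psi> (a + b) < \<psi> e"
    proof
      assume "e \<in> keys (single a c * g')"
      then obtain e' where "e = a + e'" "e' \<in> keys g'"
        using keys_mult[of "single a c" g'] by (auto split: if_splits)
      then show ?thesis using g(3)[of e'] by (simp add: order_add)
    next
      assume "e \<in> keys (f' * g)"
      then obtain e' e'' where "e = e' + e''" "e' \<in> keys f'" "e'' \<in> keys g"
        using keys_mult[of f' g] by auto
      then show ?thesis using f(3)[of e'] assms(2)
        by (auto simp: order_add trailing_def intro: add_less_le_mono)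
    qed
  qed
  ultimately show ?thesis by simp
qed

lemma trailing_power:
  assumes "trailing f a"
  shows "trailing (f ^ n) (frag_cmul (int n) a)"
proof (induction n)
  case (Suc n)
  have "frag_cmul (int (Suc n)) a = a + frag_cmul (int n) a"
    by (simp add: frag_cmul_distrib)
  then show ?case using trailing_mult[OF assms Suc] by simp
qed (use trailing_single[of 1 0] in simp)

lemma trailing_prod:
  assumes "\<And>i. i \<in> A \<Longrightarrow> trailing (f i) (a i)"
  shows "trailing (prod f A) (sum a A)"
  using assms
proof (induction A rule: infinite_finite_induct)
  case (insert x A)
  then show ?case by (simp add: trailing_mult)
qed (use trailing_single[of 1 0] in simp_all)

end

text \<open>
  The trailing exponent of \<open>T k\<close> is \<open>-1\<close> at \<open>k\<close> and vanishes at all smaller indices.  Replacing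
  negative powers of the variable \<open>k\<close> by powers of \<open>T k\<close> therefore changes the exponent of a monomial
  at later indices only.
\<close>

locale triangular_family = monomial_order +
  fixes K :: "nat set" and T :: "nat \<Rightarrow> laurent" and w :: "nat \<Rightarrow> nat \<Rightarrow>\<^sub>0 int"
  assumes finite_K: "finite K"
    and trailing_T: "k \<in> K \<Longrightarrow> trailing (T k) (w k - single k 1)"
    and triangular: "k \<in> K \<Longrightarrow> i \<le> k \<Longrightarrow> lookup (w k) i = 0"
begin

text \<open>
  The integer vector \<open>r\<close> encodes a pair of exponents with product zero at each index of \<open>K\<close>, a negative
  entry standing for a power of \<open>T k\<close>.
\<close>

definition standard :: "(nat \<Rightarrow>\<^sub>0 int) \<Rightarrow> laurent" where
  "standard r = X (r + (\<Sum>k\<in>K. single k (max 0 (- lookup r k)))) *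
     (\<Prod>k\<in>K. T k ^ nat (- lookup r k))"

definition exponent :: "(nat \<Rightarrow>\<^sub>0 int) \<Rightarrow> nat \<Rightarrow>\<^sub>0 int" where
  "exponent r = r + (\<Sum>k\<in>K. frag_cmul (max 0 (- lookup r k)) (w k))"

lemma trailing_standard: "trailing (standard r) (exponent r)"
proof -
  have "trailing (standard r) (r + (\<Sum>k\<in>K. single k (max 0 (- lookup r k))) +
      (\<Sum>k\<in>K. frag_cmul (int (nat (- lookup r k))) (w k - single k 1)))"
    unfolding standard_def
    by (intro trailing_mult trailing_single trailing_prod trailing_power trailing_T) auto
  also have "r + (\<Sum>k\<in>K. single k (max 0 (- lookup r k))) +
      (\<Sum>k\<in>K. frag_cmul (int (nat (- lookup r k))) (w k - single k 1)) = exponent r"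
  proof (rule poly_mapping_eqI)
    fix i
    have "(\<Sum>k\<in>K. lookup (single k (max 0 (- lookup r k))) i) +
        (\<Sum>k\<in>K. int (nat (- lookup r k)) * (lookup (w k) i - lookup (single k 1) i)) =
      (\<Sum>k\<in>K. max 0 (- lookup r k) * lookup (w k) i)"
      unfolding sum.distrib[symmetric]
      by (rule sum.cong) (auto simp: lookup_single when_def max_def algebra_simps)
    then show "lookup (r + (\<Sum>k\<in>K. single k (max 0 (- lookup r k))) +
      (\<Sum>k\<in>K. frag_cmul (int (nat (- lookup r k))) (w k - single k 1))) i = lookup (exponent r) i"
      by (simp add: exponent_def lookup_add lookup_sum lookup_minus)
  qed
  finally show ?thesis .
qed

lemma lookup_exponent:
  "lookup (exponent r) i = lookup r i + (\<Sum>k\<in>K. max 0 (- lookup r k) * lookup (w k) i)"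
  by (simp add: exponent_def lookup_add lookup_sum)

lemma exponent_inj:
  assumes "exponent r = exponent r'"
  shows "r = r'"
proof (rule poly_mapping_eqI)
  fix i
  show "lookup r i = lookup r' i"
  proof (induction i rule: less_induct)
    case (less i)
    have "(\<Sum>k\<in>K. max 0 (- lookup r k) * lookup (w k) i) = (\<Sum>k\<in>K. max 0 (- lookup r' k) * lookup (w k) i)"
    proof (rule sum.cong[OF refl])
      fix k assume "k \<in> K"
      then show "max 0 (- lookup r k) * lookup (w k) i = max 0 (- lookup r' k) * lookup (w k) i"
        using less[of k] triangular[of k i] by (cases "k < i") auto
    qed
    moreover have "lookup (exponent r) i = lookup (exponent r') i" using assms by simp
    ultimately show ?case unfolding lookup_exponent by linarith
  qed
qed

lemma standard_independent:
  assumes "finite F" "F \<noteq> {}" "\<And>r. r \<in> F \<Longrightarrow> c r \<noteq> 0"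
  shows "\<exists>r\<in>F. exponent r \<in> keys (\<Sum>r\<in>F. single 0 (c r) * standard r)"
proof -
  define m where "m = Min (\<psi> ` exponent ` F)"
  have "m \<in> \<psi> ` exponent ` F" unfolding m_def using assms by (intro Min_in) auto
  then obtain r0 where r0: "r0 \<in> F" "m = \<psi> (exponent r0)" by blast
  have zero: "lookup (standard r) (exponent r0) = 0" if "r \<in> F" "r \<noteq> r0" for r
  proof (rule ccontr)
    assume "lookup (standard r) (exponent r0) \<noteq> 0"
    then have "\<psi> (exponent r) \<le> \<psi> (exponent r0)"
      using trailing_standard[of r] by (simp add: trailing_def in_keys_iff)
    moreover have "\<psi> (exponent r0) \<le> \<psi> (exponent r)"
      using assms(1) that(1) r0 by (auto simp: m_def intro!: Min_le simp flip: r0(2))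
    ultimately have "r = r0" using order_inj exponent_inj by (metis order_antisym)
    then show False using that(2) by simp
  qed
  have lookup0: "lookup (single 0 c * f) e = c * lookup f e" for c :: complex and f :: laurent and e
    by (simp add: map.rep_eq when_def flip: mult_map_scale_conv_mult)
  have "lookup (\<Sum>r\<in>F. single 0 (c r) * standard r) (exponent r0) =
      (\<Sum>r\<in>F. c r * lookup (standard r) (exponent r0))"
    by (simp add: lookup_sum lookup0)
  also have "\<dots> = (\<Sum>r\<in>{r0}. c r * lookup (standard r) (exponent r0))"
    by (rule sum.mono_neutral_right) (use assms r0 zero in auto)
  also have "\<dots> \<noteq> 0"
    using assms(3)[OF r0(1)] trailing_standard[of r0] by (simp add: trailing_def in_keys_iff)
  finally show ?thesis using r0 by (auto simp: in_keys_iff)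
qed

end

lemma add_closure_family:
  assumes "s \<in> add_closure {single 0 c * \<sigma> r | c r. r \<in> A}"
  shows "\<exists>F c. finite F \<and> F \<subseteq> A \<and> (\<forall>r\<in>F. c r \<noteq> 0) \<and> s = (\<Sum>r\<in>F. single 0 (c r) * (\<sigma> r :: laurent))"
proof -
  have "\<exists>F c. finite F \<and> F \<subseteq> A \<and> s = (\<Sum>r\<in>F. single 0 (c r) * (\<sigma> r :: laurent))"
    using assms
  proof induction
    case zero
    show ?case by (rule exI[of _ "{}"]) auto
  next
    case (add s f)
    then obtain F c d r where F: "finite F" "F \<subseteq> A" "f = (\<Sum>r\<in>F. single 0 (c r) * \<sigma> r)"
      "s = single 0 d * \<sigma> r" "r \<in> A" by blast
    define c' where "c' = (\<lambda>r'. (if r' \<in> F then c r' else 0) + (if r' = r then d else 0))"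
    have "(\<Sum>r'\<in>insert r F. single 0 (c' r') * \<sigma> r') =
       (\<Sum>r'\<in>insert r F. single 0 (if r' \<in> F then c r' else 0) * \<sigma> r') +
       (\<Sum>r'\<in>insert r F. single 0 (if r' = r then d else 0) * \<sigma> r')"
      by (simp only: c'_def single_add distrib_right sum.distrib)
    also have "(\<Sum>r'\<in>insert r F. single 0 (if r' \<in> F then c r' else 0) * \<sigma> r') = f"
      unfolding F(3) by (rule sum.mono_neutral_cong_right) (use F(1) in auto)
    also have "(\<Sum>r'\<in>insert r F. single 0 (if r' = r then d else 0) * \<sigma> r') = (\<Sum>r'\<in>{r}. single 0 d * \<sigma> r')"
      by (rule sum.mono_neutral_cong_right) (use F(1) in auto)
    finally show ?case
      using F by (intro exI[of _ "insert r F"] exI[of _ c']) (auto simp: add.commute)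
  qed
  then obtain F c where F: "finite F" "F \<subseteq> A" "s = (\<Sum>r\<in>F. single 0 (c r) * \<sigma> r)" by blast
  have "s = (\<Sum>r\<in>{r\<in>F. c r \<noteq> 0}. single 0 (c r) * \<sigma> r)"
    unfolding F(3) by (rule sum.mono_neutral_cong_right) (use F(1) in auto)
  then show ?thesis using F by (intro exI[of _ "{r\<in>F. c r \<noteq> 0}"] exI[of _ c]) auto
qed

text \<open>
  Taking a graded part in \<open>x\<^sub>t\<close> commutes with taking one in \<open>x\<^sub>k\<close>, and preserves multiples of powers of
  \<open>P\<close> when \<open>P\<close> does not involve \<open>x\<^sub>t\<close>.
\<close>

lemma two_chart_graded_part:
  assumes f: "f \<in> two_chart k P" and P: "deg_free k P" "deg_free t P"
  shows "graded_part (\<lambda>e. lookup e t) a f \<in> two_chart k P"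
  unfolding two_chart_iff[OF P(1)]
proof
  fix n :: nat
  have "P ^ n dvd graded_part (\<lambda>e. lookup e k) (- int n) f"
    using f unfolding two_chart_iff[OF P(1)] by blast
  then have "P ^ n dvd graded_part (\<lambda>e. lookup e t) a (graded_part (\<lambda>e. lookup e k) (- int n) f)"
    by (rule deg.dvd_graded_part[OF deg.homogeneous_power[OF P(2)]])
  then show "P ^ n dvd graded_part (\<lambda>e. lookup e k) (- int n) (graded_part (\<lambda>e. lookup e t) a f)"
    by (simp only: graded_part_graded_part)
qed

text \<open>
  Frozen rows are included in the sign conditions: a frozen index above \<open>I\<close> may only have
  nonnegative entries.
\<close>

locale acyclic_exchange_matrix = exchange_matrix +
  assumes above: "k \<in> I \<Longrightarrow> k < i \<Longrightarrow> b i k \<ge> 0"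
    and below: "k \<in> I \<Longrightarrow> i < k \<Longrightarrow> b i k \<le> 0"
begin

abbreviation "P \<equiv> exchange_poly b"

abbreviation \<epsilon> :: "nat \<Rightarrow> nat \<Rightarrow>\<^sub>0 int" where
  "\<epsilon> k \<equiv> single k 1"

text \<open>
  The cluster variable obtained from the initial seed by one mutation in direction \<open>k\<close>.
\<close>

definition z :: "nat \<Rightarrow> laurent" where
  "z k = P k * X (- \<epsilon> k)"

lemma lookup_pos: "lookup (pos_part b k) i = max 0 (b i k)"
  and lookup_neg: "lookup (neg_part b k) i = max 0 (- b i k)"
  by (simp_all add: lookup_pos_part lookup_neg_part)

lemma z_mult: "z k * X (\<epsilon> k) = P k"
proof -
  have "z k * X (\<epsilon> k) = P k * (X (\<epsilon> k) * X (- \<epsilon> k))"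
    by (simp only: z_def mult_ac)
  then show ?thesis by (simp only: X_uminus mult_1_right)
qed

text \<open>
  Variables outside \<open>A\<close> are inverted.  For \<open>A = B\<close> this is the ring generated by the cluster and
  its neighbours with the vertices of \<open>A\<close> mutable; the case \<open>A = insert t B\<close> serves for the passage from \<open>B\<close> to
  \<open>insert t B\<close>.
\<close>

definition lower_bound :: "nat set \<Rightarrow> nat set \<Rightarrow> laurent set" where
  "lower_bound A B = add_closure {single e c * (\<Prod>k\<in>B. z k ^ q k) | e c q. \<forall>k\<in>A. lookup e k \<ge> 0}"

lemma lower_bound_gen:
  "(\<And>k. k \<in> A \<Longrightarrow> lookup e k \<ge> 0) \<Longrightarrow> single e c * (\<Prod>k\<in>B. z k ^ q k) \<in> lower_bound A B"
  unfolding lower_bound_def by (rule add_closure_base) blast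

lemma lower_bound_induct [consumes 1, case_names zero add]:
  assumes "f \<in> lower_bound A B" "Q 0"
    "\<And>e c q f. (\<And>k. k \<in> A \<Longrightarrow> lookup e k \<ge> 0) \<Longrightarrow> f \<in> lower_bound A B \<Longrightarrow> Q f \<Longrightarrow>
       Q (single e c * (\<Prod>k\<in>B. z k ^ q k) + f)"
  shows "Q f"
  using assms(1) unfolding lower_bound_def
proof induction
  case (add s f)
  then obtain e c q where s: "s = single e c * (\<Prod>k\<in>B. z k ^ q k)" "\<forall>k\<in>A. lookup e k \<ge> 0"
    by blast
  show ?case unfolding s(1) by (rule assms(3)) (use s(2) add in \<open>auto simp: lower_bound_def\<close>)
qed (rule assms(2))

lemma lower_bound_0: "0 \<in> lower_bound A B"
  unfolding lower_bound_def by (rule add_closure.zero)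

lemma lower_bound_add: "f \<in> lower_bound A B \<Longrightarrow> g \<in> lower_bound A B \<Longrightarrow> f + g \<in> lower_bound A B"
  unfolding lower_bound_def by (rule add_closure_add)

lemma lower_bound_single: "(\<And>k. k \<in> A \<Longrightarrow> lookup e k \<ge> 0) \<Longrightarrow> single e c \<in> lower_bound A B"
  using lower_bound_gen[where A = A and e = e and c = c and B = B and q = "\<lambda>_. 0"] by simp

lemma lower_bound_mult:
  assumes "f \<in> lower_bound A B" "g \<in> lower_bound A B"
  shows "f * g \<in> lower_bound A B"
  using assms unfolding lower_bound_def
proof (rule add_closure_mult, safe)
  fix e e' :: "nat \<Rightarrow>\<^sub>0 int" and q q' :: "nat \<Rightarrow> nat" and c c' :: complex
  assume *: "\<forall>k\<in>A. 0 \<le> lookup e k" "\<forall>k\<in>A. 0 \<le> lookup e' k"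
  have "single e c * (\<Prod>k\<in>B. z k ^ q k) * (single e' c' * (\<Prod>k\<in>B. z k ^ q' k)) =
      (single e c * single e' c') * ((\<Prod>k\<in>B. z k ^ q k) * (\<Prod>k\<in>B. z k ^ q' k))"
    by (simp only: mult_ac)
  also have "\<dots> = single (e + e') (c * c') * (\<Prod>k\<in>B. z k ^ (q k + q' k))"
    by (simp only: mult_single power_add prod.distrib)
  also have "\<dots> \<in> lower_bound A B"
    by (rule lower_bound_gen) (use * in \<open>simp add: lookup_add\<close>)
  finally show "single e c * (\<Prod>k\<in>B. z k ^ q k) * (single e' c' * (\<Prod>k\<in>B. z k ^ q' k))
     \<in> add_closure {single e c * (\<Prod>k\<in>B. z k ^ q k) | e c q. \<forall>k\<in>A. lookup e k \<ge> 0}"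
    unfolding lower_bound_def .
qed

lemma lower_bound_1: "1 \<in> lower_bound A B"
  using lower_bound_single[of A 0 1 B] by simp

lemma lower_bound_power: "f \<in> lower_bound A B \<Longrightarrow> f ^ n \<in> lower_bound A B"
  by (induction n) (auto simp: lower_bound_1 lower_bound_mult)

lemma lower_bound_uminus: "f \<in> lower_bound A B \<Longrightarrow> - f \<in> lower_bound A B"
  using lower_bound_mult[of "single 0 (-1)" A B f] lower_bound_single[of A 0 "-1" B]
  by (simp add: single_uminus)

lemma lower_bound_diff: "f \<in> lower_bound A B \<Longrightarrow> g \<in> lower_bound A B \<Longrightarrow> f - g \<in> lower_bound A B"
  using lower_bound_add[OF _ lower_bound_uminus, of f A B g] by simp

lemma lower_bound_prod_mono:
  assumes "B \<subseteq> B'" "finite B'"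
  shows "(\<Prod>k\<in>B. z k ^ q k) = (\<Prod>k\<in>B'. z k ^ (if k \<in> B then q k else 0))"
  by (rule prod.mono_neutral_cong_left) (use assms in auto)

lemma lower_bound_mono:
  assumes "B \<subseteq> B'" "finite B'" "f \<in> lower_bound A B"
  shows "f \<in> lower_bound A B'"
  using assms(3)
proof (induction rule: lower_bound_induct)
  case (add e c q f)
  then show ?case
    unfolding lower_bound_prod_mono[OF assms(1,2)]
    by (intro lower_bound_add lower_bound_gen)
qed (rule lower_bound_0)

lemma lower_bound_z: "k \<in> B \<Longrightarrow> finite B \<Longrightarrow> z k \<in> lower_bound A B"
  using lower_bound_gen[where A = A and e = 0 and c = 1 and B = B and q = "\<lambda>j. if j = k then 1 else 0"]
  by (simp add: if_distrib[of "\<lambda>n. _ ^ n"] prod.If_cases cong: if_cong)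

lemma lower_bound_P: "P k \<in> lower_bound A B"
  unfolding exchange_poly_def
  by (intro lower_bound_add lower_bound_single) (simp_all add: lookup_pos lookup_neg)

lemma lower_bound_two_chart:
  assumes "f \<in> lower_bound A B" "k \<in> A"
  shows "f \<in> two_chart k (P k)"
  using assms(1)
proof (induction rule: lower_bound_induct)
  case (add e c q f)
  have "z j \<in> two_chart k (P k)" for j
  proof (cases "j = k")
    case False
    then show ?thesis unfolding z_def
      by (intro two_chart_mult exchange_poly_two_chart two_chart_single) (auto simp: lookup_single)
  qed (simp add: z_def two_chart_quotient)
  then show ?case
    using add(1)[OF assms(2)] add(3)
    by (intro two_chart_add two_chart_mult two_chart_prod two_chart_power two_chart_single)
qed (rule two_chart_0)

sublocale id_order: monomial_order "\<lambda>e. e"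
  by standard auto

text \<open>
  Of the two terms of \<open>P\<^sub>k\<close>, one involves smaller indices only and the other larger ones only.  The
  latter is lexicographically smaller unless the former is 1.
\<close>

lemma trailing_z:
  assumes "k \<in> I"
  shows "\<exists>w. id_order.trailing (z k) (w - \<epsilon> k) \<and> (\<forall>i\<le>k. lookup w i = 0)"
proof -
  have sum: "z k = X (pos_part b k - \<epsilon> k) + X (neg_part b k - \<epsilon> k)"
    unfolding z_def exchange_poly_def distrib_right X_add[symmetric] by simp
  have pos0: "lookup (pos_part b k) i = 0" if "i \<le> k" for i
    using that below[OF assms, of i] diag[OF assms] by (cases "i = k") (auto simp: lookup_pos)
  have neg0: "lookup (neg_part b k) i = 0" if "i \<ge> k" for i
    using that above[OF assms, of i] diag[OF assms] by (cases "i = k") (auto simp: lookup_neg)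
  show ?thesis
  proof (cases "neg_part b k = 0")
    case True
    have nonneg: "0 \<le> pos_part b k"
    proof (rule ccontr)
      assume "\<not> 0 \<le> pos_part b k"
      then have "pos_part b k < 0" by simp
      then obtain i where "lookup (pos_part b k) i < 0"
        by (auto simp: less_poly_mapping.rep_eq less_fun_def)
      then show False by (simp add: lookup_pos)
    qed
    show ?thesis
    proof (intro exI[of _ 0] conjI)
      show "id_order.trailing (z k) (0 - \<epsilon> k)"
      proof (cases "pos_part b k = 0")
        case pos: True
        have "z k = single (- \<epsilon> k) 2"
          unfolding sum True pos by (simp flip: single_add)
        then show ?thesis using id_order.trailing_single[of 2 "- \<epsilon> k"] by simp
      next
        case False
        have "id_order.trailing (X (neg_part b k - \<epsilon> k) + X (pos_part b k - \<epsilon> k)) (neg_part b k - \<epsilon> k)"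
          by (rule id_order.trailing_sum[OF id_order.trailing_single]) (use nonneg True False in auto)
        then show ?thesis unfolding sum True by (simp add: add.commute)
      qed
    qed auto
  next
    case False
    define i where "i = (LEAST i. lookup (neg_part b k) i \<noteq> 0)"
    have "\<exists>i. lookup (neg_part b k) i \<noteq> 0"
      using False by (metis lookup_zero poly_mapping_eqI)
    then have i: "lookup (neg_part b k) i \<noteq> 0"
      unfolding i_def by (rule LeastI_ex)
    have i': "lookup (neg_part b k) i' = 0" if "i' < i" for i'
      using not_less_Least[of i' "\<lambda>i. lookup (neg_part b k) i \<noteq> 0"] that unfolding i_def by blast
    have ik: "i < k" using i neg0[of i] by force
    have "less_fun (lookup (pos_part b k)) (lookup (neg_part b k))"
      unfolding less_fun_def
      using i i' ik pos0 by (intro exI[of _ i]) (auto simp: lookup_neg)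
    then have less: "pos_part b k < neg_part b k"
      by (simp add: less_poly_mapping.rep_eq)
    show ?thesis
    proof (intro exI[of _ "pos_part b k"] conjI)
      show "id_order.trailing (z k) (pos_part b k - \<epsilon> k)"
        unfolding sum
        by (rule id_order.trailing_sum[OF id_order.trailing_single]) (use less in auto)
    qed (use pos0 in auto)
  qed
qed

text \<open>
  Rewriting \<open>x\<^sub>k z\<^sub>k\<close> as \<open>P\<^sub>k\<close> lowers the number of factors \<open>z\<close>, so products reduce to standard ones;
  those containing \<open>x\<^sub>t\<close> are collected in the first summand.
\<close>

lemma lower_bound_reduce:
  assumes M: "M \<subseteq> I" "t \<in> M" "triangular_family (\<lambda>e. e) (M - {t}) z w"
    and d: "d \<in> lower_bound M (M - {t})"
  shows "\<exists>d'\<in>lower_bound M (M - {t}). \<exists>s\<in>add_closure {single 0 c * triangular_family.standard (M - {t}) z r | c r. r \<in> {r. lookup r t = 0}}.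
           d = X (\<epsilon> t) * d' + s"
proof -
  interpret triangular_family "\<lambda>e. e" "M - {t}" z w by fact
  let ?D = "lower_bound M (M - {t})"
  let ?S = "add_closure {single 0 c * standard r | c r. r \<in> {r. lookup r t = 0}}"
  define Good where "Good = {d. \<exists>d'\<in>?D. \<exists>s\<in>?S. d = X (\<epsilon> t) * d' + s}"
  have Good_add: "f + g \<in> Good" if fg: "f \<in> Good" "g \<in> Good" for f g
  proof -
    obtain f' s g' s' where "f' \<in> ?D" "s \<in> ?S" "f = X (\<epsilon> t) * f' + s" "g' \<in> ?D" "s' \<in> ?S" "g = X (\<epsilon> t) * g' + s'"
      using fg unfolding Good_def by blast
    then have "f' + g' \<in> ?D" "s + s' \<in> ?S" "f + g = X (\<epsilon> t) * (f' + g') + (s + s')"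
      by (auto simp: distrib_left add_ac intro: lower_bound_add add_closure_add)
    then show ?thesis unfolding Good_def by blast
  qed
  have gen: "single e c * (\<Prod>k\<in>M - {t}. z k ^ q k) \<in> Good"
    if "\<And>k. k \<in> M \<Longrightarrow> lookup e k \<ge> 0" for e c q
    using that
  proof (induction "\<Sum>k\<in>M - {t}. q k" arbitrary: e q rule: less_induct)
    case less
    consider "lookup e t > 0" | k where "k \<in> M - {t}" "q k > 0" "lookup e k > 0"
      | "lookup e t = 0" "\<And>k. k \<in> M - {t} \<Longrightarrow> q k = 0 \<or> lookup e k = 0"
      using less.prems M(2) by (metis Diff_iff gr0I order_le_less)
    then show ?case
    proof cases
      case 1
      have "e = \<epsilon> t + (e - \<epsilon> t)" by simp
      then have "single e c = X (\<epsilon> t) * single (e - \<epsilon> t) c"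
        by (simp only: mult_single mult_1_left)
      then have "single e c * (\<Prod>k\<in>M - {t}. z k ^ q k) =
         X (\<epsilon> t) * (single (e - \<epsilon> t) c * (\<Prod>k\<in>M - {t}. z k ^ q k)) + 0"
        by (simp only: mult.assoc add_0_right)
      moreover have "single (e - \<epsilon> t) c * (\<Prod>k\<in>M - {t}. z k ^ q k) \<in> ?D"
        by (rule lower_bound_gen) (use 1 less.prems in \<open>auto simp: lookup_minus lookup_single when_def\<close>)
      ultimately show ?thesis unfolding Good_def using add_closure.zero by blast
    next
      case 2
      have fin: "finite (M - {t})" by (rule finite_K)
      define q' where "q' = q(k := q k - 1)"
      have prod: "(\<Prod>k\<in>M - {t}. z k ^ q k) = z k * (\<Prod>k\<in>M - {t}. z k ^ q' k)"
      proof -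
        have "(\<Prod>k\<in>M - {t}. z k ^ q k) = z k ^ q k * (\<Prod>j\<in>M - {t} - {k}. z j ^ q j)"
          using fin 2(1) by (rule prod.remove)
        also have "(\<Prod>j\<in>M - {t} - {k}. z j ^ q j) = (\<Prod>j\<in>M - {t} - {k}. z j ^ q' j)"
          by (rule prod.cong) (auto simp: q'_def)
        also have "z k ^ q k = z k * z k ^ q' k"
          using 2(2) by (simp add: q'_def flip: power_Suc)
        finally show ?thesis
          using prod.remove[OF fin 2(1), of "\<lambda>j. z j ^ q' j"] by (simp only: mult.assoc)
      qed
      have sum: "(\<Sum>k\<in>M - {t}. q' k) < (\<Sum>k\<in>M - {t}. q k)"
        by (rule sum_strict_mono_ex1) (use fin 2 in \<open>auto simp: q'_def\<close>)
      have "e = (e - \<epsilon> k) + \<epsilon> k" by simp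
      then have "single e c = single (e - \<epsilon> k) c * X (\<epsilon> k)"
        by (simp only: mult_single mult_1_right)
      then have "single e c * (\<Prod>k\<in>M - {t}. z k ^ q k) =
          single (e - \<epsilon> k) c * (z k * X (\<epsilon> k)) * (\<Prod>k\<in>M - {t}. z k ^ q' k)"
        unfolding prod by (simp only: mult_ac)
      also have "\<dots> = single (e - \<epsilon> k + pos_part b k) c * (\<Prod>k\<in>M - {t}. z k ^ q' k) +
         single (e - \<epsilon> k + neg_part b k) c * (\<Prod>k\<in>M - {t}. z k ^ q' k)"
        unfolding z_mult unfolding exchange_poly_def by (simp only: distrib_left distrib_right mult_single mult_1_right)
      also have "\<dots> \<in> Good"
        by (intro Good_add less.hyps sum)
           (use 2 less.prems in \<open>auto simp: lookup_add lookup_minus lookup_single when_def lookup_pos lookup_neg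
              intro: add_nonneg_nonneg\<close>)
      finally show ?thesis .
    next
      case 3
      define r where "r = e - (\<Sum>k\<in>M - {t}. single k (int (q k)))"
      have lookup_r: "lookup r i = lookup e i - (if i \<in> M - {t} then int (q i) else 0)" for i
        using finite_K by (simp add: r_def lookup_minus lookup_sum lookup_single when_def)
      have q: "max 0 (- lookup r k) = int (q k)" "nat (- lookup r k) = q k" if "k \<in> M - {t}" for k
        using 3(2)[OF that] less.prems[of k] that by (auto simp: lookup_r)
      have "standard r = X e * (\<Prod>k\<in>M - {t}. z k ^ q k)"
      proof -
        have "(\<Sum>k\<in>M - {t}. single k (max 0 (- lookup r k))) = (\<Sum>k\<in>M - {t}. single k (int (q k)))"
          by (rule sum.cong) (simp_all only: q)
        moreover have "(\<Prod>k\<in>M - {t}. z k ^ nat (- lookup r k)) = (\<Prod>k\<in>M - {t}. z k ^ q k)"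
          by (rule prod.cong) (simp_all only: q)
        ultimately show ?thesis
          unfolding standard_def by (simp add: r_def)
      qed
      then have "single e c * (\<Prod>k\<in>M - {t}. z k ^ q k) = X (\<epsilon> t) * 0 + single 0 c * standard r"
        by (simp add: mult_single flip: mult.assoc)
      moreover have "single 0 c * standard r \<in> ?S"
      proof (rule add_closure_base)
        have "lookup r t = 0" using 3(1) by (simp add: lookup_r)
        then show "single 0 c * standard r \<in> {single 0 c * standard r | c r. r \<in> {r. lookup r t = 0}}"
          by blast
      qed
      ultimately show ?thesis unfolding Good_def using lower_bound_0 by blast
    qed
  qed
  have "0 \<in> Good"
  proof -
    have "(0 :: laurent) = X (\<epsilon> t) * 0 + 0" by simp
    then show ?thesis unfolding Good_def using lower_bound_0 add_closure.zero by blast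
  qed
  with d have "d \<in> Good"
    by (induction rule: lower_bound_induct) (auto intro: Good_add gen)
  then show ?thesis unfolding Good_def by blast
qed

lemma lower_bound_keys_nonneg:
  assumes "f \<in> lower_bound A B" "t \<in> A" "t \<notin> B" "e \<in> keys f"
  shows "lookup e t \<ge> 0"
proof -
  have mult: "\<forall>e\<in>keys (f * g). lookup e t \<ge> 0" if "\<forall>e\<in>keys f. lookup e t \<ge> 0" "\<forall>e\<in>keys g. lookup e t \<ge> 0"
    for f g :: laurent
    using that keys_mult[of f g] by (force simp: lookup_add)
  have z: "\<forall>e\<in>keys (z k). lookup e t \<ge> 0" if "k \<in> B" for k
    unfolding z_def
  proof (rule mult)
    show "\<forall>e\<in>keys (P k). lookup e t \<ge> 0"
      unfolding exchange_poly_def using keys_add[of "X (pos_part b k)" "X (neg_part b k)"]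
      by (auto simp: lookup_pos lookup_neg)
    show "\<forall>e\<in>keys (X (- \<epsilon> k)). lookup e t \<ge> 0"
      using that assms(3) by (auto simp: lookup_single when_def)
  qed
  have power: "\<forall>e\<in>keys (z k ^ n). lookup e t \<ge> 0" if "k \<in> B" for k n
  proof (induction n)
    case (Suc n)
    show ?case unfolding power_Suc by (rule mult[OF z[OF that] Suc])
  qed simp
  have prod: "\<forall>e\<in>keys (\<Prod>k\<in>C. z k ^ q k). lookup e t \<ge> 0" if "C \<subseteq> B" for C q
    using that
  proof (induction C rule: infinite_finite_induct)
    case (insert k C)
    then show ?case unfolding prod.insert[OF insert(1,2)]
      by (intro mult power) auto
  qed simp_all
  have "\<forall>e\<in>keys f. lookup e t \<ge> 0"
    using assms(1)
  proof (induction rule: lower_bound_induct)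
    case (add e c q f)
    have "\<forall>e\<in>keys (single e c * (\<Prod>k\<in>B. z k ^ q k)). lookup e t \<ge> 0"
      by (rule mult[OF _ prod]) (use add(1)[OF assms(2)] in auto)
    then show ?case
      using add(3) keys_add[of "single e c * (\<Prod>k\<in>B. z k ^ q k)" f] by blast
  qed auto
  then show ?thesis using assms(4) by blast
qed

end

section \<open>The upper bound of an acyclic seed is its lower bound\<close>

context acyclic_exchange_matrix
begin

lemma z_deg_free:
  assumes "b t k = 0" "t \<noteq> k"
  shows "deg_free t (z k)"
proof -
  have "homogeneous (\<lambda>e. lookup e t) (0 + 0) (P k * X (- \<epsilon> k))"
    by (intro deg.homogeneous_mult exchange_poly_deg_free homogeneous_single)
       (use assms in \<open>auto simp: lookup_single\<close>)
  then show ?thesis by (simp add: z_def)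
qed

lemma P_nonzero: "P k \<noteq> 0"
  using exchange_poly_nonzero[of k] by auto

text \<open>
  Modulo \<open>x\<^sub>t\<close> only standard monomials free of \<open>x\<^sub>t\<close> remain.  Since \<open>t\<close> is least, their
  trailing exponents have degree 0 in \<open>x\<^sub>t\<close>, hence a nontrivial combination of them does not vanish
  at \<open>x\<^sub>t = 0\<close>.
\<close>

lemma lower_bound_divide:
  assumes M: "M \<subseteq> I" "t \<in> M" "\<And>k. k \<in> M \<Longrightarrow> t \<le> k"
    and d: "d \<in> lower_bound M (M - {t})" "graded_part (\<lambda>e. lookup e t) 0 d = 0"
  shows "\<exists>d'\<in>lower_bound M (M - {t}). d = X (\<epsilon> t) * d'"
proof -
  have "\<forall>k\<in>M - {t}. \<exists>w. id_order.trailing (z k) (w - \<epsilon> k) \<and> (\<forall>i\<le>k. lookup w i = 0)"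
    using trailing_z M(1) by blast
  then obtain w where w: "\<And>k. k \<in> M - {t} \<Longrightarrow> id_order.trailing (z k) (w k - \<epsilon> k)"
    "\<And>k i. k \<in> M - {t} \<Longrightarrow> i \<le> k \<Longrightarrow> lookup (w k) i = 0"
    by metis
  have tri: "triangular_family (\<lambda>e. e) (M - {t}) z w"
  proof
    show "finite (M - {t})" using M(1) finite_I by (auto intro: finite_subset)
  qed (use w in auto)
  interpret triangular_family "\<lambda>e. e" "M - {t}" z w by (rule tri)
  obtain d' s where ds: "d' \<in> lower_bound M (M - {t})"
    "s \<in> add_closure {single 0 c * standard r | c r. r \<in> {r. lookup r t = 0}}"
    "d = X (\<epsilon> t) * d' + s"
    using lower_bound_reduce[OF M(1,2) tri d(1)] by blast
  have "graded_part (\<lambda>e. lookup e t) (- 1) d' = 0"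
  proof (rule poly_mapping_eqI)
    fix e
    have "lookup e t \<ge> 0" if "e \<in> keys d'"
      by (rule lower_bound_keys_nonneg[OF ds(1) M(2) _ that]) simp
    then show "lookup (graded_part (\<lambda>e. lookup e t) (- 1) d') e = lookup 0 e"
      by (cases "e \<in> keys d'") (auto simp: lookup_graded_part in_keys_iff)
  qed
  then have "graded_part (\<lambda>e. lookup e t) 0 (X (\<epsilon> t) * d') = 0"
    by (simp add: deg.graded_part_single_mult)
  then have s0: "graded_part (\<lambda>e. lookup e t) 0 s = 0"
    using d(2) by (simp add: ds(3) graded_part_add)
  obtain F c where F: "finite F" "F \<subseteq> {r. lookup r t = 0}" "\<forall>r\<in>F. c r \<noteq> 0"
    "s = (\<Sum>r\<in>F. single 0 (c r) * standard r)"
    using add_closure_family[OF ds(2)] by blast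
  have "F = {}"
  proof (rule ccontr)
    assume "F \<noteq> {}"
    then obtain r where r: "r \<in> F" "exponent r \<in> keys s"
      using standard_independent[OF F(1), of c] F(3,4) by auto
    have "(\<Sum>k\<in>M - {t}. max 0 (- lookup r k) * lookup (w k) t) = 0"
      by (rule sum.neutral) (use w(2)[of _ t] M(3) in auto)
    then have "lookup (exponent r) t = 0"
      using F(2) r(1) by (auto simp: lookup_exponent)
    then have "lookup (graded_part (\<lambda>e. lookup e t) 0 s) (exponent r) \<noteq> 0"
      using r(2) by (simp add: lookup_graded_part in_keys_iff)
    then show False using s0 by simp
  qed
  then show ?thesis using ds F by auto
qed

lemma graded_part_mult_free:
  assumes "deg_free t f"
  shows "graded_part (\<lambda>e. lookup e t) a (f * g) = f * graded_part (\<lambda>e. lookup e t) a g"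
  using deg.graded_part_homogeneous_mult[OF assms, of a g] by simp

text \<open>
  The variables of the neighbours of \<open>t\<close> divide the term \<open>pos_part\<close> of \<open>P\<^sub>t\<close>, so a power of that term
  clears their denominators; the \<open>z\<^sub>k\<close> of the other vertices do not involve \<open>x\<^sub>t\<close>.
\<close>

lemma lower_bound_clear:
  assumes M: "M \<subseteq> I" "t \<in> M" "\<And>k. k \<in> M \<Longrightarrow> t \<le> k"
    and h: "h \<in> lower_bound {k\<in>M - {t}. b t k = 0} {k\<in>M - {t}. b t k = 0}"
  shows "\<exists>s. X (pos_part b t) ^ s * graded_part (\<lambda>e. lookup e t) 0 h \<in> lower_bound M (M - {t})"
proof -
  define M' where "M' = {k\<in>M - {t}. b t k = 0}"
  have t: "t \<in> I" and fin: "finite M" using M finite_I by (auto intro: finite_subset)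
  have pos: "X (pos_part b t) \<in> lower_bound M (M - {t})"
    by (rule lower_bound_single) (simp add: lookup_pos)
  have "\<exists>s. X (pos_part b t) ^ s * graded_part (\<lambda>e. lookup e t) 0 h \<in> lower_bound M (M - {t})"
    using h unfolding M'_def[symmetric]
  proof (induction rule: lower_bound_induct)
    case zero
    show ?case by (simp add: lower_bound_0)
  next
    case (add e c q h)
    then obtain s where s: "X (pos_part b t) ^ s * graded_part (\<lambda>e. lookup e t) 0 h \<in> lower_bound M (M - {t})" by blast
    have free: "deg_free t (\<Prod>k\<in>C. z k ^ q k)" if "C \<subseteq> M'" for C
      using that
    proof (induction C rule: infinite_finite_induct)
      case (insert k C)
      have "homogeneous (\<lambda>e. lookup e t) (0 + 0) (z k ^ q k * (\<Prod>k\<in>C. z k ^ q k))"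
        by (intro deg.homogeneous_mult deg.homogeneous_power z_deg_free)
           (use insert in \<open>auto simp: M'_def\<close>)
      then show ?case unfolding prod.insert[OF insert(1,2)] by simp
    qed (auto simp: homogeneous_def)
    let ?g = "single e c * (\<Prod>k\<in>M'. z k ^ q k)"
    define s' where "s' = nat (\<Sum>k\<in>M. \<bar>lookup e k\<bar>)"
    have s': "X (pos_part b t) ^ s' * graded_part (\<lambda>e. lookup e t) 0 ?g \<in> lower_bound M (M - {t})"
    proof (cases "lookup e t = 0")
      case True
      have "homogeneous (\<lambda>e. lookup e t) (0 + 0) ?g"
        by (intro deg.homogeneous_mult homogeneous_single free True order_refl)
      then have "X (pos_part b t) ^ s' * graded_part (\<lambda>e. lookup e t) 0 ?g = X (pos_part b t) ^ s' * ?g"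
        by (simp add: graded_part_homogeneous)
      also have "\<dots> = single (frag_cmul (int s') (pos_part b t) + e) c * (\<Prod>k\<in>M'. z k ^ q k)"
        by (simp add: mult_single flip: X_of_nat_mult mult.assoc)
      also have "\<dots> \<in> lower_bound M M'"
      proof (rule lower_bound_gen)
        fix k assume k: "k \<in> M"
        show "lookup (frag_cmul (int s') (pos_part b t) + e) k \<ge> 0"
        proof (cases "k = t \<or> k \<in> M'")
          case True
          then show ?thesis
            using add(1)[of k] \<open>lookup e t = 0\<close> by (auto simp: lookup_add lookup_pos)
        next
          case False
          then have "b t k \<noteq> 0" "k \<noteq> t" using k by (auto simp: M'_def)
          then have "b k t \<ge> 1"
            using skew[of k t] above[of t k] M k t by force
          moreover have "int s' \<ge> \<bar>lookup e k\<bar>"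
            unfolding s'_def using member_le_sum[of k M "\<lambda>k. \<bar>lookup e k\<bar>"] k fin by simp
          ultimately have "int s' * b k t \<ge> \<bar>lookup e k\<bar> * 1"
            by (intro mult_mono) auto
          then show ?thesis using \<open>b k t \<ge> 1\<close> by (simp add: lookup_add lookup_pos)
        qed
      qed
      also have "lower_bound M M' \<subseteq> lower_bound M (M - {t})"
        using lower_bound_mono[of M' "M - {t}"] fin by (auto simp: M'_def)
      finally show ?thesis .
    next
      case False
      have "homogeneous (\<lambda>e. lookup e t) (lookup e t + 0) ?g"
        by (intro deg.homogeneous_mult homogeneous_single free order_refl refl)
      then have "graded_part (\<lambda>e. lookup e t) 0 ?g = 0"
        using False by (simp add: graded_part_homogeneous)
      then show ?thesis by (simp add: lower_bound_0)
    qed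
    have "X (pos_part b t) ^ (s + s') * graded_part (\<lambda>e. lookup e t) 0 (?g + h) =
       X (pos_part b t) ^ s * (X (pos_part b t) ^ s' * graded_part (\<lambda>e. lookup e t) 0 ?g) +
       X (pos_part b t) ^ s' * (X (pos_part b t) ^ s * graded_part (\<lambda>e. lookup e t) 0 h)"
      unfolding graded_part_add power_add by (simp only: distrib_left mult_ac)
    also have "\<dots> \<in> lower_bound M (M - {t})"
      by (intro lower_bound_add lower_bound_mult lower_bound_power pos s s')
    finally show ?case by blast
  qed
  then show ?thesis .
qed

text \<open>
  If \<open>P\<^sub>t h\<close> is the value at \<open>x\<^sub>t = 0\<close> of an element \<open>d\<close> of the ring, then so is \<open>h\<close>.  The vertices
  not joined to \<open>t\<close> have \<open>P\<^sub>k\<close> coprime to \<open>P\<^sub>t\<close>, so by induction \<open>h\<close> lies in the lower bound in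
  which only they are mutable.  That inverts the neighbours of \<open>t\<close>, but they are invertible modulo \<open>P\<^sub>t\<close>
  anyway: with \<open>P\<^sub>t = p + m\<close>, a power of \<open>p\<close> clears the denominators, while \<open>m\<close> is a unit
  congruent to \<open>- p\<close>.
\<close>

lemma lower_bound_quotient:
  assumes M: "M \<subseteq> I" "t \<in> M" "\<And>k. k \<in> M \<Longrightarrow> t \<le> k"
    and IH: "\<And>M' f. M' \<subset> M \<Longrightarrow> (\<And>k. k \<in> M' \<Longrightarrow> f \<in> two_chart k (P k)) \<Longrightarrow> f \<in> lower_bound M' M'"
    and d: "d \<in> lower_bound M (M - {t})" "graded_part (\<lambda>e. lookup e t) 0 d = P t * h"
  shows "\<exists>e\<in>lower_bound M (M - {t}). graded_part (\<lambda>e. lookup e t) 0 e = h"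
proof -
  let ?D = "lower_bound M (M - {t})"
  let ?p = "X (pos_part b t)" and ?m = "X (neg_part b t)"
  define M' where "M' = {k\<in>M - {t}. b t k = 0}"
  have t: "t \<in> I" using M by blast
  have Pt: "deg_free t (P t)" using poly_deg_free[OF t] .
  have "P t * graded_part (\<lambda>e. lookup e t) 0 h = P t * h"
    using graded_part_mult_free[OF Pt, of 0 h] by (simp add: graded_part_idem flip: d(2))
  then have h0: "graded_part (\<lambda>e. lookup e t) 0 h = h" using P_nonzero by simp
  have "h \<in> two_chart k (P k)" if k: "k \<in> M'" for k
  proof (rule two_chart_cancel)
    show kI: "k \<in> I" "t \<in> I" "k \<noteq> t" using k M by (auto simp: M'_def)
    have "b t k = 0" using k by (simp add: M'_def)
    have "d \<in> two_chart k (P k)"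
      using lower_bound_two_chart[OF d(1), of k] k by (auto simp: M'_def)
    then show "P t * h \<in> two_chart k (P k)"
      unfolding d(2)[symmetric]
      by (rule two_chart_graded_part) (use kI poly_deg_free \<open>b t k = 0\<close> in \<open>auto intro: exchange_poly_deg_free\<close>)
  qed
  then have "h \<in> lower_bound M' M'"
    by (intro IH) (use M in \<open>auto simp: M'_def\<close>)
  then have "\<exists>s. ?p ^ s * graded_part (\<lambda>e. lookup e t) 0 h \<in> ?D"
    unfolding M'_def by (intro lower_bound_clear M)
  then obtain s where s: "?p ^ s * h \<in> ?D"
    unfolding h0 by blast
  have pos: "?p \<in> ?D" and neg: "?m \<in> ?D"
    by (rule lower_bound_single; simp add: lookup_pos lookup_neg)+
  have free: "deg_free t ?p" "deg_free t ?m"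
    by (rule homogeneous_single; simp add: lookup_pos lookup_neg diag[OF t])+
  have "\<exists>Q\<in>?D. deg_free t Q \<and> ?m ^ s = (- ?p) ^ s + P t * Q"
  proof (induction s)
    case 0
    show ?case by (rule bexI[of _ 0]) (auto simp: homogeneous_def lower_bound_0)
  next
    case (Suc s)
    then obtain Q where Q: "Q \<in> ?D" "deg_free t Q" "?m ^ s = (- ?p) ^ s + P t * Q" by blast
    have "deg_free t (- ?p)" using free(1) by (auto simp: homogeneous_def)
    then have 1: "deg_free t ((- ?p) ^ s)" by (rule deg.homogeneous_power)
    have 2: "deg_free t (?m * Q)"
      using deg.homogeneous_mult[OF free(2) Q(2)] by simp
    have "?m ^ Suc s = (- ?p) ^ Suc s + P t * ((- ?p) ^ s + ?m * Q)"
      unfolding power_Suc Q(3) by (simp add: exchange_poly_def algebra_simps)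
    moreover have "(- ?p) ^ s + ?m * Q \<in> ?D"
      by (intro lower_bound_add lower_bound_mult lower_bound_power lower_bound_uminus pos neg Q(1))
    ultimately show ?case using homogeneous_add[OF 1 2] by blast
  qed
  then obtain Q where Q: "Q \<in> ?D" "deg_free t Q" "?m ^ s = (- ?p) ^ s + P t * Q" by blast
  \<comment> \<open>The inverse of \<open>m\<^sup>s\<close>, which lies in the ring as \<open>m\<close> involves no index in \<open>M\<close>.\<close>
  define n where "n = X (frag_cmul (int s) (- neg_part b t))"
  have n_m: "n * ?m ^ s = 1"
  proof -
    have "frag_cmul (int s) (- neg_part b t) + frag_cmul (int s) (neg_part b t) = 0"
      by (rule poly_mapping_eqI) (simp add: lookup_add)
    then show ?thesis unfolding n_def X_of_nat_mult[symmetric] X_add[symmetric] by simp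
  qed
  have n_free: "deg_free t n"
    unfolding n_def by (rule homogeneous_single) (simp add: lookup_neg diag[OF t])
  have n_D: "n \<in> ?D"
    unfolding n_def
  proof (rule lower_bound_single)
    fix k assume "k \<in> M"
    then have "b k t \<ge> 0" using M(3)[of k] above[of t k] t diag[OF t] by (cases "k = t") auto
    then show "lookup (frag_cmul (int s) (- neg_part b t)) k \<ge> 0" by (simp add: lookup_neg)
  qed
  define e where "e = n * ((- 1) ^ s * (?p ^ s * h) + Q * d)"
  have "e \<in> ?D"
    unfolding e_def
    by (intro lower_bound_mult lower_bound_add n_D s Q(1) d(1) lower_bound_power lower_bound_uminus lower_bound_1)
  moreover have "graded_part (\<lambda>e. lookup e t) 0 e = h"
  proof -
    have 1: "(- 1) ^ s * (?p ^ s * h) = (- ?p) ^ s * h"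
      by (simp add: power_minus[of ?p] mult.assoc)
    have "deg_free t (- ?p)" using free(1) by (auto simp: homogeneous_def)
    then have 2: "deg_free t ((- ?p) ^ s)" by (rule deg.homogeneous_power)
    have "graded_part (\<lambda>e. lookup e t) 0 e = n * ((- ?p) ^ s * h + Q * (P t * h))"
      unfolding e_def 1 by (simp only: graded_part_mult_free[OF n_free] graded_part_add graded_part_mult_free[OF 2] graded_part_mult_free[OF Q(2)] h0 d(2))
    also have "\<dots> = n * (?m ^ s * h)"
      unfolding Q(3) by (simp only: distrib_left distrib_right mult_ac)
    also have "\<dots> = h"
      using n_m by (simp flip: mult.assoc)
    finally show ?thesis .
  qed
  ultimately show ?thesis by blast
qed

text \<open>
  Induction on the mutable set \<open>M\<close>, with \<open>t\<close> its least element.  With \<open>t\<close> frozen, \<open>f\<close> has the form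
  \<open>x\<^sub>t\<^sup>-\<^sup>c d\<close>.  The leading coefficient of \<open>d\<close> at \<open>x\<^sub>t = 0\<close> is divisible by \<open>P\<^sub>t\<^sup>c\<close>, so subtracting
  a multiple of \<open>z\<^sub>t\<^sup>c\<close> lowers \<open>c\<close>.
\<close>

lemma two_chart_subset_lower_bound:
  assumes "M \<subseteq> I" "\<And>k. k \<in> M \<Longrightarrow> f \<in> two_chart k (P k)"
  shows "f \<in> lower_bound M M"
  using finite_subset[OF assms(1) finite_I] assms
proof (induction arbitrary: f rule: finite_psubset_induct)
  case (psubset M)
  show ?case
  proof (cases "M = {}")
    case True
    have "(\<Sum>e\<in>keys f. single e (lookup f e)) \<in> lower_bound M M"
      unfolding True lower_bound_def
      by (rule add_closure_sum) (rule lower_bound_single[of "{}", unfolded lower_bound_def], simp)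
    then show ?thesis by (simp add: poly_mapping_sum_single)
  next
    case False
    define t where "t = Min M"
    have t: "t \<in> M" "\<And>k. k \<in> M \<Longrightarrow> t \<le> k" using False psubset.hyps by (auto simp: t_def)
    have tI: "t \<in> I" using t psubset.prems by blast
    let ?D = "lower_bound M (M - {t})"
    have IH: "f \<in> lower_bound M' M'" if "M' \<subset> M" "\<And>k. k \<in> M' \<Longrightarrow> f \<in> two_chart k (P k)" for M' f
      by (rule psubset.IH[OF that(1)]) (use that psubset.prems(1) in auto)
    have D_mono: "f \<in> lower_bound M M" if "f \<in> ?D" for f
      by (rule lower_bound_mono[OF _ _ that]) (use psubset.hyps in auto)
    have Xt: "X (\<epsilon> t) ^ n \<in> ?D" for n
      by (intro lower_bound_power lower_bound_single) (simp add: lookup_single when_def)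
    have quotient: "\<exists>e\<in>?D. graded_part (\<lambda>e. lookup e t) 0 e = h"
      if "d \<in> ?D" "graded_part (\<lambda>e. lookup e t) 0 d = P t ^ n * h" for n d h
      using that
    proof (induction n arbitrary: d)
      case (Suc n)
      obtain e where "e \<in> ?D" "graded_part (\<lambda>e. lookup e t) 0 e = P t ^ n * h"
        using lower_bound_quotient[OF psubset.prems(1) t IH, of d "P t ^ n * h"] Suc.prems
        by (auto simp: mult.assoc)
      then show ?case using Suc.IH by blast
    qed auto
    have step: "f \<in> lower_bound M M" if "f \<in> two_chart t (P t)" "X (\<epsilon> t) ^ c * f \<in> ?D" for c f
      using that
    proof (induction c arbitrary: f)
      case 0
      then show ?case using D_mono by simp
    next
      case (Suc c)
      define d where "d = X (\<epsilon> t) ^ Suc c * f"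
      have d: "d \<in> ?D" using Suc.prems(2) by (simp add: d_def)
      have "graded_part (\<lambda>e. lookup e t) 0 d = X (\<epsilon> t) ^ Suc c * graded_part (\<lambda>e. lookup e t) (- int (Suc c)) f"
        unfolding d_def X_of_nat_mult[symmetric] deg.graded_part_single_mult by simp
      moreover have "P t ^ Suc c dvd graded_part (\<lambda>e. lookup e t) (- int (Suc c)) f"
        using Suc.prems(1) unfolding two_chart_iff[OF poly_deg_free[OF tI]] by blast
      ultimately have "P t ^ Suc c dvd graded_part (\<lambda>e. lookup e t) 0 d" by (metis dvd_mult)
      then obtain h where h: "graded_part (\<lambda>e. lookup e t) 0 d = P t ^ Suc c * h" by (auto elim: dvdE)
      obtain e where e: "e \<in> ?D" "graded_part (\<lambda>e. lookup e t) 0 e = h"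
        using quotient[OF d h] by blast
      have PD: "P t ^ Suc c * e \<in> ?D"
        by (intro lower_bound_mult lower_bound_power lower_bound_P e(1))
      have "graded_part (\<lambda>e. lookup e t) 0 (d - P t ^ Suc c * e) = 0"
        unfolding graded_part_diff h graded_part_mult_free[OF deg.homogeneous_power[OF poly_deg_free[OF tI]]] e(2) by simp
      then obtain d' where d': "d' \<in> ?D" "d - P t ^ Suc c * e = X (\<epsilon> t) * d'"
        using lower_bound_divide[OF psubset.prems(1) t] lower_bound_diff[OF d PD] by blast
      define g where "g = f - z t ^ Suc c * e"
      have ze: "z t ^ Suc c * e \<in> lower_bound M M"
        by (intro lower_bound_mult lower_bound_power lower_bound_z t psubset.hyps D_mono e(1))
      have "X (\<epsilon> t) * (X (\<epsilon> t) ^ c * g) = d - (z t * X (\<epsilon> t)) ^ Suc c * e"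
        unfolding g_def d_def power_mult_distrib by (simp add: algebra_simps)
      also have "\<dots> = X (\<epsilon> t) * d'" unfolding z_mult d'(2) ..
      finally have "X (\<epsilon> t) ^ c * g = d'"
        by (simp add: single_nonzero)
      moreover have "g \<in> two_chart t (P t)"
        unfolding g_def by (intro two_chart_diff Suc.prems lower_bound_two_chart[OF ze] t)
      ultimately have "g \<in> lower_bound M M" using Suc.IH d'(1) by blast
      then have "g + z t ^ Suc c * e \<in> lower_bound M M" using ze by (rule lower_bound_add)
      then show ?case by (simp add: g_def)
    qed
    have "f \<in> lower_bound (M - {t}) (M - {t})"
      by (rule IH) (use t psubset.prems in auto)
    then have "\<exists>c. X (\<epsilon> t) ^ c * f \<in> ?D"
    proof (induction rule: lower_bound_induct)
      case zero
      show ?case by (simp add: lower_bound_0)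
    next
      case (add e c q f)
      then obtain n where n: "X (\<epsilon> t) ^ n * f \<in> ?D" by blast
      define m where "m = nat \<bar>lookup e t\<bar>"
      let ?g = "single e c * (\<Prod>k\<in>M - {t}. z k ^ q k)"
      have "X (\<epsilon> t) ^ m * ?g = single (frag_cmul (int m) (\<epsilon> t) + e) c * (\<Prod>k\<in>M - {t}. z k ^ q k)"
        by (simp add: mult_single flip: X_of_nat_mult mult.assoc)
      also have "\<dots> \<in> ?D"
        by (rule lower_bound_gen) (use add(1) in \<open>auto simp: lookup_add lookup_single when_def m_def\<close>)
      finally have m: "X (\<epsilon> t) ^ m * ?g \<in> ?D" .
      have "X (\<epsilon> t) ^ (m + n) * (?g + f) = X (\<epsilon> t) ^ n * (X (\<epsilon> t) ^ m * ?g) + X (\<epsilon> t) ^ m * (X (\<epsilon> t) ^ n * f)"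
        by (simp only: power_add distrib_left mult_ac)
      also have "\<dots> \<in> ?D" by (intro lower_bound_add lower_bound_mult Xt m n)
      finally show ?case by blast
    qed
    then show ?thesis using step psubset.prems(2)[OF t(1)] by blast
  qed
qed

lemma upper_bound_subset_lower_bound: "upper_bound \<subseteq> lower_bound I I"
  using two_chart_subset_lower_bound[OF order_refl] by (auto simp: upper_bound_def)

end

section \<open>Cluster variables as specialisations of the upper bound\<close>

definition nonneg_polys :: "((nat \<Rightarrow>\<^sub>0 nat) \<Rightarrow>\<^sub>0 complex) set" where
  "nonneg_polys = add_closure {single e (complex_of_real r) | e r. r \<ge> 0}"

lemma nonneg_polys_add: "p \<in> nonneg_polys \<Longrightarrow> q \<in> nonneg_polys \<Longrightarrow> p + q \<in> nonneg_polys"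
  unfolding nonneg_polys_def by (rule add_closure_add)

lemma nonneg_polys_mult:
  assumes "p \<in> nonneg_polys" "q \<in> nonneg_polys"
  shows "p * q \<in> nonneg_polys"
  using assms unfolding nonneg_polys_def
proof (rule add_closure_mult, safe)
  fix e e' :: "nat \<Rightarrow>\<^sub>0 nat" and r r' :: real
  assume "r \<ge> 0" "r' \<ge> 0"
  then have "single (e + e') (complex_of_real (r * r')) \<in> add_closure {single e (complex_of_real r) | e r. r \<ge> 0}"
    by (intro add_closure_base) (use zero_le_mult_iff in blast)
  then show "single e (complex_of_real r) * single e' (complex_of_real r')
      \<in> add_closure {single e (complex_of_real r) | e r. r \<ge> 0}"
    by (simp add: mult_single)
qed

lemma nonneg_polys_coeff:
  assumes "p \<in> nonneg_polys"
  shows "\<exists>r\<ge>0. lookup p e = complex_of_real r"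
  using assms unfolding nonneg_polys_def
proof induction
  case zero
  show ?case by (rule exI[of _ 0]) simp
next
  case (add s f)
  then obtain e' r r' where "s = single e' (complex_of_real r)" "r \<ge> 0" "r' \<ge> 0" "lookup f e = complex_of_real r'"
    by blast
  then show ?case
    by (intro exI[of _ "(if e = e' then r else 0) + r'"]) (auto simp: lookup_add lookup_single when_def)
qed

lemma nonneg_polys_add_eq_0:
  assumes p: "p \<in> nonneg_polys" and q: "q \<in> nonneg_polys" and "p + q = 0"
  shows "p = 0"
proof (rule poly_mapping_eqI)
  fix e
  obtain r r' where r: "r \<ge> 0" "lookup p e = complex_of_real r" "r' \<ge> 0" "lookup q e = complex_of_real r'"
    using nonneg_polys_coeff[OF p, of e] nonneg_polys_coeff[OF q, of e] by blast
  have "lookup (p + q) e = 0" using assms(3) by simp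
  then have "complex_of_real (r + r') = 0" by (simp add: lookup_add r)
  then have "r + r' = 0" by (simp only: of_real_eq_0_iff)
  then show "lookup p e = lookup 0 e" using r by simp
qed

text \<open>
  Mutation divides by a cluster variable, whose specialisation must be known to be nonzero.  Exchange
  relations are subtraction-free, so positivity provides this.
\<close>

definition positive :: "ratfun set" where
  "positive = {to_fract p / to_fract q | p q. p \<in> nonneg_polys - {0} \<and> q \<in> nonneg_polys - {0}}"

lemma positiveI: "p \<in> nonneg_polys \<Longrightarrow> p \<noteq> 0 \<Longrightarrow> q \<in> nonneg_polys \<Longrightarrow> q \<noteq> 0 \<Longrightarrow> to_fract p / to_fract q \<in> positive"
  unfolding positive_def by blast

lemma positiveE:
  assumes "x \<in> positive"
  obtains p q where "x = to_fract p / to_fract q" "p \<in> nonneg_polys" "p \<noteq> 0" "q \<in> nonneg_polys" "q \<noteq> 0"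
  using assms unfolding positive_def by blast

lemma positive_nonzero: "x \<in> positive \<Longrightarrow> x \<noteq> 0"
  by (elim positiveE) simp

lemma positive_mult: "x \<in> positive \<Longrightarrow> y \<in> positive \<Longrightarrow> x * y \<in> positive"
proof (elim positiveE)
  fix p q p' q' assume *: "x = to_fract p / to_fract q" "p \<in> nonneg_polys" "p \<noteq> 0" "q \<in> nonneg_polys" "q \<noteq> 0"
    "y = to_fract p' / to_fract q'" "p' \<in> nonneg_polys" "p' \<noteq> 0" "q' \<in> nonneg_polys" "q' \<noteq> 0"
  have "x * y = to_fract (p * p') / to_fract (q * q')" by (simp add: *)
  then show "x * y \<in> positive" using * by (simp only:) (intro positiveI nonneg_polys_mult; simp)
qed

lemma positive_divide: "x \<in> positive \<Longrightarrow> y \<in> positive \<Longrightarrow> x / y \<in> positive"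
proof (elim positiveE)
  fix p q p' q' assume *: "x = to_fract p / to_fract q" "p \<in> nonneg_polys" "p \<noteq> 0" "q \<in> nonneg_polys" "q \<noteq> 0"
    "y = to_fract p' / to_fract q'" "p' \<in> nonneg_polys" "p' \<noteq> 0" "q' \<in> nonneg_polys" "q' \<noteq> 0"
  have "x / y = to_fract (p * q') / to_fract (q * p')" by (simp add: *)
  then show "x / y \<in> positive" using * by (simp only:) (intro positiveI nonneg_polys_mult; simp)
qed

lemma positive_add: "x \<in> positive \<Longrightarrow> y \<in> positive \<Longrightarrow> x + y \<in> positive"
proof (elim positiveE)
  fix p q p' q' assume *: "x = to_fract p / to_fract q" "p \<in> nonneg_polys" "p \<noteq> 0" "q \<in> nonneg_polys" "q \<noteq> 0"
    "y = to_fract p' / to_fract q'" "p' \<in> nonneg_polys" "p' \<noteq> 0" "q' \<in> nonneg_polys" "q' \<noteq> 0"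
  have "x + y = to_fract (p * q' + p' * q) / to_fract (q * q')" using * by (simp add: field_simps)
  moreover have "p * q' + p' * q \<noteq> 0"
    using nonneg_polys_add_eq_0[of "p * q'" "p' * q"] * by (auto simp: nonneg_polys_mult)
  moreover have "p * q' + p' * q \<in> nonneg_polys" "q * q' \<in> nonneg_polys"
    using * by (auto intro: nonneg_polys_add nonneg_polys_mult)
  ultimately show "x + y \<in> positive" using * by (simp only:) (intro positiveI; simp)
qed

lemma nonneg_polys_single_1: "single e 1 \<in> nonneg_polys"
  unfolding nonneg_polys_def
  by (intro add_closure_base CollectI exI[of _ e] exI[of _ 1]) simp

lemma positive_1: "1 \<in> positive"
  using positiveI[of 1 1] nonneg_polys_single_1[of 0] by simp

lemma positive_yvar: "yvar i \<in> positive"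
  using positiveI[of "single (single i 1) 1" 1] nonneg_polys_single_1[of 0]
    nonneg_polys_single_1[of "single i 1"]
  by (simp add: yvar_def single_nonzero)

lemma positive_power: "x \<in> positive \<Longrightarrow> x ^ m \<in> positive"
  by (induction m) (auto simp: positive_1 positive_mult)

lemma positive_prod: "(\<And>i. i \<in> A \<Longrightarrow> f i \<in> positive) \<Longrightarrow> prod f A \<in> positive"
  by (induction A rule: infinite_finite_induct) (auto simp: positive_1 positive_mult)

definition specialize :: "nat set \<Rightarrow> (nat \<Rightarrow> ratfun) \<Rightarrow> nat \<Rightarrow> ratfun" where
  "specialize I u = (\<lambda>i. if i \<in> I then u i else 1)"

lemma ev_monomial_specialize_pos_part:
  assumes "finite I" "finite {i. b i k \<noteq> 0}"
  shows "ev_monomial (specialize I u) (pos_part b k) = (\<Prod>i\<in>{i\<in>I. b i k > 0}. u i ^ nat (b i k))"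
proof -
  have "ev_monomial (specialize I u) (pos_part b k) =
      (\<Prod>i\<in>I \<union> keys (pos_part b k). specialize I u i powi lookup (pos_part b k) i)"
    by (rule ev_monomial_superset) (use assms in auto)
  also have "\<dots> = (\<Prod>i\<in>{i\<in>I. b i k > 0}. u i ^ nat (b i k))"
  proof (rule prod.mono_neutral_cong_right)
    show "\<forall>i\<in>I \<union> keys (pos_part b k) - {i \<in> I. 0 < b i k}. specialize I u i powi lookup (pos_part b k) i = 1"
    proof
      fix i assume "i \<in> I \<union> keys (pos_part b k) - {i \<in> I. 0 < b i k}"
      then have "i \<notin> I \<or> b i k \<le> 0" by auto
      then show "specialize I u i powi lookup (pos_part b k) i = 1"
        using assms by (auto simp: specialize_def lookup_pos_part)
    qed
  qed (use assms in \<open>auto simp: specialize_def lookup_pos_part power_int_def\<close>)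
  finally show ?thesis .
qed

context exchange_matrix
begin

lemma ev_specialize_exchange_poly:
  assumes "k \<in> I" "\<And>i. i \<in> I \<Longrightarrow> b' i k = b i k"
  shows "ev (specialize I u) (exchange_poly b k) =
     (\<Prod>i\<in>{i\<in>I. b' i k > 0}. u i ^ nat (b' i k)) + (\<Prod>i\<in>{i\<in>I. b' i k < 0}. u i ^ nat (- b' i k))"
proof -
  have "{i\<in>I. b i k > 0} = {i\<in>I. b' i k > 0}" "{i\<in>I. - b i k > 0} = {i\<in>I. b' i k < 0}"
    using assms(2) by auto
  moreover have "(\<Prod>i\<in>{i\<in>I. b' i k > 0}. u i ^ nat (b i k)) = (\<Prod>i\<in>{i\<in>I. b' i k > 0}. u i ^ nat (b' i k))"
    "(\<Prod>i\<in>{i\<in>I. b' i k < 0}. u i ^ nat (- b i k)) = (\<Prod>i\<in>{i\<in>I. b' i k < 0}. u i ^ nat (- b' i k))"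
    using assms(2) by (auto intro!: prod.cong)
  moreover have "finite {i. - b i k \<noteq> 0}" by simp
  ultimately show ?thesis
    by (simp only: exchange_poly_def ev_add ev_single ev_monomial_specialize_pos_part[OF finite_I] finite_col const_1 mult_1_left)
qed

text \<open>
  The induction appends a mutation at the far end of the path and pulls the new upper bound back by
  one step.  The enlarged matrix \<open>b'\<close> is mutated along with the given one, while the frozen
  variables are evaluated at 1 throughout.
\<close>

theorem mutation_class_upper_bound:
  assumes "s \<in> mutation_class I (yvar, B)" and B: "\<And>i j. i \<in> I \<Longrightarrow> j \<in> I \<Longrightarrow> B i j = b i j"
  shows "\<exists>b'. exchange_matrix I b' \<and> (\<forall>i\<in>I. \<forall>j\<in>I. snd s i j = b' i j) \<and> (\<forall>i\<in>I. fst s i \<in> positive) \<and>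
     (\<forall>f\<in>exchange_matrix.upper_bound I b'. \<exists>h\<in>upper_bound. ev (specialize I (fst s)) f = ev (specialize I yvar) h)"
  using assms(1)
proof induction
  case initial
  show ?case
    by (rule exI[of _ b]) (use B exchange_matrix_axioms positive_yvar in auto)
next
  case (step s k)
  then obtain b' where b': "exchange_matrix I b'" "\<forall>i\<in>I. \<forall>j\<in>I. snd s i j = b' i j" "\<forall>i\<in>I. fst s i \<in> positive"
    "\<forall>f\<in>exchange_matrix.upper_bound I b'. \<exists>h\<in>upper_bound. ev (specialize I (fst s)) f = ev (specialize I yvar) h"
    by blast
  obtain u B' where s: "s = (u, B')" by force
  interpret b': exchange_matrix I b' by (rule b'(1))
  have k: "k \<in> I" by (rule step)
  let ?u = "specialize I u"
  let ?P = "exchange_poly b' k"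
  have evP: "ev ?u ?P = (\<Prod>i\<in>{i\<in>I. B' i k > 0}. u i ^ nat (B' i k)) + (\<Prod>i\<in>{i\<in>I. B' i k < 0}. u i ^ nat (- B' i k))"
    by (rule b'.ev_specialize_exchange_poly) (use k b'(2) s in auto)
  have pos_u: "?u i \<in> positive" for i
    using b'(3) s by (simp add: specialize_def positive_1)
  have pos_P: "ev ?u ?P \<in> positive"
    unfolding evP using b'(3) s by (auto intro!: positive_add positive_prod positive_power)
  have mut: "mutate I k s = (u(k := ev ?u ?P / u k), mutate_matrix k B')"
    by (simp add: s mutate_def evP)
  have spec: "specialize I (u(k := ev ?u ?P / u k)) = ?u(k := ev ?u ?P / ?u k)"
    using k by (auto simp: specialize_def)
  show ?case
  proof (intro exI[of _ "mutate_matrix k b'"] conjI)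
    show "exchange_matrix I (mutate_matrix k b')" by (rule b'.mutate_exchange_matrix[OF k])
    show "\<forall>i\<in>I. \<forall>j\<in>I. snd (mutate I k s) i j = mutate_matrix k b' i j"
      unfolding mut using b'(2) k s by (simp add: mutate_matrix_def)
    show "\<forall>i\<in>I. fst (mutate I k s) i \<in> positive"
      unfolding mut using b'(3) k pos_P s by (auto intro: positive_divide)
    show "\<forall>f\<in>exchange_matrix.upper_bound I (mutate_matrix k b'). \<exists>h\<in>upper_bound.
      ev (specialize I (fst (mutate I k s))) f = ev (specialize I yvar) h"
    proof
      fix f assume "f \<in> exchange_matrix.upper_bound I (mutate_matrix k b')"
      then obtain g where g: "g \<in> b'.upper_bound"
        "\<forall>u. (\<forall>i. u i \<noteq> 0) \<longrightarrow> ev u ?P \<noteq> 0 \<longrightarrow> ev (u(k := ev u ?P / u k)) f = ev u g"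
        using b'.upper_bound_mutate[OF k] by blast
      have "ev (specialize I (fst (mutate I k s))) f = ev ?u g"
        unfolding mut fst_conv spec using g(2) pos_u pos_P positive_nonzero by blast
      then show "\<exists>h\<in>upper_bound. ev (specialize I (fst (mutate I k s))) f = ev (specialize I yvar) h"
        using b'(4) g(1) s by auto
    qed
  qed
qed

lemma cluster_variable_upper_bound:
  assumes "s \<in> mutation_class I (yvar, B)" "\<And>i j. i \<in> I \<Longrightarrow> j \<in> I \<Longrightarrow> B i j = b i j" "i \<in> I"
  shows "\<exists>h\<in>upper_bound. fst s i = ev (specialize I yvar) h"
proof -
  obtain b' where b': "exchange_matrix I b'"
    "\<forall>f\<in>exchange_matrix.upper_bound I b'. \<exists>h\<in>upper_bound. ev (specialize I (fst s)) f = ev (specialize I yvar) h"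
    using mutation_class_upper_bound[OF assms(1,2)] by blast
  interpret b': exchange_matrix I b' by (rule b'(1))
  have "X (single i 1) \<in> b'.upper_bound"
    by (auto simp: b'.upper_bound_def lookup_single when_def intro!: two_chart_single)
  moreover have "ev (specialize I (fst s)) (X (single i 1)) = fst s i"
    using assms(3) by (simp add: ev_single ev_monomial_single specialize_def)
  ultimately show ?thesis using b'(2) by metis
qed

end

section \<open>Mutating at sources: the span of the dagger monomials\<close>

lemma prod_positive_exponents:
  fixes f :: "nat \<Rightarrow> 'a::comm_monoid_mult"
  assumes "finite I" "{i\<in>I. c i > 0} \<subseteq> T" "T \<subseteq> I"
  shows "(\<Prod>i\<in>{i\<in>I. c i > 0}. f i ^ nat (c i)) = (\<Prod>i\<in>T. f i ^ nat (c i))"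
proof (rule prod.mono_neutral_left)
  show "finite T" using assms by (auto intro: finite_subset)
  show "\<forall>i\<in>T - {i\<in>I. c i > 0}. f i ^ nat (c i) = 1"
  proof
    fix i assume "i \<in> T - {i\<in>I. c i > 0}"
    then have "c i \<le> 0" using assms(3) by auto
    then show "f i ^ nat (c i) = 1" by simp
  qed
qed (rule assms(2))

locale ordered_quiver =
  fixes Q :: "(nat, 'e) pre_digraph" and n :: nat
  assumes fin: "fin_digraph Q" and verts: "verts Q = {1..n}"
    and ordered: "e \<in> arcs Q \<Longrightarrow> tail Q e < head Q e"
begin

abbreviation "arrows \<equiv> num_arrows Q"
abbreviation "I \<equiv> {1..n}"

lemma arrows_zero:
  assumes "\<not> i < j \<or> i \<notin> I \<or> j \<notin> I"
  shows "arrows i j = 0"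
proof -
  interpret fin_digraph Q by (rule fin)
  have "{e \<in> arcs Q. tail Q e = i \<and> head Q e = j} = {}"
    using assms ordered verts tail_in_verts head_in_verts by blast
  then show ?thesis unfolding num_arrows_def by (simp only: card.empty)
qed

lemma B_lower: "k < i \<Longrightarrow> B_matrix Q i k = int (arrows k i)"
  and B_upper: "i < k \<Longrightarrow> B_matrix Q i k = - int (arrows i k)"
  and B_diag: "B_matrix Q k k = 0"
  by (simp_all add: B_matrix_def arrows_zero)

lemma B_cases: "B_matrix Q i k = (if k < i then int (arrows k i) else - int (arrows i k))"
  by (simp add: B_matrix_def arrows_zero)

lemma B_skew: "B_matrix Q i j = - B_matrix Q j i"
  by (simp add: B_matrix_def)

text \<open>
  The exchange matrix with principal coefficients: the rows \<open>n + 1, \<dots>, 2 n\<close> form an identity matrix.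
\<close>

definition principal :: "nat \<Rightarrow> nat \<Rightarrow> int" where
  "principal i j = (if j \<notin> I then 0 else if i \<in> I then B_matrix Q i j else if i = n + j then 1 else 0)"

lemma principal_acyclic: "acyclic_exchange_matrix I principal"
proof
  show "finite I" by simp
  show "finite {i. \<exists>k. principal i k \<noteq> 0}"
    by (rule finite_subset[of _ "{..n + n}"]) (auto simp: principal_def split: if_splits)
  show "principal i j = - principal j i" if "i \<in> I" "j \<in> I" for i j
    using that B_skew[of i j] by (simp add: principal_def)
  show "principal i k \<ge> 0" if "k \<in> I" "k < i" for i k
    using that by (auto simp: principal_def B_lower)
  show "principal i k \<le> 0" if "k \<in> I" "i < k" for i k
    using that by (auto simp: principal_def B_upper)
  show "column_independent I principal"
    unfolding column_independent_def
  proof safe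
    fix c :: "nat \<Rightarrow> int" and l assume c: "\<forall>i. (\<Sum>l\<in>I. c l * principal i l) = 0" and l: "l \<in> I"
    have "0 = (\<Sum>j\<in>I. c j * principal (n + l) j)" using c by simp
    also have "\<dots> = (\<Sum>j\<in>{l}. c j * principal (n + l) j)"
      by (rule sum.mono_neutral_right) (use l in \<open>auto simp: principal_def\<close>)
    also have "\<dots> = c l" using l by (simp add: principal_def)
    finally show "c l = 0" by simp
  qed
qed

sublocale acyclic_exchange_matrix I principal
  by (rule principal_acyclic)

abbreviation "yd \<equiv> y_dagger Q"

definition source_seed :: "nat \<Rightarrow> (nat, ratfun) seed" where
  "source_seed m = fold (mutate I) [1..<m + 1] (initial_seed Q)"

lemma source_seed_Suc: "source_seed (Suc m) = mutate I (Suc m) (source_seed m)"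
  by (simp add: source_seed_def)

lemma y_dagger_source_seed: "yd k = fst (source_seed k) k"
  by (simp add: y_dagger_def source_seed_def verts)

lemma source_seed_mutation_class:
  "m \<le> n \<Longrightarrow> source_seed m \<in> mutation_class I (initial_seed Q)"
proof (induction m)
  case 0
  show ?case by (simp add: source_seed_def mutation_class.initial)
next
  case (Suc m)
  then show ?case unfolding source_seed_Suc by (intro mutation_class.step) auto
qed

text \<open>
  As \<open>Suc m\<close> is a source at step \<open>Suc m\<close>, the column of the matrix that governs the mutation has one sign,
  and mutation merely reverses the arrows at that vertex.
\<close>

lemma source_seed_matrix:
  "m \<le> n \<Longrightarrow> snd (source_seed m) i j =
     (if (i \<in> {1..m}) \<noteq> (j \<in> {1..m}) then - B_matrix Q i j else B_matrix Q i j)"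
proof (induction m arbitrary: i j)
  case 0
  show ?case by (simp add: source_seed_def initial_seed_def)
next
  case (Suc m)
  let ?k = "Suc m"
  let ?b = "snd (source_seed m)"
  note IH = Suc.IH[OF Suc_leD[OF Suc.prems]]
  have zero: "arrows 0 ?k = 0" "arrows ?k ?k = 0" by (simp_all add: arrows_zero)
  have col: "?b i ?k \<ge> 0" for i
    using zero by (cases "i = 0"; cases "i = ?k") (auto simp: IH B_cases)
  have row: "?b ?k j \<le> 0" for j
    using zero by (cases "j = 0"; cases "j = ?k") (auto simp: IH B_cases)
  have "snd (source_seed ?k) i j = mutate_matrix ?k ?b i j"
    by (simp add: source_seed_Suc mutate_def split: prod.split)
  also have "\<dots> = (if i = ?k \<or> j = ?k then - ?b i j else ?b i j)"
    using col[of i] row[of j] by (simp add: mutate_matrix_def)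
  finally show ?case
    using B_diag[of ?k] by (auto simp: IH le_Suc_eq)
qed

lemma source_seed_cluster:
  "m \<le> n \<Longrightarrow> fst (source_seed m) i = (if i \<in> {1..m} then yd i else yvar i)"
proof (induction m)
  case 0
  show ?case by (simp add: source_seed_def initial_seed_def)
next
  case (Suc m)
  have "fst (source_seed (Suc m)) i = fst (source_seed m) i" if "i \<noteq> Suc m"
    using that by (simp add: source_seed_Suc mutate_def split: prod.split)
  then show ?case using Suc.IH Suc.prems
    by (cases "i = Suc m") (simp add: y_dagger_source_seed, auto)
qed

text \<open>
  The nontrivial monomial of the exchange relation between \<open>y\<^sub>k\<close> and its dagger.
\<close>

definition exchange_monomial :: "nat \<Rightarrow> ratfun" where
  "exchange_monomial k = (\<Prod>i\<in>{1..<k}. yd i ^ arrows i k) * (\<Prod>i\<in>{k<..n}. yvar i ^ arrows k i)"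

lemma dagger_exchange:
  assumes "k \<in> I"
  shows "yvar k * yd k = exchange_monomial k + 1"
proof -
  obtain m where k: "k = Suc m" using assms by (cases k) auto
  have m: "m \<le> n" using assms k by simp
  have km: "i \<le> m \<longleftrightarrow> i < k" for i using k by auto
  let ?u = "fst (source_seed m)" and ?b = "snd (source_seed m)"
  have b: "?b i k = (if i < k then int (arrows i k) else int (arrows k i))" if "i \<in> I" for i
    unfolding source_seed_matrix[OF m] B_cases using that arrows_zero[of k k]
    by (cases "i = k") (auto simp: k)
  have "yd k = ((\<Prod>i\<in>{i\<in>I. ?b i k > 0}. ?u i ^ nat (?b i k)) + (\<Prod>i\<in>{i\<in>I. ?b i k < 0}. ?u i ^ nat (- ?b i k))) / ?u k"
    by (simp add: y_dagger_source_seed k source_seed_Suc mutate_def split: prod.split)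
  also have "?u k = yvar k"
    using source_seed_cluster[OF m, of k] by (simp add: k)
  also have "{i\<in>I. ?b i k < 0} = {}" using b by auto
  also have "(\<Prod>i\<in>{i\<in>I. ?b i k > 0}. ?u i ^ nat (?b i k)) = (\<Prod>i\<in>{1..<k} \<union> {k<..n}. ?u i ^ nat (?b i k))"
  proof (rule prod_positive_exponents)
    have "?b k k = 0" using b[OF assms] arrows_zero[of k k] by simp
    then have ne: "i \<noteq> k" if "?b i k > 0" for i using that by auto
    show "{i\<in>I. ?b i k > 0} \<subseteq> {1..<k} \<union> {k<..n}"
    proof
      fix i assume i: "i \<in> {i\<in>I. ?b i k > 0}"
      then have "i \<noteq> k" using ne by blast
      then show "i \<in> {1..<k} \<union> {k<..n}" using i by auto
    qed
  qed (use assms in auto)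
  also have "\<dots> = (\<Prod>i\<in>{1..<k}. ?u i ^ nat (?b i k)) * (\<Prod>i\<in>{k<..n}. ?u i ^ nat (?b i k))"
    by (rule prod.union_disjoint) auto
  also have "(\<Prod>i\<in>{1..<k}. ?u i ^ nat (?b i k)) = (\<Prod>i\<in>{1..<k}. yd i ^ arrows i k)"
    by (rule prod.cong) (use assms km in \<open>auto simp: b source_seed_cluster[OF m]\<close>)
  also have "(\<Prod>i\<in>{k<..n}. ?u i ^ nat (?b i k)) = (\<Prod>i\<in>{k<..n}. yvar i ^ arrows k i)"
    by (rule prod.cong) (use assms km in \<open>auto simp: b source_seed_cluster[OF m]\<close>)
  finally show ?thesis by (simp add: exchange_monomial_def)
qed

definition dagger_span :: "ratfun set" where
  "dagger_span = ratfun_span (dagger_monomial Q n ` dagger_exponents n)"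

definition dagger_product :: "(nat \<Rightarrow> nat) \<Rightarrow> (nat \<Rightarrow> nat) \<Rightarrow> ratfun" where
  "dagger_product p q = (\<Prod>i\<in>I. yvar i ^ p i * yd i ^ q i)"

lemma dagger_product_mult: "dagger_product p q * dagger_product p' q' = dagger_product (\<lambda>i. p i + p' i) (\<lambda>i. q i + q' i)"
  by (simp add: dagger_product_def power_add prod.distrib mult_ac)

lemma dagger_product_exchange_monomial: "k \<in> I \<Longrightarrow> exchange_monomial k = dagger_product (\<lambda>i. if i > k then arrows k i else 0) (\<lambda>i. if i < k then arrows i k else 0)"
proof -
  assume k: "k \<in> I"
  have "dagger_product (\<lambda>i. if i > k then arrows k i else 0) (\<lambda>i. if i < k then arrows i k else 0) =
      (\<Prod>i\<in>I. yvar i ^ (if i > k then arrows k i else 0)) * (\<Prod>i\<in>I. yd i ^ (if i < k then arrows i k else 0))"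
    by (simp only: dagger_product_def prod.distrib)
  also have "(\<Prod>i\<in>I. yvar i ^ (if i > k then arrows k i else 0)) = (\<Prod>i\<in>{k<..n}. yvar i ^ arrows k i)"
    by (rule prod.mono_neutral_cong_right) (use k in auto)
  also have "(\<Prod>i\<in>I. yd i ^ (if i < k then arrows i k else 0)) = (\<Prod>i\<in>{1..<k}. yd i ^ arrows i k)"
    by (rule prod.mono_neutral_cong_right) (use k in auto)
  finally show ?thesis by (simp add: exchange_monomial_def mult.commute)
qed

lemma dagger_product_single: "k \<in> I \<Longrightarrow> yvar k * yd k = dagger_product (\<lambda>i. if i = k then 1 else 0) (\<lambda>i. if i = k then 1 else 0)"
proof -
  assume k: "k \<in> I"
  have "dagger_product (\<lambda>i. if i = k then 1 else 0) (\<lambda>i. if i = k then 1 else 0) = (\<Prod>i\<in>{k}. yvar i * yd i)"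
    unfolding dagger_product_def by (rule prod.mono_neutral_cong_right) (use k in auto)
  then show ?thesis by simp
qed

text \<open>
  Weights for which both monomials on the right-hand side of the exchange relation are lighter than the
  left-hand side.  The weight of \<open>y\<^sub>i\<close> falls and the weight of its dagger grows rapidly with \<open>i\<close>, and the
  base exceeds the total number of arrows.
\<close>

definition weight_base :: nat where "weight_base = 1 + (\<Sum>i\<in>I. \<Sum>j\<in>I. arrows i j)"

definition weight :: "(nat \<Rightarrow> nat) \<Rightarrow> (nat \<Rightarrow> nat) \<Rightarrow> nat" where
  "weight p q = (\<Sum>i\<in>I. p i * weight_base ^ (n - i) + q i * weight_base ^ i)"

lemma sum_arrows_bound:
  assumes "f ` A \<subseteq> I \<times> I" "inj_on f A"
  shows "(\<Sum>i\<in>A. arrows (fst (f i)) (snd (f i))) < weight_base"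
proof -
  have "(\<Sum>i\<in>A. arrows (fst (f i)) (snd (f i))) = (\<Sum>x\<in>f ` A. arrows (fst x) (snd x))"
    using assms(2) by (simp add: sum.reindex)
  also have "\<dots> \<le> (\<Sum>x\<in>I \<times> I. arrows (fst x) (snd x))"
    using assms(1) by (intro sum_mono2) auto
  also have "\<dots> = (\<Sum>i\<in>I. \<Sum>j\<in>I. arrows i j)"
    by (simp add: sum.cartesian_product case_prod_beta)
  finally show ?thesis by (simp add: weight_base_def)
qed

lemma weight_exchange:
  assumes k: "k \<in> I"
  shows "weight (\<lambda>i. if i > k then arrows k i else 0) (\<lambda>i. if i < k then arrows i k else 0) < weight_base ^ (n - k) + weight_base ^ k"
proof -
  have base: "weight_base \<ge> 1" by (simp add: weight_base_def)
  have "weight (\<lambda>i. if i > k then arrows k i else 0) (\<lambda>i. if i < k then arrows i k else 0) =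
      (\<Sum>i\<in>I. (if i > k then arrows k i else 0) * weight_base ^ (n - i)) + (\<Sum>i\<in>I. (if i < k then arrows i k else 0) * weight_base ^ i)"
    by (simp only: weight_def sum.distrib)
  also have "(\<Sum>i\<in>I. (if i > k then arrows k i else 0) * weight_base ^ (n - i)) = (\<Sum>i\<in>{k<..n}. arrows k i * weight_base ^ (n - i))"
    by (rule sum.mono_neutral_cong_right) (use k in auto)
  also have "(\<Sum>i\<in>I. (if i < k then arrows i k else 0) * weight_base ^ i) = (\<Sum>i\<in>{1..<k}. arrows i k * weight_base ^ i)"
    by (rule sum.mono_neutral_cong_right) (use k in auto)
  also have "(\<Sum>i\<in>{k<..n}. arrows k i * weight_base ^ (n - i)) < weight_base ^ (n - k)"
  proof (cases "k = n")
    case True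
    then show ?thesis using base by simp
  next
    case False
    have "(\<Sum>i\<in>{k<..n}. arrows k i * weight_base ^ (n - i)) \<le> (\<Sum>i\<in>{k<..n}. arrows k i * weight_base ^ (n - k - 1))"
      using base by (intro sum_mono mult_left_mono power_increasing) auto
    also have "\<dots> = (\<Sum>i\<in>{k<..n}. arrows k i) * weight_base ^ (n - k - 1)"
      by (simp add: sum_distrib_right)
    also have "\<dots> < weight_base * weight_base ^ (n - k - 1)"
    proof (rule mult_strict_right_mono)
      have "(\<lambda>i. (k, i)) ` {k<..n} \<subseteq> I \<times> I" using k by auto
      from sum_arrows_bound[OF this] show "(\<Sum>i\<in>{k<..n}. arrows k i) < weight_base" by (simp add: inj_on_def)
    qed (use base in simp)
    also have "\<dots> = weight_base ^ (n - k)"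
      using False k by (simp flip: power_Suc add: Suc_diff_Suc)
    finally show ?thesis .
  qed
  also have "(\<Sum>i\<in>{1..<k}. arrows i k * weight_base ^ i) < weight_base ^ k"
  proof -
    have "(\<Sum>i\<in>{1..<k}. arrows i k * weight_base ^ i) \<le> (\<Sum>i\<in>{1..<k}. arrows i k * weight_base ^ (k - 1))"
      using base by (intro sum_mono mult_left_mono power_increasing) auto
    also have "\<dots> = (\<Sum>i\<in>{1..<k}. arrows i k) * weight_base ^ (k - 1)"
      by (simp add: sum_distrib_right)
    also have "\<dots> < weight_base * weight_base ^ (k - 1)"
    proof (rule mult_strict_right_mono)
      have "(\<lambda>i. (i, k)) ` {1..<k} \<subseteq> I \<times> I" using k by auto
      from sum_arrows_bound[OF this] show "(\<Sum>i\<in>{1..<k}. arrows i k) < weight_base" by (simp add: inj_on_def)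
    qed (use base in simp)
    also have "\<dots> = weight_base ^ k"
      using k by (simp flip: power_Suc)
    finally show ?thesis .
  qed
  finally show ?thesis by simp
qed

lemma weight_add: "weight (\<lambda>i. p i + p' i) (\<lambda>i. q i + q' i) = weight p q + weight p' q'"
  by (simp add: weight_def distrib_right sum.distrib)

text \<open>
  Replacing a factor \<open>y\<^sub>k y\<^sub>k\<^sup>\<dagger>\<close> by the right-hand side of the exchange relation lowers the weight, so
  the rewriting ends in dagger monomials.
\<close>

lemma dagger_product_in_dagger_span: "dagger_product p q \<in> dagger_span"
proof (induction "weight p q" arbitrary: p q rule: less_induct)
  case less
  show ?case
  proof (cases "\<forall>i\<in>I. p i * q i = 0")
    case True
    define x where "x = (restrict p I, restrict q I)"
    have "x \<in> dagger_exponents n"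
      using True by (auto simp: x_def dagger_exponents_def)
    moreover have "dagger_monomial Q n x = dagger_product p q"
      unfolding x_def dagger_monomial_def dagger_product_def by (auto intro!: prod.cong)
    ultimately show ?thesis unfolding dagger_span_def by (metis imageI ratfun.span_base)
  next
    case False
    then obtain k where k: "k \<in> I" "p k > 0" "q k > 0" by auto
    define p' q' where "p' = p(k := p k - 1)" and "q' = q(k := q k - 1)"
    let ?d = "\<lambda>i. if i = k then 1 else 0 :: nat"
    let ?p = "\<lambda>i. if i > k then arrows k i else 0" and ?q = "\<lambda>i. if i < k then arrows i k else 0"
    have pq: "p = (\<lambda>i. ?d i + p' i)" "q = (\<lambda>i. ?d i + q' i)"
      using k by (auto simp: p'_def q'_def)
    have "dagger_product p q = (yvar k * yd k) * dagger_product p' q'"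
      unfolding dagger_product_single[OF k(1)] dagger_product_mult using pq by simp
    also have "\<dots> = dagger_product (\<lambda>i. ?p i + p' i) (\<lambda>i. ?q i + q' i) + dagger_product p' q'"
      unfolding dagger_exchange[OF k(1)] by (simp only: distrib_right dagger_product_exchange_monomial[OF k(1)] dagger_product_mult mult_1_left)
    finally have eq: "dagger_product p q = dagger_product (\<lambda>i. ?p i + p' i) (\<lambda>i. ?q i + q' i) + dagger_product p' q'" .
    have "weight ?d ?d = weight_base ^ (n - k) + weight_base ^ k"
    proof -
      have "weight ?d ?d = (\<Sum>i\<in>{k}. weight_base ^ (n - i) + weight_base ^ i)"
        unfolding weight_def by (rule sum.mono_neutral_cong_right) (use k in auto)
      then show ?thesis by simp
    qed
    moreover have "weight p q = weight ?d ?d + weight p' q'"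
      unfolding weight_add[symmetric] using pq by simp
    ultimately have w: "weight p q = weight_base ^ (n - k) + weight_base ^ k + weight p' q'" by simp
    have "weight_base ^ k > 0" by (simp add: weight_base_def)
    then have "dagger_product p' q' \<in> dagger_span" by (intro less) (simp add: w)
    moreover have "dagger_product (\<lambda>i. ?p i + p' i) (\<lambda>i. ?q i + q' i) \<in> dagger_span"
      by (intro less) (use weight_exchange[OF k(1)] in \<open>simp add: w weight_add\<close>)
    ultimately show ?thesis unfolding eq dagger_span_def by (rule ratfun.span_add[rotated])
  qed
qed

lemma dagger_span_add: "x \<in> dagger_span \<Longrightarrow> y \<in> dagger_span \<Longrightarrow> x + y \<in> dagger_span"
  unfolding dagger_span_def by (rule ratfun.span_add)

lemma dagger_span_diff: "x \<in> dagger_span \<Longrightarrow> y \<in> dagger_span \<Longrightarrow> x - y \<in> dagger_span"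
  unfolding dagger_span_def by (rule ratfun.span_diff)

lemma dagger_span_scale: "x \<in> dagger_span \<Longrightarrow> const c * x \<in> dagger_span"
  unfolding dagger_span_def by (rule ratfun.span_scale)

lemma dagger_span_0: "0 \<in> dagger_span"
  unfolding dagger_span_def by (rule ratfun.span_zero)

lemma dagger_span_1: "1 \<in> dagger_span"
  using dagger_product_in_dagger_span[of "\<lambda>_. 0" "\<lambda>_. 0"] by (simp add: dagger_product_def)

lemma dagger_span_induct [consumes 1, case_names zero add]:
  assumes "x \<in> dagger_span" "R 0" "\<And>c p q y. R y \<Longrightarrow> R (const c * dagger_product p q + y)"
  shows "R x"
  using assms(1) unfolding dagger_span_def
proof (induction rule: ratfun.span_induct_alt)
  case (step c m y)
  then obtain p q where "m = dagger_product p q"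
    by (auto simp: dagger_monomial_def dagger_product_def)
  then show ?case using assms(3) step by simp
qed (rule assms(2))

lemma dagger_span_mult:
  assumes "x \<in> dagger_span" "y \<in> dagger_span"
  shows "x * y \<in> dagger_span"
  using assms(1)
proof (induction rule: dagger_span_induct)
  case (add c p q x)
  have "dagger_product p q * y \<in> dagger_span"
    using assms(2)
  proof (induction rule: dagger_span_induct)
    case (add c' p' q' y)
    have "dagger_product p q * (const c' * dagger_product p' q' + y) = const c' * dagger_product (\<lambda>i. p i + p' i) (\<lambda>i. q i + q' i) + dagger_product p q * y"
      by (simp add: distrib_left mult_ac flip: dagger_product_mult)
    then show ?case using add by (simp only: dagger_span_add dagger_span_scale dagger_product_in_dagger_span)
  qed (simp add: dagger_span_0)
  then show ?case using add by (simp add: distrib_right mult.assoc dagger_span_add dagger_span_scale)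
qed (simp add: dagger_span_0)

lemma dagger_span_power: "x \<in> dagger_span \<Longrightarrow> x ^ m \<in> dagger_span"
  by (induction m) (auto simp: dagger_span_1 dagger_span_mult)

lemma dagger_span_prod: "(\<And>i. i \<in> A \<Longrightarrow> f i \<in> dagger_span) \<Longrightarrow> prod f A \<in> dagger_span"
  by (induction A rule: infinite_finite_induct) (auto simp: dagger_span_1 dagger_span_mult)

lemma dagger_span_subalgebra: "is_subalgebra dagger_span"
  unfolding is_subalgebra_def
  using dagger_span_1 dagger_span_mult by (auto simp: dagger_span_def)

lemma dagger_span_yvar: "k \<in> I \<Longrightarrow> yvar k \<in> dagger_span" and dagger_span_yd: "k \<in> I \<Longrightarrow> yd k \<in> dagger_span"
proof -
  assume k: "k \<in> I"
  have "dagger_product (\<lambda>i. if i = k then 1 else 0) (\<lambda>_. 0) = (\<Prod>i\<in>{k}. yvar i)"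
    unfolding dagger_product_def by (rule prod.mono_neutral_cong_right) (use k in auto)
  then show "yvar k \<in> dagger_span" using dagger_product_in_dagger_span by (metis prod.insert finite.emptyI empty_iff prod.empty mult_1_right)
next
  assume k: "k \<in> I"
  have "dagger_product (\<lambda>_. 0) (\<lambda>i. if i = k then 1 else 0) = (\<Prod>i\<in>{k}. yd i)"
    unfolding dagger_product_def by (rule prod.mono_neutral_cong_right) (use k in auto)
  then show "yd k \<in> dagger_span" using dagger_product_in_dagger_span by (metis prod.insert finite.emptyI empty_iff prod.empty mult_1_right)
qed

lemma ev_principal_z:
  assumes k: "k \<in> I"
  shows "ev (specialize I yvar) (z k) * yvar k = (\<Prod>i\<in>{k<..n}. yvar i ^ arrows k i) + (\<Prod>i\<in>{1..<k}. yvar i ^ arrows i k)"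
proof -
  have nz: "specialize I yvar i \<noteq> 0" for i by (simp add: specialize_def)
  have "ev (specialize I yvar) (z k) * ev (specialize I yvar) (X (\<epsilon> k)) = ev (specialize I yvar) (P k)"
    by (simp only: ev_mult[OF nz, symmetric] z_mult)
  moreover have "ev (specialize I yvar) (X (\<epsilon> k)) = yvar k"
    using k by (simp add: ev_single ev_monomial_single specialize_def)
  moreover have "ev (specialize I yvar) (P k) = (\<Prod>i\<in>{i\<in>I. B_matrix Q i k > 0}. yvar i ^ nat (B_matrix Q i k)) +
      (\<Prod>i\<in>{i\<in>I. B_matrix Q i k < 0}. yvar i ^ nat (- B_matrix Q i k))"
    by (rule ev_specialize_exchange_poly) (use k in \<open>auto simp: principal_def\<close>)
  moreover have "(\<Prod>i\<in>{i\<in>I. B_matrix Q i k > 0}. yvar i ^ nat (B_matrix Q i k)) = (\<Prod>i\<in>{k<..n}. yvar i ^ nat (B_matrix Q i k))"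
    by (rule prod_positive_exponents) (use k in \<open>auto simp: B_cases split: if_splits\<close>)
  moreover have "(\<Prod>i\<in>{i\<in>I. - B_matrix Q i k > 0}. yvar i ^ nat (- B_matrix Q i k)) = (\<Prod>i\<in>{1..<k}. yvar i ^ nat (- B_matrix Q i k))"
  proof (rule prod_positive_exponents)
    have "B_matrix Q i k \<ge> 0" if "k \<le> i" for i
      using that B_diag[of k] by (cases "i = k") (auto simp: B_cases)
    then have "i < k" if "- B_matrix Q i k > 0" for i
      using that by (meson neg_0_less_iff_less not_less)
    then show "{i\<in>I. - B_matrix Q i k > 0} \<subseteq> {1..<k}" by auto
  qed (use k in auto)
  moreover have "(\<Prod>i\<in>{k<..n}. yvar i ^ nat (B_matrix Q i k)) = (\<Prod>i\<in>{k<..n}. yvar i ^ arrows k i)"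
    by (rule prod.cong) (auto simp: B_lower)
  moreover have "(\<Prod>i\<in>{1..<k}. yvar i ^ nat (- B_matrix Q i k)) = (\<Prod>i\<in>{1..<k}. yvar i ^ arrows i k)"
    by (rule prod.cong) (auto simp: B_upper)
  ultimately show ?thesis by simp
qed

text \<open>
  With \<open>A\<close> and \<open>B\<close> the products over the later and the earlier neighbours of \<open>k\<close>, one has \<open>y\<^sub>k z\<^sub>k = A + B\<close>
  and \<open>y\<^sub>k B y\<^sub>k\<^sup>\<dagger> = B + A \<Prod>\<^bsub>i<k\<^esub> (y\<^sub>i y\<^sub>i\<^sup>\<dagger>)\<^bsup>a(i,k)\<^esup>\<close>.  If \<open>i\<close> is joined to \<open>k\<close>, then \<open>y\<^sub>i y\<^sub>i\<^sup>\<dagger>\<close> is 1 plus a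
  multiple of \<open>y\<^sub>k\<close>, so the right-hand sides differ by a multiple of \<open>y\<^sub>k\<close>, which can be cancelled.
\<close>

lemma ev_z_in_dagger_span:
  assumes k: "k \<in> I"
  shows "ev (specialize I yvar) (z k) \<in> dagger_span"
proof -
  define above below where "above = (\<Prod>i\<in>{k<..n}. yvar i ^ arrows k i)" and "below = (\<Prod>i\<in>{1..<k}. yvar i ^ arrows i k)"
  have above: "above \<in> dagger_span" and below: "below \<in> dagger_span"
    unfolding above_def below_def by (intro dagger_span_prod dagger_span_power dagger_span_yvar; use k in auto)+
  \<comment> \<open>The elements congruent to 1 modulo \<open>y\<^sub>k\<close>, closed under products.\<close>
  define W where "W = {x. \<exists>v\<in>dagger_span. x = 1 + yvar k * v}"
  have W_mult: "x * y \<in> W" if "x \<in> W" "y \<in> W" for x y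
  proof -
    obtain v w where "v \<in> dagger_span" "w \<in> dagger_span" "x = 1 + yvar k * v" "y = 1 + yvar k * w"
      using \<open>x \<in> W\<close> \<open>y \<in> W\<close> unfolding W_def by blast
    moreover from this have "x * y = 1 + yvar k * (v + w + yvar k * v * w)"
      by (simp add: algebra_simps)
    ultimately show ?thesis unfolding W_def using k by (blast intro: dagger_span_add dagger_span_mult dagger_span_yvar)
  qed
  have W_1: "1 \<in> W" unfolding W_def using dagger_span_0 by force
  have W_power: "x ^ m \<in> W" if "x \<in> W" for x m
    by (induction m) (auto simp: W_1 W_mult that)
  have W_prod: "prod f A \<in> W" if "\<And>i. i \<in> A \<Longrightarrow> f i \<in> W" for f and A :: "nat set"
    using that by (induction A rule: infinite_finite_induct) (auto simp: W_1 W_mult)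
  have "(yvar i * yd i) ^ arrows i k \<in> W" if i: "i \<in> {1..<k}" for i
  proof (cases "arrows i k = 0")
    case True
    then show ?thesis by (simp add: W_1)
  next
    case False
    have iI: "i \<in> I" using i k by auto
    have "(\<Prod>j\<in>{i<..n}. yvar j ^ arrows i j) = yvar k ^ arrows i k * (\<Prod>j\<in>{i<..n} - {k}. yvar j ^ arrows i j)"
      using i k by (intro prod.remove) auto
    moreover have "yvar k ^ arrows i k = yvar k * yvar k ^ (arrows i k - 1)"
      using False by (simp flip: power_Suc)
    ultimately have exchange_monomial: "exchange_monomial i = yvar k * (yvar k ^ (arrows i k - 1) * (\<Prod>j\<in>{i<..n} - {k}. yvar j ^ arrows i j) * (\<Prod>j\<in>{1..<i}. yd j ^ arrows j i))"
      by (simp only: exchange_monomial_def mult_ac)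
    have "yvar k ^ (arrows i k - 1) * (\<Prod>j\<in>{i<..n} - {k}. yvar j ^ arrows i j) * (\<Prod>j\<in>{1..<i}. yd j ^ arrows j i) \<in> dagger_span"
      using iI k by (intro dagger_span_mult dagger_span_prod dagger_span_power dagger_span_yvar dagger_span_yd) auto
    then have "yvar i * yd i \<in> W"
      unfolding W_def dagger_exchange[OF iI] exchange_monomial by (auto simp: add.commute)
    then show ?thesis by (rule W_power)
  qed
  then have "(\<Prod>i\<in>{1..<k}. (yvar i * yd i) ^ arrows i k) \<in> W" by (rule W_prod)
  then obtain v where v: "v \<in> dagger_span" "(\<Prod>i\<in>{1..<k}. (yvar i * yd i) ^ arrows i k) = 1 + yvar k * v"
    unfolding W_def by blast
  have "below * exchange_monomial k = above * (\<Prod>i\<in>{1..<k}. (yvar i * yd i) ^ arrows i k)"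
    by (simp add: exchange_monomial_def above_def below_def power_mult_distrib prod.distrib mult_ac)
  then have "below * (yvar k * yd k) = above * (1 + yvar k * v) + below"
    unfolding dagger_exchange[OF k] v(2) by (simp add: distrib_left)
  also have "\<dots> = (ev (specialize I yvar) (z k) + above * v) * yvar k"
    unfolding distrib_right ev_principal_z[OF k] by (simp add: above_def below_def algebra_simps)
  finally have "(below * yd k) * yvar k = (ev (specialize I yvar) (z k) + above * v) * yvar k"
    by (simp add: mult_ac)
  then have "ev (specialize I yvar) (z k) = below * yd k - above * v" by simp
  also have "\<dots> \<in> dagger_span" using k by (intro dagger_span_diff dagger_span_mult above below v dagger_span_yd)
  finally show ?thesis .
qed

lemma ev_lower_bound_in_dagger_span:
  assumes "f \<in> lower_bound I I"
  shows "ev (specialize I yvar) f \<in> dagger_span"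
  using assms
proof (induction rule: lower_bound_induct)
  case (add e c q f)
  have nz: "specialize I yvar i \<noteq> 0" for i by (simp add: specialize_def)
  have "specialize I yvar i powi lookup e i \<in> dagger_span" for i
    using add(1)[of i] dagger_span_power[OF dagger_span_yvar[of i], of "nat (lookup e i)"] dagger_span_1
    by (cases "i \<in> I") (simp_all add: specialize_def power_int_def)
  then have "ev_monomial (specialize I yvar) e \<in> dagger_span"
    unfolding ev_monomial_def by (intro dagger_span_prod)
  moreover have "(\<Prod>k\<in>I. ev (specialize I yvar) (z k) ^ q k) \<in> dagger_span"
    by (intro dagger_span_prod dagger_span_power ev_z_in_dagger_span)
  ultimately have "const c * (ev_monomial (specialize I yvar) e * (\<Prod>k\<in>I. ev (specialize I yvar) (z k) ^ q k)) \<in> dagger_span"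
    by (intro dagger_span_scale dagger_span_mult)
  moreover have "ev (specialize I yvar) (single e c * (\<Prod>k\<in>I. z k ^ q k)) =
    const c * (ev_monomial (specialize I yvar) e * (\<Prod>k\<in>I. ev (specialize I yvar) (z k) ^ q k))"
    by (simp only: ev_mult[OF nz] ev_prod[OF nz] ev_power[OF nz] ev_single mult.assoc)
  ultimately show ?case using add(3) by (simp only: ev_add dagger_span_add)
qed (simp add: dagger_span_0)

theorem cluster_algebra_eq_dagger_span: "cluster_algebra Q = dagger_span"
proof
  show "cluster_algebra Q \<subseteq> dagger_span"
    unfolding cluster_algebra_def
  proof (rule hull_minimal[where S = is_subalgebra, OF _ dagger_span_subalgebra])
    show "cluster_variables Q \<subseteq> dagger_span"
    proof
      fix x assume "x \<in> cluster_variables Q"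
      then obtain s i where s: "x = fst s i" "s \<in> mutation_class I (yvar, B_matrix Q)" "i \<in> I"
        unfolding cluster_variables_def initial_seed_def verts by blast
      obtain h where h: "h \<in> upper_bound" "x = ev (specialize I yvar) h"
        using cluster_variable_upper_bound[OF s(2) _ s(3)] s(1) by (auto simp: principal_def)
      then show "x \<in> dagger_span" using upper_bound_subset_lower_bound ev_lower_bound_in_dagger_span by blast
    qed
  qed
next
  show "dagger_span \<subseteq> cluster_algebra Q"
    unfolding cluster_algebra_def hull_def
  proof safe
    fix x t assume x: "x \<in> dagger_span" and t: "is_subalgebra t" "cluster_variables Q \<subseteq> t"
    have yvar: "yvar i \<in> t" if "i \<in> I" for i
    proof -
      have "yvar i = fst (initial_seed Q) i" by (simp add: initial_seed_def)
      then have "yvar i \<in> cluster_variables Q"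
        unfolding cluster_variables_def verts using that mutation_class.initial by blast
      then show ?thesis using t by blast
    qed
    have yd: "yd i \<in> t" if "i \<in> I" for i
    proof -
      have "yd i \<in> cluster_variables Q"
        unfolding cluster_variables_def verts y_dagger_source_seed
        using that source_seed_mutation_class[of i] by (intro CollectI exI[of _ "source_seed i"] exI[of _ i]) auto
      then show ?thesis using t by blast
    qed
    have one: "1 \<in> t" and mult: "\<And>x y. x \<in> t \<Longrightarrow> y \<in> t \<Longrightarrow> x * y \<in> t" and sub: "ratfun_subspace t"
      using t(1) by (auto simp: is_subalgebra_def)
    have power: "x ^ m \<in> t" if "x \<in> t" for x m
      by (induction m) (auto simp: one mult that)
    have "(\<Prod>i\<in>A. yvar i ^ p i * yd i ^ q i) \<in> t" if "A \<subseteq> I" for A p q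
      using that by (induction A rule: infinite_finite_induct) (auto simp: one intro!: mult power yvar yd)
    then have "dagger_monomial Q n ` dagger_exponents n \<subseteq> t"
      by (auto simp: dagger_monomial_def)
    then show "x \<in> t" using ratfun.span_minimal[OF _ sub] x unfolding dagger_span_def by blast
  qed
qed

end

section \<open>Linear independence of the dagger monomials\<close>

interpretation reverse_order: monomial_order uminus
  by standard auto

context ordered_quiver
begin

text \<open>
  If \<open>k\<close> has earlier neighbours, the dagger of the least one, \<open>i\<close>, has leading exponent \<open>-1\<close> at \<open>i\<close>, so the nontrivial
  monomial of the exchange relation is smaller than 1 and \<open>y\<^sub>k\<^sup>-\<^sup>1\<close> leads.  Otherwise that
  monomial involves later variables only.
\<close>

lemma dagger_trailing:
  "k \<in> I \<Longrightarrow> \<exists>Y w. ev yvar Y = yd k \<and> reverse_order.trailing Y (w - \<epsilon> k) \<and> (\<forall>i\<le>k. lookup w i = 0)"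
proof (induction k rule: less_induct)
  case (less k)
  have "\<forall>i\<in>{1..<k}. \<exists>Y w. ev yvar Y = yd i \<and> reverse_order.trailing Y (w - \<epsilon> i) \<and> (\<forall>j\<le>i. lookup w j = 0)"
    using less by auto
  then obtain Y w where Y: "\<And>i. i \<in> {1..<k} \<Longrightarrow> ev yvar (Y i) = yd i"
    "\<And>i. i \<in> {1..<k} \<Longrightarrow> reverse_order.trailing (Y i) (w i - \<epsilon> i)"
    "\<And>i j. i \<in> {1..<k} \<Longrightarrow> j \<le> i \<Longrightarrow> lookup (w i) j = 0"
    by metis
  define \<nu> where "\<nu> = (\<Sum>i\<in>{k<..n}. single i (int (arrows k i)))"
  define T where "T = (\<Prod>i\<in>{1..<k}. Y i ^ arrows i k) * X \<nu>"
  define \<tau> where "\<tau> = (\<Sum>i\<in>{1..<k}. frag_cmul (int (arrows i k)) (w i - \<epsilon> i)) + \<nu>"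
  have \<nu>: "lookup \<nu> i = (if i \<in> {k<..n} then int (arrows k i) else 0)" for i
    by (simp add: \<nu>_def lookup_sum lookup_single when_def)
  have "ev_monomial yvar \<nu> = (\<Prod>i\<in>{k<..n}. yvar i powi lookup \<nu> i)"
    by (rule ev_monomial_superset) (auto simp: in_keys_iff \<nu> split: if_splits)
  also have "\<dots> = (\<Prod>i\<in>{k<..n}. yvar i ^ arrows k i)"
    by (rule prod.cong) (auto simp: \<nu>)
  finally have T: "ev yvar T = exchange_monomial k"
    by (simp add: T_def exchange_monomial_def ev_mult ev_prod ev_power ev_single Y(1))
  have trailing_T: "reverse_order.trailing T \<tau>"
    unfolding T_def \<tau>_def
    by (intro reverse_order.trailing_mult reverse_order.trailing_prod reverse_order.trailing_power
        reverse_order.trailing_single Y(2)) auto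
  have ev: "ev yvar (X (- \<epsilon> k) * (T + 1)) = yd k"
  proof -
    have "ev yvar (X (- \<epsilon> k) * (T + 1)) = (exchange_monomial k + 1) / yvar k"
      by (simp add: ev_mult ev_add ev_single ev_monomial_def T divide_inverse mult.commute)
    then show ?thesis using dagger_exchange[OF less.prems] by (metis nonzero_mult_div_cancel_left yvar_nonzero)
  qed
  have "\<exists>w. reverse_order.trailing (T + 1) w \<and> (\<forall>i\<le>k. lookup w i = 0)"
  proof (cases "\<exists>i\<in>{1..<k}. arrows i k \<noteq> 0")
    case False
    then have "T = X \<nu>" unfolding T_def by simp
    have "\<nu> \<ge> 0"
    proof (rule ccontr)
      assume "\<not> \<nu> \<ge> 0"
      then have "\<nu> < 0" by simp
      then obtain i where "lookup \<nu> i < 0"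
        by (auto simp: less_poly_mapping.rep_eq less_fun_def)
      then show False by (simp add: \<nu> split: if_splits)
    qed
    show ?thesis
    proof (intro exI[of _ \<nu>] conjI)
      show "reverse_order.trailing (T + 1) \<nu>"
      proof (cases "\<nu> = 0")
        case True
        have "T + 1 = single 0 2"
          unfolding \<open>T = X \<nu>\<close> True by simp
        then show ?thesis using True reverse_order.trailing_single[of 2 0] by simp
      next
        case False
        then show ?thesis
          unfolding \<open>T = X \<nu>\<close>
          by (intro reverse_order.trailing_sum reverse_order.trailing_single) (use \<open>\<nu> \<ge> 0\<close> in auto)
      qed
    qed (simp add: \<nu>)
  next
    case True
    \<comment> \<open>The least earlier neighbour of \<open>k\<close> decides the comparison with 1.\<close>
    define i0 where "i0 = (LEAST i. i \<in> {1..<k} \<and> arrows i k \<noteq> 0)"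
    have "\<exists>i. i \<in> {1..<k} \<and> arrows i k \<noteq> 0" using True by blast
    then have i0: "i0 \<in> {1..<k}" "arrows i0 k \<noteq> 0"
      unfolding i0_def by (metis (mono_tags, lifting) LeastI_ex)+
    have least: "arrows i k = 0" if "i \<in> {1..<k}" "i < i0" for i
      using not_less_Least[of i "\<lambda>i. i \<in> {1..<k} \<and> arrows i k \<noteq> 0"] that unfolding i0_def by blast
    have lookup_\<tau>: "lookup \<tau> j = - (if j = i0 then int (arrows j k) else 0)" if "j \<le> i0" for j
    proof -
      have "lookup \<tau> j = (\<Sum>i\<in>{1..<k}. int (arrows i k) * (lookup (w i) j - lookup (\<epsilon> i) j))"
        using that i0 by (simp add: \<tau>_def lookup_add lookup_sum lookup_minus \<nu>)
      also have "\<dots> = (\<Sum>i\<in>{1..<k}. if i = j then - (if j = i0 then int (arrows j k) else 0) else 0)"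
      proof (rule sum.cong[OF refl])
        fix i assume i: "i \<in> {1..<k}"
        show "int (arrows i k) * (lookup (w i) j - lookup (\<epsilon> i) j) = (if i = j then - (if j = i0 then int (arrows j k) else 0) else 0)"
        proof (cases "i < i0")
          case True
          then show ?thesis using least[OF i] by auto
        next
          case False
          then show ?thesis using that Y(3)[OF i, of j] by (auto simp: lookup_single when_def)
        qed
      qed
      also have "\<dots> = - (if j = i0 then int (arrows j k) else 0)"
        using i0(1) by (auto simp: sum.delta)
      finally show ?thesis .
    qed
    have "less_fun (lookup \<tau>) (lookup 0)"
      unfolding less_fun_def
      by (rule exI[of _ i0]) (use lookup_\<tau> i0(2) in auto)
    then have neg: "\<tau> < 0" by (simp add: less_poly_mapping.rep_eq)
    show ?thesis
    proof (intro exI[of _ 0] conjI)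
      have "reverse_order.trailing (1 + T) 0"
      proof (rule reverse_order.trailing_sum)
        show "reverse_order.trailing 1 0" using reverse_order.trailing_single[of 1 0] by simp
        show "- 0 < - e" if "e \<in> keys T" for e
          using that trailing_T neg by (auto simp: reverse_order.trailing_def)
      qed
      then show "reverse_order.trailing (T + 1) 0" by (simp add: add.commute)
    qed simp
  qed
  then obtain w' where w': "reverse_order.trailing (T + 1) w'" "\<forall>i\<le>k. lookup w' i = 0" by blast
  have "reverse_order.trailing (X (- \<epsilon> k) * (T + 1)) (- \<epsilon> k + w')"
    by (intro reverse_order.trailing_mult reverse_order.trailing_single w') simp
  then have "reverse_order.trailing (X (- \<epsilon> k) * (T + 1)) (w' - \<epsilon> k)" by simp
  then show ?case using ev w'(2) by blast
qed

text \<open>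
  A pair \<open>(p, q)\<close> with \<open>p\<^sub>i q\<^sub>i = 0\<close> is determined by the difference \<open>p - q\<close>.
\<close>

definition exponent_difference :: "(nat \<Rightarrow> nat) \<times> (nat \<Rightarrow> nat) \<Rightarrow> nat \<Rightarrow>\<^sub>0 int" where
  "exponent_difference x = (\<Sum>i\<in>I. single i (int (fst x i) - int (snd x i)))"

lemma lookup_exponent_difference:
  "lookup (exponent_difference x) i = (if i \<in> I then int (fst x i) - int (snd x i) else 0)"
  by (simp add: exponent_difference_def lookup_sum lookup_single when_def)

lemma exponent_difference_parts:
  assumes "x \<in> dagger_exponents n" "i \<in> I"
  shows "fst x i = nat (lookup (exponent_difference x) i)" "snd x i = nat (- lookup (exponent_difference x) i)"
proof -
  have "fst x i * snd x i = 0" using assms by (auto simp: dagger_exponents_def)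
  then show "fst x i = nat (lookup (exponent_difference x) i)" "snd x i = nat (- lookup (exponent_difference x) i)"
    using assms(2) by (auto simp: lookup_exponent_difference)
qed

lemma exponent_difference_inj: "inj_on exponent_difference (dagger_exponents n)"
proof (rule inj_onI)
  fix x y assume xy: "x \<in> dagger_exponents n" "y \<in> dagger_exponents n"
    "exponent_difference x = exponent_difference y"
  have "fst x = fst y" "snd x = snd y"
  proof -
    show "fst x = fst y"
    proof (rule PiE_ext)
      show "fst x \<in> I \<rightarrow>\<^sub>E UNIV" "fst y \<in> I \<rightarrow>\<^sub>E UNIV"
        using xy(1,2) by (auto simp: dagger_exponents_def)
      show "fst x i = fst y i" if "i \<in> I" for i
        using exponent_difference_parts(1)[OF xy(1) that] exponent_difference_parts(1)[OF xy(2) that] xy(3) by simp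
    qed
    show "snd x = snd y"
    proof (rule PiE_ext)
      show "snd x \<in> I \<rightarrow>\<^sub>E UNIV" "snd y \<in> I \<rightarrow>\<^sub>E UNIV"
        using xy(1,2) by (auto simp: dagger_exponents_def)
      show "snd x i = snd y i" if "i \<in> I" for i
        using exponent_difference_parts(2)[OF xy(1) that] exponent_difference_parts(2)[OF xy(2) that] xy(3) by simp
    qed
  qed
  then show "x = y" by (rule prod_eqI)
qed

theorem dagger_basis:
  "inj_on (dagger_monomial Q n) (dagger_exponents n)"
  "\<not> ratfun_dependent (dagger_monomial Q n ` dagger_exponents n)"
proof -
  let ?E = "dagger_exponents n" and ?m = "dagger_monomial Q n" and ?r = exponent_difference
  have "\<forall>k\<in>I. \<exists>Y w. ev yvar Y = yd k \<and> reverse_order.trailing Y (w - \<epsilon> k) \<and> (\<forall>i\<le>k. lookup w i = 0)"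
    using dagger_trailing by blast
  then obtain Y w where Y: "\<And>k. k \<in> I \<Longrightarrow> ev yvar (Y k) = yd k"
    "\<And>k. k \<in> I \<Longrightarrow> reverse_order.trailing (Y k) (w k - \<epsilon> k)"
    "\<And>k i. k \<in> I \<Longrightarrow> i \<le> k \<Longrightarrow> lookup (w k) i = 0"
    by metis
  interpret triangular_family uminus I Y w
    by standard (use Y in auto)
  have monomial: "ev yvar (standard (?r x)) = ?m x" if x: "x \<in> ?E" for x
  proof -
    have "?r x + (\<Sum>k\<in>I. single k (max 0 (- lookup (?r x) k))) = (\<Sum>i\<in>I. single i (int (fst x i)))"
    proof (rule poly_mapping_eqI)
      fix i
      have "max 0 (- lookup (?r x) i) = int (snd x i)" if "i \<in> I"
        using exponent_difference_parts(2)[OF x that] by simp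
      then show "lookup (?r x + (\<Sum>k\<in>I. single k (max 0 (- lookup (?r x) k)))) i =
          lookup (\<Sum>i\<in>I. single i (int (fst x i))) i"
        by (auto simp: lookup_add lookup_sum lookup_single when_def lookup_exponent_difference)
    qed
    moreover have "ev_monomial yvar (\<Sum>i\<in>I. single i (int (fst x i))) = (\<Prod>i\<in>I. yvar i ^ fst x i)"
    proof -
      have "ev_monomial yvar (\<Sum>i\<in>A. single i (int (fst x i))) = (\<Prod>i\<in>A. yvar i ^ fst x i)" for A
        by (induction A rule: infinite_finite_induct) (auto simp: ev_monomial_add ev_monomial_single)
      then show ?thesis .
    qed
    moreover have "(\<Prod>k\<in>I. yd k ^ nat (- lookup (?r x) k)) = (\<Prod>k\<in>I. yd k ^ snd x k)"
      by (rule prod.cong) (use exponent_difference_parts(2)[OF x] in auto)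
    moreover have "(\<Prod>k\<in>I. ev yvar (Y k) ^ nat (- lookup (?r x) k)) = (\<Prod>k\<in>I. yd k ^ nat (- lookup (?r x) k))"
      by (rule prod.cong) (auto simp: Y(1))
    ultimately have "ev yvar (standard (?r x)) = (\<Prod>i\<in>I. yvar i ^ fst x i) * (\<Prod>k\<in>I. yd k ^ snd x k)"
      by (simp only: standard_def ev_mult[OF yvar_nonzero] ev_prod[OF yvar_nonzero] ev_power[OF yvar_nonzero]
          ev_single const_1 mult_1_left)
    then show ?thesis
      by (simp add: dagger_monomial_def case_prod_beta prod.distrib)
  qed
  have standard_inj: "r = r'" if "standard r = standard r'" for r r'
  proof -
    have "- exponent r = - exponent r'"
      using trailing_standard[of r] trailing_standard[of r'] that
      unfolding reverse_order.trailing_def by (metis order_antisym)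
    then show ?thesis using exponent_inj by simp
  qed
  show inj: "inj_on ?m ?E"
  proof (rule inj_onI)
    fix x y assume xy: "x \<in> ?E" "y \<in> ?E" "?m x = ?m y"
    then have "ev yvar (standard (?r x)) = ev yvar (standard (?r y))" by (simp only: monomial)
    then have "?r x = ?r y" by (intro standard_inj ev_yvar_inj)
    then show "x = y" using exponent_difference_inj xy by (auto dest: inj_onD)
  qed
  show "\<not> ratfun_dependent (?m ` ?E)"
  proof
    assume "ratfun_dependent (?m ` ?E)"
    then obtain S u where S: "finite S" "S \<subseteq> ?m ` ?E" "\<exists>v\<in>S. u v \<noteq> 0" "(\<Sum>v\<in>S. const (u v) * v) = 0"
      unfolding ratfun.dependent_explicit by blast
    define F where "F = {x\<in>?E. ?m x \<in> S \<and> u (?m x) \<noteq> 0}"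
    define c where "c r = u (ev yvar (standard r))" for r
    have mF: "?m ` F = {v\<in>S. u v \<noteq> 0}"
      using S(2) by (auto simp: F_def)
    have injF: "inj_on ?m F" by (rule inj_on_subset[OF inj]) (auto simp: F_def)
    have "finite (?m ` F)" unfolding mF using S(1) by simp
    then have finF: "finite F" using injF by (rule finite_imageD)
    have injr: "inj_on ?r F" by (rule inj_on_subset[OF exponent_difference_inj]) (auto simp: F_def)
    have "F \<noteq> {}" using S(3) mF by auto
    have c: "c (?r x) = u (?m x)" if "x \<in> F" for x
      using monomial[of x] that by (simp add: c_def F_def)
    have "ev yvar (\<Sum>r\<in>?r ` F. single 0 (c r) * standard r) =
        (\<Sum>r\<in>?r ` F. const (c r) * ev yvar (standard r))"
      by (simp add: ev_sum ev_mult ev_single)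
    also have "\<dots> = (\<Sum>x\<in>F. const (c (?r x)) * ev yvar (standard (?r x)))"
      by (simp add: sum.reindex[OF injr])
    also have "\<dots> = (\<Sum>x\<in>F. const (u (?m x)) * ?m x)"
      by (rule sum.cong) (use monomial c in \<open>auto simp: F_def\<close>)
    also have "\<dots> = (\<Sum>v\<in>?m ` F. const (u v) * v)"
      by (simp add: sum.reindex[OF injF])
    also have "\<dots> = (\<Sum>v\<in>S. const (u v) * v)"
      unfolding mF by (rule sum.mono_neutral_left) (use S(1) in auto)
    finally have "(\<Sum>r\<in>?r ` F. single 0 (c r) * standard r) = 0"
      unfolding S(4) by (rule ev_yvar_eq_0)
    moreover have "\<exists>r\<in>?r ` F. exponent r \<in> keys (\<Sum>r\<in>?r ` F. single 0 (c r) * standard r)"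
      by (rule standard_independent) (use finF \<open>F \<noteq> {}\<close> c in \<open>auto simp: F_def\<close>)
    ultimately show False by simp
  qed
qed

end

theorem theorem16p3:
  fixes Q :: "(nat, 'e) pre_digraph" and n :: nat
  assumes "fin_digraph Q"
    and "verts Q = {1..n}"
    and "connected Q"
    and "acyclic (arcs_ends Q)"
    and "\<And>e. e \<in> arcs Q \<Longrightarrow> tail Q e < head Q e"
    and "\<not> linearly_oriented_A Q"
  shows "inj_on (dagger_monomial Q n) (dagger_exponents n) \<and>
         \<not> ratfun_dependent (dagger_monomial Q n ` dagger_exponents n) \<and>
         ratfun_span (dagger_monomial Q n ` dagger_exponents n) = cluster_algebra Q"
proof -
  interpret ordered_quiver Q n
    by (rule ordered_quiver.intro) (use assms(1,2,5) in auto)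
  show ?thesis
    using dagger_basis cluster_algebra_eq_dagger_span unfolding dagger_span_def by simp
qed

end
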